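(* The system $Z_2(A)=\langle P_1,P_2\rangle$ in the two variables $(t_1,t_2)$ is of rank $6$. Its singular locus in $\mathbb{P}^1\times\mathbb{P}^1$ is given by $$t_i=\pm1,\ \infty\ (i=1,2),\qquad t_1=t_2.$$
   Context: Let $A=(A_0,A_1,A_2,A_3)$ be complex parameters, $a_0=2A_0-3$, $a_i=A_i^2-(A_0-1)^2$ ($i=1,2,3$), and $\partial_i=\partial/\partial t_i$, $\partial_{ij}=\partial_i\partial_j$, $\partial_{ijk}=\partial_i\partial_j\partial_k$. The system $Z_2(A)$ is generated by $$P_1=(1-t_1^2)\partial_{11}+2(1-t_1t_2)\partial_{12}+(1-t_2^2)\partial_{22}+a_0(t_1\partial_1+t_2\partial_2)+a_3,$$ $$P_2=2(t_1-t_2)\{(1-t_2^2)\partial_{122}+a_0t_2\partial_{12}+a_1\partial_1+(1-t_1^2)\partial_{112}+a_0t_1\partial_{12}+a_2\partial_2\}$$ $$\qquad-(2+a_0)\{(1-t_2^2)\partial_{22}+a_0t_2\partial_2+a_1-(1-t_1^2)\partial_{11}-a_0t_1\partial_1-a_2\}.$$ The rank is the dimension of the space of local holomorphic solutions at a generic point. *)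

theory Defs
  imports "HOL-Analysis.Analysis" "HOL-Library.Poly_Mapping"
    "HOL-Computational_Algebra.Polynomial"
begin

section \<open>Polynomials in two variables\<close>

text \<open>The ring of polynomials in \<open>t1, t2\<close> is \<open>\<complex>[t1][t2]\<close>: the outer variable is \<open>t2\<close>.\<close>

type_synonym poly2 = "complex poly poly"

definition t1 :: poly2 where "t1 = [:[:0, 1:]:]"
definition t2 :: poly2 where "t2 = [:0, 1:]"
definition cst :: "complex \<Rightarrow> poly2" where "cst c = [:[:c:]:]"

definition eval2 :: "poly2 \<Rightarrow> complex \<times> complex \<Rightarrow> complex" where
  "eval2 p = (\<lambda>(x, y). poly (poly p [:y:]) x)"

definition pd1 :: "poly2 \<Rightarrow> poly2" where "pd1 p = map_poly pderiv p"
definition pd2 :: "poly2 \<Rightarrow> poly2" where "pd2 p = pderiv p"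

section \<open>The Weyl algebra in two variables\<close>

text \<open>
  An element of the Weyl algebra in normal form \<open>\<Sum> c\<^sub>i\<^sub>j \<partial>\<^sub>1\<^sup>i \<partial>\<^sub>2\<^sup>j\<close> is the finitely supported
  family of its coefficients.  The convolution product that \<open>Poly_Mapping\<close> provides is not
  the product of the Weyl algebra and is not used.
\<close>

type_synonym diffop = "(nat \<times> nat) \<Rightarrow>\<^sub>0 poly2"

definition dop :: "poly2 \<Rightarrow> nat \<Rightarrow> nat \<Rightarrow> diffop" where
  "dop c i j = Poly_Mapping.single (i, j) c"

text \<open>
  The products \<open>f P\<close>, \<open>\<partial>\<^sub>1 P\<close> and \<open>\<partial>\<^sub>2 P\<close> in the Weyl algebra; the last two
  are brought to normal form by \<open>\<partial>\<^sub>i c = (\<partial>c/\<partial>t\<^sub>i) + c \<partial>\<^sub>i\<close>.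
\<close>

definition fmult :: "poly2 \<Rightarrow> diffop \<Rightarrow> diffop" where
  "fmult f P = Poly_Mapping.map ((*) f) P"

definition dmult1 :: "diffop \<Rightarrow> diffop" where
  "dmult1 P = (\<Sum>(i, j)\<in>Poly_Mapping.keys P.
     dop (pd1 (Poly_Mapping.lookup P (i, j))) i j + dop (Poly_Mapping.lookup P (i, j)) (Suc i) j)"

definition dmult2 :: "diffop \<Rightarrow> diffop" where
  "dmult2 P = (\<Sum>(i, j)\<in>Poly_Mapping.keys P.
     dop (pd2 (Poly_Mapping.lookup P (i, j))) i j + dop (Poly_Mapping.lookup P (i, j)) i (Suc j))"

text \<open>
  The Weyl algebra is generated as a ring by the polynomials and \<open>\<partial>\<^sub>1, \<partial>\<^sub>2\<close>, so the
  left ideal generated by \<open>S\<close> is the least additive submonoid that contains \<open>S\<close> and is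
  closed under left multiplication by these.
\<close>

inductive_set left_ideal :: "diffop set \<Rightarrow> diffop set" for S where
  zero: "0 \<in> left_ideal S"
| gen: "P \<in> S \<Longrightarrow> P \<in> left_ideal S"
| add: "P \<in> left_ideal S \<Longrightarrow> Q \<in> left_ideal S \<Longrightarrow> P + Q \<in> left_ideal S"
| fmult: "P \<in> left_ideal S \<Longrightarrow> fmult f P \<in> left_ideal S"
| dmult1: "P \<in> left_ideal S \<Longrightarrow> dmult1 P \<in> left_ideal S"
| dmult2: "P \<in> left_ideal S \<Longrightarrow> dmult2 P \<in> left_ideal S"

section \<open>Local holomorphic solutions and the rank\<close>

definition holomorphic2_on :: "(complex \<times> complex \<Rightarrow> complex) \<Rightarrow> (complex \<times> complex) set \<Rightarrow> bool" where
  "holomorphic2_on u U \<longleftrightarrow> open U \<and>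
     (\<forall>q\<in>U. \<exists>a b. (u has_derivative (\<lambda>(h, k). a * h + b * k)) (at q))"

definition D1 :: "(complex \<times> complex \<Rightarrow> complex) \<Rightarrow> complex \<times> complex \<Rightarrow> complex" where
  "D1 u = (\<lambda>(x, y). deriv (\<lambda>z. u (z, y)) x)"

definition D2 :: "(complex \<times> complex \<Rightarrow> complex) \<Rightarrow> complex \<times> complex \<Rightarrow> complex" where
  "D2 u = (\<lambda>(x, y). deriv (\<lambda>z. u (x, z)) y)"

definition dop_apply :: "diffop \<Rightarrow> (complex \<times> complex \<Rightarrow> complex) \<Rightarrow> complex \<times> complex \<Rightarrow> complex" where
  "dop_apply P u q = (\<Sum>(i, j)\<in>Poly_Mapping.keys P.
     eval2 (Poly_Mapping.lookup P (i, j)) q * (D1 ^^ i) ((D2 ^^ j) u) q)"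

definition local_solution :: "diffop set \<Rightarrow> complex \<times> complex \<Rightarrow> (complex \<times> complex \<Rightarrow> complex) \<Rightarrow> bool" where
  "local_solution I p u \<longleftrightarrow> (\<exists>U. p \<in> U \<and> holomorphic2_on u U \<and>
     (\<forall>P\<in>I. \<forall>q\<in>U. dop_apply P u q = 0))"

text \<open>
  The vector space of germs at \<open>p\<close> of holomorphic solutions has a basis of \<open>r\<close> elements.
  Equality of germs at \<open>p\<close> is equality on a neighbourhood of \<open>p\<close>.
\<close>

definition solution_dim :: "diffop set \<Rightarrow> complex \<times> complex \<Rightarrow> nat \<Rightarrow> bool" where
  "solution_dim I p r \<longleftrightarrow> (\<exists>b :: nat \<Rightarrow> complex \<times> complex \<Rightarrow> complex.
     (\<forall>i<r. local_solution I p (b i)) \<and>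
     (\<forall>c :: nat \<Rightarrow> complex. (\<forall>\<^sub>F q in nhds p. (\<Sum>i<r. c i * b i q) = 0) \<longrightarrow> (\<forall>i<r. c i = 0)) \<and>
     (\<forall>u. local_solution I p u \<longrightarrow>
        (\<exists>c :: nat \<Rightarrow> complex. \<forall>\<^sub>F q in nhds p. u q = (\<Sum>i<r. c i * b i q))))"

text \<open>``Generic'' means: off some proper algebraic subset of \<open>\<complex>\<^sup>2\<close>.\<close>

definition has_rank :: "diffop set \<Rightarrow> nat \<Rightarrow> bool" where
  "has_rank I r \<longleftrightarrow> (\<exists>g. g \<noteq> 0 \<and> (\<forall>p. eval2 g p \<noteq> 0 \<longrightarrow> solution_dim I p r))"

section \<open>Characteristic variety and singular locus\<close>

definition dop_order :: "diffop \<Rightarrow> nat" where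
  "dop_order P = Max ((\<lambda>(i, j). i + j) ` Poly_Mapping.keys P)"

text \<open>For \<open>P = 0\<close> the order is irrelevant, since the sum is empty.\<close>

definition principal_symbol :: "diffop \<Rightarrow> complex \<times> complex \<Rightarrow> complex \<times> complex \<Rightarrow> complex" where
  "principal_symbol P q = (\<lambda>(\<xi>1, \<xi>2).
     \<Sum>(i, j)\<in>{(i, j) \<in> Poly_Mapping.keys P. i + j = dop_order P}.
       eval2 (Poly_Mapping.lookup P (i, j)) q * \<xi>1 ^ i * \<xi>2 ^ j)"

definition char_variety :: "diffop set \<Rightarrow> ((complex \<times> complex) \<times> (complex \<times> complex)) set" where
  "char_variety I = {(q, \<xi>). \<forall>P\<in>I. principal_symbol P q \<xi> = 0}"

text \<open>
  Each factor of \<open>\<P>\<^sup>1 \<times> \<P>\<^sup>1\<close> is covered by the charts \<open>t\<^sub>i = x\<^sub>i\<close> and \<open>t\<^sub>i = 1 / x\<^sub>i\<close>; the flag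
  \<open>e\<^sub>i\<close> selects the second one.
\<close>

datatype sphere = Fin complex | Infty

definition chart_map :: "bool \<Rightarrow> bool \<Rightarrow> complex \<times> complex \<Rightarrow> complex \<times> complex" where
  "chart_map e1 e2 = (\<lambda>(x, y). (if e1 then inverse x else x, if e2 then inverse y else y))"

text \<open>\<open>Q\<close> is the operator \<open>x\<^sub>1\<^sup>k x\<^sub>2\<^sup>l P\<close> written in the chart coordinates \<open>x\<^sub>1, x\<^sub>2\<close>.\<close>

definition chart_form ::
  "bool \<Rightarrow> bool \<Rightarrow> nat \<Rightarrow> nat \<Rightarrow> diffop \<Rightarrow> diffop \<Rightarrow> bool" where
  "chart_form e1 e2 k l P Q \<longleftrightarrow>
     (\<forall>u U x y. holomorphic2_on u U \<longrightarrow> x \<noteq> 0 \<longrightarrow> y \<noteq> 0 \<longrightarrow> chart_map e1 e2 (x, y) \<in> U \<longrightarrow>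
        dop_apply Q (u \<circ> chart_map e1 e2) (x, y) =
        x ^ k * y ^ l * dop_apply P u (chart_map e1 e2 (x, y)))"

text \<open>
  The generators in \<open>S\<close>, written in a chart and cleared of denominators: \<open>Q\<close> is a \<open>diffop\<close>,
  so its coefficients are polynomial in \<open>x\<^sub>1, x\<^sub>2\<close>.  The \<open>Q\<close> belonging to one \<open>P\<close> are the
  monomial multiples of the one obtained with the least possible exponents, so they generate the
  same left ideal as that one.  For \<open>e1 = e2 = False\<close> this is the left ideal generated
  by \<open>S\<close> itself.
\<close>

definition chart_system :: "bool \<Rightarrow> bool \<Rightarrow> diffop set \<Rightarrow> diffop set" where
  "chart_system e1 e2 S = left_ideal {Q. \<exists>P\<in>S. \<exists>k l. chart_form e1 e2 k l P Q}"

primrec chart_coord :: "sphere \<Rightarrow> complex" where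
  "chart_coord (Fin z) = z"
| "chart_coord Infty = 0"

text \<open>
  A point is singular if the characteristic variety has a nonzero covector over it, i.e. the
  singular locus is the projection of the characteristic variety minus the zero section.
\<close>

definition singular_locus :: "diffop set \<Rightarrow> (sphere \<times> sphere) set" where
  "singular_locus S = {(p1, p2). \<exists>\<xi>. \<xi> \<noteq> (0, 0) \<and>
     ((chart_coord p1, chart_coord p2), \<xi>) \<in> char_variety (chart_system (p1 = Infty) (p2 = Infty) S)}"

section \<open>The system\<close>

definition par0 :: "complex \<Rightarrow> complex" where
  "par0 A0 = 2 * A0 - 3"

definition par :: "complex \<Rightarrow> complex \<Rightarrow> complex" where
  "par A0 Ai = Ai ^ 2 - (A0 - 1) ^ 2"

definition Z2_P1 :: "complex \<Rightarrow> complex \<Rightarrow> complex \<Rightarrow> complex \<Rightarrow> diffop" where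
  "Z2_P1 A0 A1 A2 A3 = (let a0 = cst (par0 A0); a3 = cst (par A0 A3) in
     dop (1 - t1 ^ 2) 2 0 + dop (2 * (1 - t1 * t2)) 1 1 + dop (1 - t2 ^ 2) 0 2
     + fmult a0 (dop t1 1 0 + dop t2 0 1) + dop a3 0 0)"

definition Z2_P2 :: "complex \<Rightarrow> complex \<Rightarrow> complex \<Rightarrow> complex \<Rightarrow> diffop" where
  "Z2_P2 A0 A1 A2 A3 = (let a0 = cst (par0 A0); a1 = cst (par A0 A1); a2 = cst (par A0 A2) in
     fmult (2 * (t1 - t2))
       (dop (1 - t2 ^ 2) 1 2 + dop (a0 * t2) 1 1 + dop a1 1 0
        + dop (1 - t1 ^ 2) 2 1 + dop (a0 * t1) 1 1 + dop a2 0 1)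
     - fmult (2 + a0)
       (dop (1 - t2 ^ 2) 0 2 + dop (a0 * t2) 0 1 + dop a1 0 0
        - dop (1 - t1 ^ 2) 2 0 - dop (a0 * t1) 1 0 - dop a2 0 0))"

definition Z2_gens :: "complex \<Rightarrow> complex \<Rightarrow> complex \<Rightarrow> complex \<Rightarrow> diffop set" where
  "Z2_gens A0 A1 A2 A3 = {Z2_P1 A0 A1 A2 A3, Z2_P2 A0 A1 A2 A3}"

definition Z2 :: "complex \<Rightarrow> complex \<Rightarrow> complex \<Rightarrow> complex \<Rightarrow> diffop set" where
  "Z2 A0 A1 A2 A3 = left_ideal (Z2_gens A0 A1 A2 A3)"

end

theory Submission
  imports Defs "HOL-Complex_Analysis.Complex_Analysis"
begin

text \<open>
  The second-order operators \<open>L\<^sub>1 = (1 - t\<^sub>1\<^sup>2) \<partial>\<^sub>1\<^sub>1 + a\<^sub>0 t\<^sub>1 \<partial>\<^sub>1 + a\<^sub>2\<close> and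
  \<open>L\<^sub>2 = (1 - t\<^sub>2\<^sup>2) \<partial>\<^sub>2\<^sub>2 + a\<^sub>0 t\<^sub>2 \<partial>\<^sub>2 + a\<^sub>1\<close> turn \<open>P\<^sub>1\<close> into
  \<open>L\<^sub>1 + L\<^sub>2 + 2 (1 - t\<^sub>1 t\<^sub>2) \<partial>\<^sub>1\<^sub>2 + const\<close> and \<open>P\<^sub>2\<close> into
  \<open>2 (t\<^sub>1 - t\<^sub>2) (\<partial>\<^sub>1 L\<^sub>2 + \<partial>\<^sub>2 L\<^sub>1) - (2 + a\<^sub>0) (L\<^sub>2 - L\<^sub>1)\<close>.  Off the lines
  \<open>t\<^sub>i = \<plusminus>1\<close>, \<open>t\<^sub>1 = t\<^sub>2\<close> the functions \<open>u, \<partial>\<^sub>1 u, \<partial>\<^sub>2 u, \<partial>\<^sub>1\<^sub>2 u, L\<^sub>2 u - L\<^sub>1 u, \<partial>\<^sub>1 L\<^sub>2 u - \<partial>\<^sub>2 L\<^sub>1 u\<close> of a solution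
  satisfy a Pfaffian system.  It is flat, hence its solution spaces have dimension 6, and the first
  component of each of its solutions solves the original system.

  For the singular locus, \<open>P\<^sub>1\<close> and \<open>P\<^sub>2\<close> commute, and in the charts at infinity the commutator
  of the two generators is a left multiple of the second one.  As their principal symbols form a
  regular sequence, a cancellation of leading terms in \<open>A P\<^sub>1 + B P\<^sub>2\<close> comes from the Koszul syzygy
  and can be undone by means of the commutator, so every symbol of the left ideal lies in the ideal
  of the two symbols.  Thus the characteristic variety is cut out by these two symbols: \<open>(1, 0)\<close> or
  \<open>(0, 1)\<close> is a common zero where a leading coefficient vanishes, \<open>(1, -1)\<close> on the diagonal, and
  elsewhere there is none.
\<close>


section \<open>Arithmetic of the Weyl algebra\<close>

text \<open>The six unknowns are what the equations leave open: \<open>P\<^sub>1\<close> determines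
  the sum \<open>L\<^sub>1 u + L\<^sub>2 u\<close> and \<open>P\<^sub>2\<close> the sum
  \<open>\<partial>\<^sub>1 L\<^sub>2 u + \<partial>\<^sub>2 L\<^sub>1 u\<close>, so the
  corresponding differences are kept beside \<open>u\<close> and its square-free derivatives. The
  two inclusions for the singular locus are of unequal depth. Regularity of a point is seen on the
  symbols of the two generators alone. Singularity needs the symbols of all operators in the left
  ideal to vanish at one covector, and such an operator may have lower order than the terms
  \<open>A P\<^sub>1\<close>, \<open>B P\<^sub>2\<close> that make it up; only this direction uses
  the commutator and the regular sequence. At infinity there is a further obstacle. Clearing the
  denominator of \<open>t\<^sub>1 - t\<^sub>2\<close> can overshoot: in a chart that inverts the
  coordinate concerned, all coefficients of the second generator are divisible by \<open>t2\<close>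
  if \<open>a\<^sub>1 = 0\<close>, and by \<open>t1\<close> if \<open>a\<^sub>2 = 0\<close>. The
  commutator relation must therefore survive division by such a monomial.\<close>

lemma pd1_add: "pd1 (p + q) = pd1 p + pd1 q"
  by (intro poly_eqI) (simp add: pd1_def coeff_map_poly pderiv_add)

lemma pd1_0 [simp]: "pd1 0 = 0"
  by (simp add: pd1_def)

lemma pd1_minus: "pd1 (- p) = - pd1 p"
  by (intro poly_eqI) (simp add: pd1_def coeff_map_poly pderiv_minus)

lemma pd1_diff: "pd1 (p - q) = pd1 p - pd1 q"
  by (intro poly_eqI) (simp add: pd1_def coeff_map_poly pderiv_diff)

lemma pderiv_sum: "pderiv (sum f A) = (\<Sum>i\<in>A. pderiv (f i))"
  by (induction A rule: infinite_finite_induct) (auto simp: pderiv_add)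

lemma pd1_mult: "pd1 (p * q) = pd1 p * q + p * pd1 q"
  by (intro poly_eqI)
    (simp add: pd1_def coeff_map_poly coeff_mult pderiv_sum pderiv_mult sum.distrib mult.commute[of "coeff q _"] add.commute)

lemma pd2_add: "pd2 (p + q) = pd2 p + pd2 q" by (simp add: pd2_def pderiv_add)
lemma pd2_0 [simp]: "pd2 0 = 0" by (simp add: pd2_def)
lemma pd2_minus: "pd2 (- p) = - pd2 p" by (simp add: pd2_def pderiv_minus)
lemma pd2_diff: "pd2 (p - q) = pd2 p - pd2 q" by (simp add: pd2_def pderiv_diff)
lemma pd2_mult: "pd2 (p * q) = pd2 p * q + p * pd2 q"
  by (simp add: pd2_def pderiv_mult algebra_simps)

lemma pd_t [simp]:
  "pd1 t1 = 1" "pd1 t2 = 0" "pd2 t1 = 0" "pd2 t2 = 1" "pd1 (cst c) = 0" "pd2 (cst c) = 0"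
  by (simp_all add: pd1_def pd2_def t1_def t2_def cst_def map_poly_pCons pderiv_pCons one_pCons)

lemma pd_1 [simp]: "pd1 1 = 0" "pd2 1 = 0"
  using pd_t(5,6)[of 1] by (simp_all add: cst_def flip: one_pCons)

lemma pd_numeral [simp]: "pd1 (numeral n) = 0" "pd2 (numeral n) = 0"
  using pd_t(5,6)[of "numeral n"] by (simp_all add: cst_def flip: numeral_poly)

lemmas pd_simps = pd1_add pd2_add pd1_diff pd2_diff pd1_minus pd2_minus pd1_mult pd2_mult

lemma pd1_pd2: "pd1 (pd2 p) = pd2 (pd1 p)"
  by (intro poly_eqI) (simp add: pd1_def pd2_def coeff_map_poly coeff_pderiv pderiv_mult pderiv_add
      flip: of_nat_Suc)

abbreviation lookup :: "diffop \<Rightarrow> nat \<times> nat \<Rightarrow> poly2" where "lookup \<equiv> Poly_Mapping.lookup"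

lemma lookup_dop: "lookup (dop c i j) (a, b) = (if i = a \<and> j = b then c else 0)"
  by (simp add: dop_def lookup_single when_def)

lemma lookup_fmult [simp]: "lookup (fmult f P) k = f * lookup P k"
  by (simp add: fmult_def map.rep_eq when_def)

lemma lookup_sum_superset:
  assumes "finite S" "Poly_Mapping.keys P \<subseteq> S" "\<And>k. F k 0 = 0"
  shows "(\<Sum>k\<in>Poly_Mapping.keys P. F k (lookup P k)) = (\<Sum>k\<in>S. F k (lookup P k))"
  using assms by (intro sum.mono_neutral_left) (auto simp: in_keys_iff)

lemma lookup_dmult1:
  "lookup (dmult1 P) (i, j) =
     pd1 (lookup P (i, j)) + (if i = 0 then 0 else lookup P (i - 1, j))"
proof -
  let ?S = "Poly_Mapping.keys P \<union> {(i, j), (i - 1, j)}"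
  let ?F = "\<lambda>(a, b) c. dop (pd1 c) a b + dop c (Suc a) b"
  have "dmult1 P = (\<Sum>k\<in>Poly_Mapping.keys P. ?F k (lookup P k))"
    unfolding dmult1_def by (intro sum.cong) auto
  also have "\<dots> = (\<Sum>k\<in>?S. ?F k (lookup P k))"
    by (intro lookup_sum_superset) (auto simp: dop_def)
  finally have "lookup (dmult1 P) (i, j) =
      (\<Sum>k\<in>?S. (if k = (i, j) then pd1 (lookup P k) else 0)
        + (if k = (i - 1, j) then (if i = 0 then 0 else lookup P k) else 0))"
    by (simp only: lookup_sum) (intro sum.cong, auto simp: lookup_dop lookup_add split: if_splits)
  also have "\<dots> = pd1 (lookup P (i, j)) + (if i = 0 then 0 else lookup P (i - 1, j))"
    by (simp only: sum.distrib) (simp add: sum.delta)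
  finally show ?thesis .
qed

lemma lookup_dmult2:
  "lookup (dmult2 P) (i, j) =
     pd2 (lookup P (i, j)) + (if j = 0 then 0 else lookup P (i, j - 1))"
proof -
  let ?S = "Poly_Mapping.keys P \<union> {(i, j), (i, j - 1)}"
  let ?F = "\<lambda>(a, b) c. dop (pd2 c) a b + dop c a (Suc b)"
  have "dmult2 P = (\<Sum>k\<in>Poly_Mapping.keys P. ?F k (lookup P k))"
    unfolding dmult2_def by (intro sum.cong) auto
  also have "\<dots> = (\<Sum>k\<in>?S. ?F k (lookup P k))"
    by (intro lookup_sum_superset) (auto simp: dop_def)
  finally have "lookup (dmult2 P) (i, j) =
      (\<Sum>k\<in>?S. (if k = (i, j) then pd2 (lookup P k) else 0)
        + (if k = (i, j - 1) then (if j = 0 then 0 else lookup P k) else 0))"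
    by (simp only: lookup_sum) (intro sum.cong, auto simp: lookup_dop lookup_add split: if_splits)
  also have "\<dots> = pd2 (lookup P (i, j)) + (if j = 0 then 0 else lookup P (i, j - 1))"
    by (simp only: sum.distrib) (simp add: sum.delta)
  finally show ?thesis .
qed

lemma diffop_eqI: "(\<And>i j. lookup P (i, j) = lookup Q (i, j)) \<Longrightarrow> P = (Q :: diffop)"
  by (rule poly_mapping_eqI) auto

lemma dmult1_add: "dmult1 (P + Q) = dmult1 P + dmult1 Q"
  by (rule diffop_eqI) (simp add: lookup_dmult1 lookup_add pd1_add)
lemma dmult2_add: "dmult2 (P + Q) = dmult2 P + dmult2 Q"
  by (rule diffop_eqI) (simp add: lookup_dmult2 lookup_add pd2_add)
lemma dmult2_0 [simp]: "dmult2 0 = 0"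
  by (simp add: dmult2_def)
lemma fmult_add: "fmult f (P + Q) = fmult f P + fmult f Q"
  by (rule diffop_eqI) (simp add: lookup_add algebra_simps)
lemma fmult_diff: "fmult f (P - Q) = fmult f P - fmult f Q"
  by (rule diffop_eqI) (simp add: lookup_minus algebra_simps)
lemma fmult_add_left: "fmult (f + g) P = fmult f P + fmult g P"
  by (rule diffop_eqI) (simp add: lookup_add algebra_simps)
lemma fmult_0 [simp]: "fmult f 0 = 0" "fmult 0 P = 0"
  by (rule diffop_eqI, simp)+
lemma fmult_fmult: "fmult f (fmult g P) = fmult (f * g) P"
  by (rule diffop_eqI) (simp add: algebra_simps)
lemma fmult_1 [simp]: "fmult 1 P = P"
  by (rule diffop_eqI) simp

lemma dmult1_fmult: "dmult1 (fmult f P) = fmult (pd1 f) P + fmult f (dmult1 P)"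
  by (rule diffop_eqI) (simp add: lookup_dmult1 lookup_add pd1_mult algebra_simps)
lemma dmult2_fmult: "dmult2 (fmult f P) = fmult (pd2 f) P + fmult f (dmult2 P)"
  by (rule diffop_eqI) (simp add: lookup_dmult2 lookup_add pd2_mult algebra_simps)

lemma dmult1_dmult2: "dmult1 (dmult2 P) = dmult2 (dmult1 P)"
  by (rule diffop_eqI) (auto simp: lookup_dmult1 lookup_dmult2 pd1_add pd2_add pd1_pd2)

lemma dmult2_dmult1_pow: "dmult2 ((dmult1 ^^ i) P) = (dmult1 ^^ i) (dmult2 P)"
  by (induction i) (auto simp flip: dmult1_dmult2)

section \<open>The product of the Weyl algebra and left ideals with two generators\<close>

definition dmono :: "nat \<Rightarrow> nat \<Rightarrow> diffop \<Rightarrow> diffop" where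
  "dmono i j P = (dmult1 ^^ i) ((dmult2 ^^ j) P)"

lemma dmono_simps [simp]:
  "dmono 0 0 P = P" "dmult1 (dmono i j P) = dmono (Suc i) j P" "dmult2 (dmono i j P) = dmono i (Suc j) P"
  by (simp_all add: dmono_def dmult2_dmult1_pow)

lemma dmono_add: "dmono i j (P + Q) = dmono i j P + dmono i j Q"
proof -
  have "(dmult2 ^^ j) (P + Q) = (dmult2 ^^ j) P + (dmult2 ^^ j) Q" for P Q
    by (induction j) (auto simp: dmult2_add)
  moreover have "(dmult1 ^^ i) (P + Q) = (dmult1 ^^ i) P + (dmult1 ^^ i) Q" for P Q
    by (induction i) (auto simp: dmult1_add)
  ultimately show ?thesis by (simp add: dmono_def)
qed

lemma dmono_0 [simp]: "dmono i j 0 = 0"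
  using dmono_add[of i j 0 0] by simp

text \<open>The product \<open>A P\<close> in the Weyl algebra, obtained by applying the normal form
  of \<open>A\<close> to \<open>P\<close>. The Leibniz rule sits entirely in \<open>dmult1\<close>
  and \<open>dmult2\<close>.\<close>

definition act :: "diffop \<Rightarrow> diffop \<Rightarrow> diffop" where
  "act A P = (\<Sum>(i, j)\<in>Poly_Mapping.keys A. fmult (lookup A (i, j)) (dmono i j P))"

lemma act_superset:
  assumes "finite S" "Poly_Mapping.keys A \<subseteq> S"
  shows "act A P = (\<Sum>(i, j)\<in>S. fmult (lookup A (i, j)) (dmono i j P))"
  using lookup_sum_superset[OF assms, of "\<lambda>(i, j) c. fmult c (dmono i j P)"]
  by (auto simp: act_def split_def)

lemma act_add_left: "act (A + B) P = act A P + act B P"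
proof -
  let ?S = "Poly_Mapping.keys A \<union> Poly_Mapping.keys B"
  have "act (A + B) P = (\<Sum>(i, j)\<in>?S. fmult (lookup (A + B) (i, j)) (dmono i j P))"
    by (rule act_superset) (auto simp: Poly_Mapping.keys_add)
  also have "\<dots> = (\<Sum>(i, j)\<in>?S. fmult (lookup A (i, j)) (dmono i j P))
      + (\<Sum>(i, j)\<in>?S. fmult (lookup B (i, j)) (dmono i j P))"
    by (simp add: split_def lookup_add fmult_add_left sum.distrib)
  also have "\<dots> = act A P + act B P"
    by (subst (1 2) act_superset[symmetric]) auto
  finally show ?thesis .
qed

lemma act_dop: "act (dop c i j) P = fmult c (dmono i j P)"
  by (subst act_superset[of "{(i, j)}"]) (auto simp: dop_def lookup_single)

lemma act_0 [simp]: "act 0 P = 0" "act A 0 = 0"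
  by (simp_all add: act_def split_def)

lemma diffop_expand:
  assumes "finite S" "Poly_Mapping.keys A \<subseteq> S"
  shows "A = (\<Sum>(i, j)\<in>S. dop (lookup A (i, j)) i j)"
proof (rule diffop_eqI)
  fix i j
  have "lookup (\<Sum>(i, j)\<in>S. dop (lookup A (i, j)) i j) (i, j) =
    (\<Sum>k\<in>S. if k = (i, j) then lookup A k else 0)"
    by (simp only: lookup_sum) (intro sum.cong, auto simp: lookup_dop split: if_splits)
  then show "lookup A (i, j) =
      lookup (\<Sum>(i, j)\<in>S. dop (lookup A (i, j)) i j) (i, j)"
    using assms by (auto simp: sum.delta in_keys_iff)
qed

lemma diffop_induct [case_names add dop]:
  assumes "\<And>P Q. R P \<Longrightarrow> R Q \<Longrightarrow> R (P + Q)" "\<And>c i j. R (dop c i j)"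
  shows "R (A :: diffop)"
proof -
  have R0: "R 0" using assms(2)[of 0 0 0] by (simp add: dop_def)
  have "R (\<Sum>(i, j)\<in>S. dop (lookup A (i, j)) i j)" if "finite S" for S
    using that by (induction S rule: finite_induct) (auto intro: assms R0)
  from this[of "Poly_Mapping.keys A"] show ?thesis
    by (simp flip: diffop_expand)
qed

lemma act_add_right: "act A (P + Q) = act A P + act A Q"
  by (induction A rule: diffop_induct) (simp_all add: act_add_left act_dop dmono_add fmult_add)

lemma act_uminus [simp]: "act (- A) P = - act A P" "act A (- P) = - act A P"
proof -
  have "act (- A) P + act A P = 0" by (simp flip: act_add_left)
  then show "act (- A) P = - act A P" by (simp add: eq_neg_iff_add_eq_0)
  have "act A (- P) + act A P = 0" by (simp flip: act_add_right)
  then show "act A (- P) = - act A P" by (simp add: eq_neg_iff_add_eq_0)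
qed

lemma act_diff: "act (A - B) P = act A P - act B P" "act A (P - Q) = act A P - act A Q"
  using act_add_left[of A "- B" P] act_add_right[of A P "- Q"] by simp_all

lemma act_fmult: "act (fmult f A) P = fmult f (act A P)"
proof (induction A rule: diffop_induct)
  case (dop c i j)
  have "fmult f (dop c i j) = dop (f * c) i j"
    by (rule diffop_eqI) (simp add: lookup_dop)
  then show ?case by (simp add: act_dop fmult_fmult)
qed (simp add: fmult_add act_add_left)

lemma dmult_dop: "dmult1 (dop c i j) = dop (pd1 c) i j + dop c (Suc i) j"
  "dmult2 (dop c i j) = dop (pd2 c) i j + dop c i (Suc j)"
  by (rule diffop_eqI, auto simp: lookup_dmult1 lookup_dmult2 lookup_add lookup_dop)+

lemma act_dmult1: "act (dmult1 A) P = dmult1 (act A P)"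
  by (induction A rule: diffop_induct)
    (simp_all add: act_add_left dmult1_add act_dop dmult_dop dmult1_fmult)

lemma act_dmult2: "act (dmult2 A) P = dmult2 (act A P)"
  by (induction A rule: diffop_induct)
    (simp_all add: act_add_left dmult2_add act_dop dmult_dop dmult2_fmult)

lemma act_dmono: "act (dmono i j A) P = dmono i j (act A P)"
proof -
  have "act ((dmult2 ^^ j) A) P = (dmult2 ^^ j) (act A P)"
    by (induction j) (auto simp: act_dmult2)
  moreover have "act ((dmult1 ^^ i) A) P = (dmult1 ^^ i) (act A P)" for A
    by (induction i) (auto simp: act_dmult1)
  ultimately show ?thesis by (simp add: dmono_def)
qed

text \<open>In its first argument \<open>act\<close> is additive and commutes with left
  multiplication by polynomials and derivations, so the terms \<open>dop c i j\<close> decide.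
  Associativity allows a commutator relation to be multiplied by an operator from the left.\<close>

lemma act_assoc: "act (act A B) P = act A (act B P)"
  by (induction A rule: diffop_induct) (simp_all add: act_add_left act_dop act_fmult act_dmono)

text \<open>Puts ideal elements into the shape in which cancellation of leading terms is studied.
  The elements of \<open>S\<close> need only be combinations of \<open>P1\<close> and
  \<open>P2\<close>, so the reduced generators of a chart at infinity can serve.\<close>

lemma left_ideal_generated:
  assumes "R \<in> left_ideal S" "\<And>P. P \<in> S \<Longrightarrow> \<exists>A B. P = act A P1 + act B P2"
  shows "\<exists>A B. R = act A P1 + act B P2"
  using assms(1)
proof induction
  case zero
  show ?case by (rule exI[of _ 0], rule exI[of _ 0]) simp
next
  case (add P Q)
  then obtain A B A' B' where "P = act A P1 + act B P2" "Q = act A' P1 + act B' P2" by blast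
  then have "P + Q = act (A + A') P1 + act (B + B') P2" by (simp add: act_add_left)
  then show ?case by blast
next
  case (fmult P f)
  then obtain A B where "P = act A P1 + act B P2" by blast
  then have "fmult f P = act (fmult f A) P1 + act (fmult f B) P2" by (simp add: act_fmult fmult_add)
  then show ?case by blast
next
  case (dmult1 P)
  then obtain A B where "P = act A P1 + act B P2" by blast
  then have "dmult1 P = act (dmult1 A) P1 + act (dmult1 B) P2" by (simp add: act_dmult1 dmult1_add)
  then show ?case by blast
next
  case (dmult2 P)
  then obtain A B where "P = act A P1 + act B P2" by blast
  then have "dmult2 P = act (dmult2 A) P1 + act (dmult2 B) P2" by (simp add: act_dmult2 dmult2_add)
  then show ?case by blast
qed (use assms(2) in blast)

section \<open>Orders and symbols\<close>

text \<open>\<open>ordb n P\<close> says that the order of \<open>P\<close> is less than \<open>n\<close>, so that \<open>ordb 0 P\<close> means \<open>P = 0\<close>.\<close>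

definition ordb :: "nat \<Rightarrow> diffop \<Rightarrow> bool" where
  "ordb n P \<longleftrightarrow> (\<forall>i j. n \<le> i + j \<longrightarrow> lookup P (i, j) = 0)"

lemma ordb_lookup: "ordb n P \<Longrightarrow> n \<le> i + j \<Longrightarrow> lookup P (i, j) = 0"
  by (simp add: ordb_def)

lemma ordb_0 [simp]: "ordb n 0" by (simp add: ordb_def)
lemma ordb_0_iff: "ordb 0 P \<longleftrightarrow> P = 0" by (auto simp: ordb_def intro: diffop_eqI)
lemma ordb_mono: "ordb m P \<Longrightarrow> m \<le> n \<Longrightarrow> ordb n P" by (auto simp: ordb_def)
lemma ordb_add: "ordb n P \<Longrightarrow> ordb n Q \<Longrightarrow> ordb n (P + Q)" by (simp add: ordb_def lookup_add)
lemma ordb_diff: "ordb n P \<Longrightarrow> ordb n Q \<Longrightarrow> ordb n (P - Q)" by (simp add: ordb_def lookup_minus)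
lemma ordb_fmult: "ordb n P \<Longrightarrow> ordb n (fmult f P)" by (simp add: ordb_def)
lemma ordb_dop: "i + j < n \<Longrightarrow> ordb n (dop c i j)" by (auto simp: ordb_def lookup_dop)
lemma ordb_dmult1: "ordb n P \<Longrightarrow> ordb (Suc n) (dmult1 P)"
  by (auto simp: ordb_def lookup_dmult1)
lemma ordb_dmult2: "ordb n P \<Longrightarrow> ordb (Suc n) (dmult2 P)"
  by (auto simp: ordb_def lookup_dmult2)
lemma ordb_sum: "(\<And>k. k \<in> S \<Longrightarrow> ordb n (F k)) \<Longrightarrow> ordb n (sum F S)"
  by (induction S rule: infinite_finite_induct) (auto intro: ordb_add)

lemma ordb_dmono: "ordb n P \<Longrightarrow> ordb (i + j + n) (dmono i j P)"
proof (induction i)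
  case 0
  have "ordb (j + n) (dmono 0 j P)"
    using 0 by (induction j) (auto dest: ordb_dmult2)
  then show ?case by simp
next
  case (Suc i)
  then show ?case using ordb_dmult1 by force
qed

text \<open>The index range depends on the order bound only. With \<open>j\<close> outside, the
  inner sum over \<open>i\<close> retains just \<open>i = m - j\<close> when symbols of order
  \<open>m\<close> are taken.\<close>

lemma act_square:
  assumes "ordb (Suc m) A"
  shows "act A P = (\<Sum>j\<le>m. \<Sum>i\<le>m. fmult (lookup A (i, j)) (dmono i j P))"
proof -
  have "i \<le> m \<and> j \<le> m" if "(i, j) \<in> Poly_Mapping.keys A" for i j
    using ordb_lookup[OF assms, of i j] that by (cases "Suc m \<le> i + j") (auto simp: in_keys_iff)
  then have "act A P = (\<Sum>(i, j)\<in>{..m} \<times> {..m}. fmult (lookup A (i, j)) (dmono i j P))"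
    by (intro act_superset) auto
  also have "\<dots> = (\<Sum>i\<le>m. \<Sum>j\<le>m. fmult (lookup A (i, j)) (dmono i j P))"
    by (simp add: sum.cartesian_product)
  finally show ?thesis by (subst sum.swap)
qed

lemma ordb_act:
  assumes "ordb m A" "ordb (Suc n) P"
  shows "ordb (m + n) (act A P)"
proof (cases m)
  case 0
  then show ?thesis using assms(1) by (simp add: ordb_0_iff)
next
  case (Suc m')
  have "ordb (m + n) (fmult (lookup A (i, j)) (dmono i j P))" for i j
  proof (cases "m \<le> i + j")
    case True
    then show ?thesis using ordb_lookup[OF assms(1)] by simp
  next
    case False
    then show ?thesis using ordb_mono[OF ordb_dmono[OF assms(2), of i j], of "m + n"]
      by (auto intro: ordb_fmult)
  qed
  then show ?thesis using act_square[of m' A P] assms(1) Suc by (auto intro: ordb_sum)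
qed

text \<open>One theory for two kinds of symbol: as a polynomial over the coefficient ring, where
  divisibility can be discussed, and as a number at a point and a covector, which is what the
  characteristic variety tests.\<close>

locale symbol_map =
  fixes \<phi> :: "poly2 \<Rightarrow> 'a :: comm_ring_1" and X Y :: 'a
  assumes \<phi>_add: "\<phi> (a + b) = \<phi> a + \<phi> b" and \<phi>_mult: "\<phi> (a * b) = \<phi> a * \<phi> b"
begin

lemma \<phi>_0 [simp]: "\<phi> 0 = 0"
  using \<phi>_add[of 0 0] by simp

definition symb :: "nat \<Rightarrow> diffop \<Rightarrow> 'a" where
  "symb n P = (\<Sum>j\<le>n. \<phi> (lookup P (n - j, j)) * X ^ (n - j) * Y ^ j)"

lemma symb_0 [simp]: "symb n 0 = 0" by (simp add: symb_def)

lemma symb_add: "symb n (P + Q) = symb n P + symb n Q"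
  by (simp add: symb_def lookup_add \<phi>_add sum.distrib algebra_simps)

lemma symb_uminus: "symb n (- P) = - symb n P"
  using symb_add[of n P "- P"] by (simp add: eq_neg_iff_add_eq_0 add.commute)

lemma symb_diff: "symb n (P - Q) = symb n P - symb n Q"
  using symb_add[of n P "- Q"] by (simp add: symb_uminus)

lemma symb_sum: "symb n (sum F S) = (\<Sum>k\<in>S. symb n (F k))"
  by (induction S rule: infinite_finite_induct) (auto simp: symb_add)

lemma symb_fmult: "symb n (fmult f P) = \<phi> f * symb n P"
  by (simp add: symb_def \<phi>_mult sum_distrib_left mult.assoc)

lemma symb_ordb: "ordb n P \<Longrightarrow> symb n P = 0"
  by (auto simp: symb_def ordb_lookup intro!: sum.neutral)

lemma symb_dmult1:
  assumes "ordb (Suc n) P"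
  shows "symb (Suc n) (dmult1 P) = X * symb n P"
proof -
  have "symb (Suc n) (dmult1 P) = (\<Sum>j\<le>n. \<phi> (lookup P (n - j, j)) * X ^ Suc (n - j) * Y ^ j)"
    using assms by (auto simp: symb_def lookup_dmult1 ordb_lookup Suc_diff_le intro!: sum.cong)
  then show ?thesis by (simp add: symb_def sum_distrib_left algebra_simps)
qed

lemma symb_dmult2:
  assumes "ordb (Suc n) P"
  shows "symb (Suc n) (dmult2 P) = Y * symb n P"
proof -
  have "symb (Suc n) (dmult2 P) = (\<Sum>j\<le>n. \<phi> (lookup P (n - j, j)) * X ^ (n - j) * Y ^ Suc j)"
    unfolding symb_def using assms
    by (subst sum.atMost_Suc_shift) (auto simp: lookup_dmult2 ordb_lookup intro!: sum.cong)
  then show ?thesis by (simp add: symb_def sum_distrib_left algebra_simps)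
qed

lemma symb_dmono:
  assumes "ordb (Suc n) P"
  shows "symb (i + j + n) (dmono i j P) = X ^ i * Y ^ j * symb n P"
proof (induction i)
  case 0
  have "symb (j + n) (dmono 0 j P) = Y ^ j * symb n P"
  proof (induction j)
    case (Suc j)
    then show ?case using symb_dmult2[of "j + n" "dmono 0 j P"] ordb_dmono[OF assms, of 0 j]
      by (simp add: mult.assoc)
  qed simp
  then show ?case by simp
next
  case (Suc i)
  then show ?case using symb_dmult1[of "i + j + n" "dmono i j P"] ordb_dmono[OF assms, of i j]
    by (simp add: mult.assoc)
qed

text \<open>Terms of \<open>A\<close> with \<open>i + j < m\<close> stay below order
  \<open>m + n\<close>, those with \<open>i + j > m\<close> are absent, and derivatives falling on
  coefficients of \<open>P\<close> lower the order. Hence symbols multiply although operators do not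
  commute.\<close>

lemma symb_act:
  assumes "ordb (Suc m) A" "ordb (Suc n) P"
  shows "symb (m + n) (act A P) = symb m A * symb n P"
proof -
  have *: "symb (m + n) (fmult (lookup A (i, j)) (dmono i j P)) =
     (if i = m - j then \<phi> (lookup A (m - j, j)) * X ^ (m - j) * Y ^ j * symb n P else 0)"
    if "j \<le> m" for i j
  proof -
    consider "i = m - j" | "i + j > m" | "i + j < m" using that by linarith
    then show ?thesis
    proof cases
      case 1
      then show ?thesis using symb_dmono[OF assms(2), of i j] that
        by (simp add: symb_fmult mult.assoc)
    next
      case 2
      then show ?thesis using ordb_lookup[OF assms(1), of i j] that by auto
    next
      case 3
      then have "ordb (m + n) (dmono i j P)"
        using ordb_mono[OF ordb_dmono[OF assms(2), of i j], of "m + n"] by simp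
      then show ?thesis using 3 by (simp add: symb_fmult symb_ordb)
    qed
  qed
  have "symb (m + n) (act A P) = (\<Sum>j\<le>m. \<Sum>i\<le>m. symb (m + n) (fmult (lookup A (i, j)) (dmono i j P)))"
    by (simp add: act_square[OF assms(1)] symb_sum)
  also have "\<dots> = (\<Sum>j\<le>m. \<phi> (lookup A (m - j, j)) * X ^ (m - j) * Y ^ j * symb n P)"
    by (intro sum.cong refl) (simp add: * sum.delta')
  finally show ?thesis by (simp add: symb_def sum_distrib_right)
qed

end

text \<open>The homogeneous symbol, dehomogenized by \<open>\<xi>\<^sub>1 = 1\<close>.\<close>

interpretation psymb: symbol_map "\<lambda>c. [:c:]" 1 "[:0, 1:]"
  by unfold_locales auto

abbreviation "psymb \<equiv> psymb.symb"

lemma coeff_psymb: "coeff (psymb n P) j = (if j \<le> n then lookup P (n - j, j) else 0)"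
proof -
  have "psymb n P = (\<Sum>j\<le>n. monom (lookup P (n - j, j)) j)"
    unfolding psymb.symb_def by (intro sum.cong refl) (simp add: monom_altdef)
  then show ?thesis by (simp add: coeff_sum)
qed

lemma degree_psymb: "degree (psymb n P) \<le> n"
  by (rule degree_le) (simp add: coeff_psymb)

lemma psymb_eq_0:
  assumes "ordb (Suc n) P" "psymb n P = 0"
  shows "ordb n P"
proof -
  have "lookup P (i, j) = 0" if "n \<le> i + j" for i j
  proof (cases "n = i + j")
    case True
    then show ?thesis using coeff_psymb[of n P j] assms(2) by simp
  next
    case False
    then show ?thesis using ordb_lookup[OF assms(1), of i j] that by simp
  qed
  then show ?thesis by (auto simp: ordb_def)
qed

text \<open>Lifts the coefficient of a syzygy between symbols to an operator.\<close>

lemma psymb_surj: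
  assumes "degree t \<le> n"
  shows "\<exists>T. ordb (Suc n) T \<and> psymb n T = t"
proof -
  define T where "T = (\<Sum>j\<le>n. dop (coeff t j) (n - j) j)"
  have lk: "lookup T (n - j, j) = coeff t j" if "j \<le> n" for j
  proof -
    have "lookup T (n - j, j) = (\<Sum>k\<le>n. if k = j then coeff t k else 0)"
      unfolding T_def lookup_sum by (intro sum.cong refl) (auto simp: lookup_dop)
    then show ?thesis using that by simp
  qed
  have "psymb n T = t"
    using assms by (intro poly_eqI) (auto simp: coeff_psymb lk coeff_eq_0)
  moreover have "ordb (Suc n) T"
    unfolding T_def by (intro ordb_sum ordb_dop) auto
  ultimately show ?thesis by blast
qed

text \<open>
  If the symbols of \<open>P1\<close> and \<open>P2\<close> have only the Koszul syzygy and the commutator of \<open>P1\<close>, \<open>P2\<close>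
  is reducible, then a cancellation of leading terms in \<open>A P1 + B P2\<close> can be undone by adding a
  multiple of the commutator relation.
\<close>

lemma koszul_reduction:
  assumes P: "ordb 3 P1" "ordb 4 P2" "ordb 2 C"
    and comm: "act P1 P2 - act P2 P1 = act C P2"
    and reg: "\<And>a b. a * psymb 2 P1 + b * psymb 3 P2 = 0 \<Longrightarrow> \<exists>t. a = t * psymb 3 P2 \<and> b = - (t * psymb 2 P1)"
    and deg: "degree (psymb 2 P1) = 2"
    and AB: "ordb (Suc n) A" "ordb n B" and R: "ordb (Suc m) (act A P1 + act B P2)"
  shows "\<exists>A' B'. act A P1 + act B P2 = act A' P1 + act B' P2 \<and> ordb (m - 1) A' \<and> ordb (m - 2) B'"
  \<comment> \<open>The induction lowers the order bounds of \<open>A\<close> and \<open>B\<close>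
    until they fit the order \<open>m\<close> of the sum. The bounds differ by one because
    \<open>P1\<close> has order 2 and \<open>P2\<close> order 3. The truncated subtractions in the
    conclusion are intended: \<open>ordb 0\<close> means that the operator is zero.\<close>
  using AB R
proof (induction n arbitrary: A B)
  case 0
  then have B: "B = 0" by (simp add: ordb_0_iff)
  show ?case
  proof (cases "m \<ge> 2")
    case True
    then show ?thesis using 0 B ordb_mono[of "Suc 0" A "m - 1"] by (intro exI[of _ A] exI[of _ 0]) simp
  next
    case False
    have "psymb 2 (act A P1) = psymb 0 A * psymb 2 P1"
      using psymb.symb_act[of 0 A 2 P1] 0 P by (simp add: eval_nat_numeral)
    moreover have "psymb 2 (act A P1) = 0"
      using 0(3) B False by (intro psymb.symb_ordb) (auto elim: ordb_mono)
    moreover have "psymb 2 P1 \<noteq> 0" using deg by auto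
    ultimately have "psymb 0 A = 0" by simp
    then have "A = 0" using psymb_eq_0[of 0 A] 0 by (simp add: ordb_0_iff)
    then show ?thesis using B by (intro exI[of _ 0]) simp
  qed
next
  case (Suc k)
  show ?case
  proof (cases "k + 3 \<le> m")
    case True
    then show ?thesis using Suc.prems
      by (intro exI[of _ A] exI[of _ B]) (auto elim: ordb_mono)
  next
    case False
    have "psymb (Suc k + 2) (act A P1) = psymb (Suc k) A * psymb 2 P1"
      using Suc.prems P by (intro psymb.symb_act) (auto simp: numeral_3_eq_3)
    moreover have "psymb (k + 3) (act B P2) = psymb k B * psymb 3 P2"
      using Suc.prems P by (intro psymb.symb_act) (auto simp: eval_nat_numeral)
    moreover have "psymb (k + 3) (act A P1 + act B P2) = 0"
      using Suc.prems(3) False by (intro psymb.symb_ordb) (auto elim: ordb_mono)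
    ultimately have "psymb (Suc k) A * psymb 2 P1 + psymb k B * psymb 3 P2 = 0"
      by (simp add: psymb.symb_add eval_nat_numeral)
    from reg[OF this] obtain t where
      t: "psymb (Suc k) A = t * psymb 3 P2" "psymb k B = - (t * psymb 2 P1)" by blast
    show ?thesis
    proof (cases "t = 0")
      case True
      then have "ordb (Suc k) A" "ordb k B"
        using t psymb_eq_0 Suc.prems by auto
      then show ?thesis using Suc.IH Suc.prems(3) by blast
    next
      case False
      \<comment> \<open>Since the symbol of \<open>P1\<close> has full degree 2 in the dehomogenized
        variable, \<open>degree t\<close> is at most \<open>k - 2\<close>, which is what makes
        \<open>t\<close> the symbol of an operator of order at most \<open>k - 2\<close>.\<close>
      have "psymb 2 P1 \<noteq> 0" using deg by auto
      then have "degree (psymb k B) = degree t + 2"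
        using False by (simp add: t degree_mult_eq deg)
      then have k: "degree t \<le> k - 2" "k \<ge> 2" using degree_psymb[of k B] by auto
      obtain T where T: "ordb (Suc (k - 2)) T" "psymb (k - 2) T = t"
        using psymb_surj[OF k(1)] by blast
      \<comment> \<open>This adds \<open>T\<close> times the relation
        \<open>P1 P2 - P2 P1 - C P2 = 0\<close>. The symbols of \<open>T P2\<close> and
        \<open>T P1\<close> cancel those of \<open>A\<close> and \<open>B\<close>, while
        \<open>T C\<close> has order below \<open>k\<close> and does not interfere.\<close>
      define A' B' where "A' = A - act T P2" and "B' = B + act T P1 - act T C"
      have "act T (act P1 P2) - act T (act P2 P1) = act T (act C P2)"
        by (simp flip: comm add: act_diff)
      then have eq: "act A P1 + act B P2 = act A' P1 + act B' P2"
        by (simp add: A'_def B'_def act_diff act_add_left act_assoc algebra_simps)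
      have oT: "ordb (Suc (k - 2) + 3) (act T P2)" "ordb (Suc (k - 2) + 2) (act T P1)"
        "ordb (Suc (k - 2) + 1) (act T C)"
        using ordb_act[OF T(1), of 3 P2] ordb_act[OF T(1), of 2 P1] ordb_act[OF T(1), of 1 C] P
        by (simp_all add: eval_nat_numeral)
      have sT: "psymb (k - 2 + 3) (act T P2) = t * psymb 3 P2"
        "psymb (k - 2 + 2) (act T P1) = t * psymb 2 P1"
        using psymb.symb_act[of "k - 2" T 3 P2] psymb.symb_act[of "k - 2" T 2 P1] T P
        by (auto simp: eval_nat_numeral)
      have "ordb (Suc k) A'"
      proof (rule psymb_eq_0)
        show "ordb (Suc (Suc k)) A'"
          unfolding A'_def using Suc.prems(1) oT(1) k by (intro ordb_diff) (auto elim: ordb_mono)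
        have "k - 2 + 3 = Suc k" using k by simp
        then show "psymb (Suc k) A' = 0" using sT(1) t by (simp add: A'_def psymb.symb_diff)
      qed
      moreover have "ordb k B'"
      proof (rule psymb_eq_0)
        show "ordb (Suc k) B'"
          unfolding B'_def using Suc.prems(2) oT(2,3) k
          by (intro ordb_diff ordb_add) (auto elim: ordb_mono)
        have "psymb k (act T C) = 0"
          using oT(3) k by (intro psymb.symb_ordb) (auto elim: ordb_mono)
        moreover have "k - 2 + 2 = k" using k by simp
        ultimately show "psymb k B' = 0"
          using sT(2) t by (simp add: B'_def psymb.symb_diff psymb.symb_add)
      qed
      ultimately show ?thesis using Suc.IH[of A' B'] Suc.prems(3) unfolding eq by blast
    qed
  qed
qed

section \<open>Symbols at a point and the characteristic variety of an ideal with two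
  generators\<close>

lemma eval2_simps [simp]:
  "eval2 (p + p') q = eval2 p q + eval2 p' q" "eval2 (p - p') q = eval2 p q - eval2 p' q"
  "eval2 (- p) q = - eval2 p q" "eval2 (p * p') q = eval2 p q * eval2 p' q"
  "eval2 (p ^ n) q = eval2 p q ^ n" "eval2 0 q = 0" "eval2 1 q = 1" "eval2 (numeral k) q = numeral k"
  "eval2 (cst c) q = c" "eval2 t1 q = fst q" "eval2 t2 q = snd q"
  by (simp_all add: eval2_def split_def cst_def t1_def t2_def)

interpretation esymb: symbol_map "\<lambda>p. eval2 p q" \<xi>1 \<xi>2 for q \<xi>1 \<xi>2
  by unfold_locales auto

abbreviation "esymb \<equiv> esymb.symb"

lemma dop_order_bound:
  assumes "lookup P (i, j) \<noteq> 0"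
  shows "i + j \<le> dop_order P"
  unfolding dop_order_def using assms by (intro Max_ge) (force simp: in_keys_iff)+

lemma ordb_dop_order: "ordb (Suc (dop_order P)) P"
  unfolding ordb_def using dop_order_bound by (metis not_less_eq_eq)

lemma principal_symbol_esymb: "principal_symbol P q (\<xi>1, \<xi>2) = esymb q \<xi>1 \<xi>2 (dop_order P) P"
proof -
  let ?n = "dop_order P"
  let ?K = "{k \<in> Poly_Mapping.keys P. fst k + snd k = ?n}"
  let ?F = "\<lambda>k. eval2 (lookup P k) q * \<xi>1 ^ fst k * \<xi>2 ^ snd k"
  have "principal_symbol P q (\<xi>1, \<xi>2) = sum ?F ?K"
    unfolding principal_symbol_def by (auto simp: split_def intro!: sum.cong)
  also have "\<dots> = sum ?F ((\<lambda>j. (?n - j, j)) ` {..?n})"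
  proof (intro sum.mono_neutral_left subsetI ballI)
    fix k assume "k \<in> ?K"
    then have "k = (?n - snd k, snd k)" "snd k \<le> ?n" by (auto simp: prod_eq_iff)
    then show "k \<in> (\<lambda>j. (?n - j, j)) ` {..?n}" by blast
  qed (auto simp: in_keys_iff)
  also have "\<dots> = esymb q \<xi>1 \<xi>2 ?n P"
    unfolding esymb.symb_def by (subst sum.reindex) (auto simp: inj_on_def)
  finally show ?thesis .
qed

lemma dop_order_eqI:
  assumes "ordb (Suc n) P" "i + j = n" "lookup P (i, j) \<noteq> 0"
  shows "dop_order P = n"
proof (rule antisym)
  have "Poly_Mapping.keys P \<noteq> {}" using assms(3) by (auto simp: in_keys_iff)
  then have "dop_order P \<in> (\<lambda>(i, j). i + j) ` Poly_Mapping.keys P"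
    unfolding dop_order_def by (intro Max_in) auto
  then obtain a b where "lookup P (a, b) \<noteq> 0" "dop_order P = a + b"
    by (auto simp: in_keys_iff)
  then show "dop_order P \<le> n" using ordb_lookup[OF assms(1), of a b] by force
  show "n \<le> dop_order P" using dop_order_bound[OF assms(3)] assms(2) by simp
qed

text \<open>After the reduction no leading terms cancel, so the symbol of every ideal element is a
  combination of the two generator symbols and vanishes wherever both do.\<close>

lemma char_variety_koszul:
  assumes P: "ordb 3 P1" "ordb 4 P2" "ordb 2 C"
    and comm: "act P1 P2 - act P2 P1 = act C P2"
    and reg: "\<And>a b. a * psymb 2 P1 + b * psymb 3 P2 = 0 \<Longrightarrow> \<exists>t. a = t * psymb 3 P2 \<and> b = - (t * psymb 2 P1)"
    and deg: "degree (psymb 2 P1) = 2"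
    and gen: "\<And>P. P \<in> S \<Longrightarrow> \<exists>A B. P = act A P1 + act B P2"
    and zero: "esymb q \<xi>1 \<xi>2 2 P1 = 0" "esymb q \<xi>1 \<xi>2 3 P2 = 0"
  shows "(q, (\<xi>1, \<xi>2)) \<in> char_variety (left_ideal S)"
proof -
  have "principal_symbol R q (\<xi>1, \<xi>2) = 0" if "R \<in> left_ideal S" for R
  proof -
    define m where "m = dop_order R"
    obtain A B where AB: "R = act A P1 + act B P2"
      using left_ideal_generated[OF \<open>R \<in> left_ideal S\<close> gen] by blast
    let ?n = "max (dop_order A) (Suc (dop_order B))"
    have "ordb (Suc ?n) A" "ordb ?n B"
      using ordb_dop_order[of A] ordb_dop_order[of B] by (auto elim!: ordb_mono)
    from koszul_reduction[OF P comm reg deg this, of m] obtain A B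
      where R: "R = act A P1 + act B P2" and AB: "ordb (m - 1) A" "ordb (m - 2) B"
      using ordb_dop_order[of R] unfolding AB m_def by blast
    have "esymb q \<xi>1 \<xi>2 m (act A P1) = 0"
    proof (cases "m \<ge> 2")
      case True
      then have "m = (m - 2) + 2" "m - 1 = Suc (m - 2)" by auto
      then show ?thesis using esymb.symb_act[of "m - 2" A 2 P1 q \<xi>1 \<xi>2] AB P zero
        by (simp add: eval_nat_numeral)
    next
      case False
      then have "A = 0" using AB by (simp add: ordb_0_iff)
      then show ?thesis by simp
    qed
    moreover have "esymb q \<xi>1 \<xi>2 m (act B P2) = 0"
    proof (cases "m \<ge> 3")
      case True
      then have "m = (m - 3) + 3" "m - 2 = Suc (m - 3)" by auto
      then show ?thesis using esymb.symb_act[of "m - 3" B 3 P2 q \<xi>1 \<xi>2] AB P zero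
        by (simp add: eval_nat_numeral)
    next
      case False
      then have "B = 0" using AB by (simp add: ordb_0_iff)
      then show ?thesis by simp
    qed
    ultimately show ?thesis
      by (simp add: principal_symbol_esymb m_def[symmetric] esymb.symb_add) (simp add: R esymb.symb_add)
  qed
  then show ?thesis by (auto simp: char_variety_def)
qed

section \<open>The operators in the four charts\<close>

text \<open>
  In the chart selected by \<open>e\<close> the coordinate on the projective line is \<open>t = n / m\<close>, and
  \<open>\<partial>\<^sub>t = s m\<^sup>2 \<partial>\<^sub>x\<close> with a sign \<open>s\<close>; \<open>k\<close> is the derivative of \<open>m\<close>.
\<close>

definition cn :: "bool \<Rightarrow> poly2 \<Rightarrow> poly2" where "cn e t = (if e then 1 else t)"
definition cm :: "bool \<Rightarrow> poly2 \<Rightarrow> poly2" where "cm e t = (if e then t else 1)"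
definition cs :: "bool \<Rightarrow> poly2" where "cs e = (if e then - 1 else 1)"
definition ck :: "bool \<Rightarrow> poly2" where "ck e = (if e then 1 else 0)"

text \<open>\<open>lead\<close> and \<open>sublead\<close> are the coefficients of \<open>(1 - t^2)
  \<partial>\<^sub>t\<^sup>2 + b0 t \<partial>\<^sub>t\<close> in the chart: \<open>1 - t^2\<close>
  is \<open>(m^2 - n^2) / m^2\<close>, \<open>\<partial>\<^sub>t\<^sup>2\<close> begins with
  \<open>m^4 \<partial>\<^sub>x\<^sup>2\<close>, and the term with \<open>k\<close> is the
  derivative of \<open>m^2\<close>. Likewise
  \<open>2 (1 - t\<^sub>1 t\<^sub>2) \<partial>\<^sub>1\<^sub>2\<close> yields \<open>mixed\<close>,
  and \<open>t\<^sub>1 - t\<^sub>2\<close> is \<open>gap / (m\<^sub>1 m\<^sub>2)\<close>.\<close>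

definition lead :: "bool \<Rightarrow> poly2 \<Rightarrow> poly2" where
  "lead e t = ((cm e t)\<^sup>2 - (cn e t)\<^sup>2) * (cm e t)\<^sup>2"

definition sublead :: "poly2 \<Rightarrow> bool \<Rightarrow> poly2 \<Rightarrow> poly2" where
  "sublead b0 e t = ((cm e t)\<^sup>2 - (cn e t)\<^sup>2) * 2 * cm e t * ck e + b0 * cs e * cn e t * cm e t"

definition mixed :: "bool \<Rightarrow> bool \<Rightarrow> poly2" where
  "mixed e1 e2 = 2 * (cm e1 t1 * cm e2 t2 - cn e1 t1 * cn e2 t2) * cs e1 * cs e2"

definition gap :: "bool \<Rightarrow> bool \<Rightarrow> poly2" where
  "gap e1 e2 = cn e1 t1 * cm e2 t2 - cn e2 t2 * cm e1 t1"

definition C1 :: "bool \<Rightarrow> bool \<Rightarrow> poly2 \<Rightarrow> poly2 \<Rightarrow> diffop" where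
  "C1 e1 e2 b0 b3 = dop (lead e1 t1) 2 0 + dop (mixed e1 e2 * cm e1 t1 * cm e2 t2) 1 1 + dop (lead e2 t2) 0 2
     + dop (sublead b0 e1 t1) 1 0 + dop (sublead b0 e2 t2) 0 1 + dop b3 0 0"

text \<open>The second operator in the chart, multiplied by \<open>m\<^sub>1 m\<^sub>2\<close> to
  clear the denominator of \<open>t\<^sub>1 - t\<^sub>2\<close>. \<open>C1\<close> comes out
  polynomial without such a factor.\<close>

definition C2 :: "bool \<Rightarrow> bool \<Rightarrow> poly2 \<Rightarrow> poly2 \<Rightarrow> poly2 \<Rightarrow> diffop" where
  "C2 e1 e2 b0 b1 b2 =
     fmult (2 * gap e1 e2)
       (fmult (cs e1 * (cm e1 t1)\<^sup>2) (dop (lead e2 t2) 1 2 + dop (sublead b0 e2 t2) 1 1 + dop b1 1 0)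
        + fmult (cs e2 * (cm e2 t2)\<^sup>2) (dop (lead e1 t1) 2 1 + dop (sublead b0 e1 t1) 1 1 + dop b2 0 1))
     - fmult ((2 + b0) * cm e1 t1 * cm e2 t2)
       (dop (lead e2 t2) 0 2 + dop (sublead b0 e2 t2) 0 1 + dop b1 0 0
        - (dop (lead e1 t1) 2 0 + dop (sublead b0 e1 t1) 1 0 + dop b2 0 0))"

text \<open>
  The commutator of \<open>C1\<close> with multiplication by \<open>X\<^sup>k Y\<^sup>l\<close>, \<open>k, l \<in> {0, 1}\<close>, where only inverted
  coordinates have a nonzero exponent.
\<close>

definition CM :: "bool \<Rightarrow> bool \<Rightarrow> poly2 \<Rightarrow> bool \<Rightarrow> bool \<Rightarrow> diffop" where
  "CM e1 e2 b0 k l =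
     dop (ck k * 2 * (t1\<^sup>2 - 1) * t1 + ck l * mixed e1 e2 * cm e1 t1) 1 0
     + dop (ck l * 2 * (t2\<^sup>2 - 1) * t2 + ck k * mixed e1 e2 * cm e2 t2) 0 1
     + dop (- (ck k * ck l * mixed e1 e2 + b0 * (ck k + ck l))) 0 0"

lemmas chart_data = cn_def cm_def cs_def ck_def lead_def sublead_def mixed_def gap_def

lemma ordb_chart:
  "ordb 3 (C1 e1 e2 b0 b3)" "ordb 4 (C2 e1 e2 b0 b1 b2)" "ordb 2 (CM e1 e2 b0 k l)"
  unfolding C1_def C2_def CM_def by (intro ordb_add ordb_diff ordb_fmult ordb_dop; simp)+

lemma act_C1:
  "act (C1 e1 e2 b0 b3) P = fmult (lead e1 t1) (dmult1 (dmult1 P))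
     + fmult (mixed e1 e2 * cm e1 t1 * cm e2 t2) (dmult1 (dmult2 P))
     + fmult (lead e2 t2) (dmult2 (dmult2 P)) + fmult (sublead b0 e1 t1) (dmult1 P)
     + fmult (sublead b0 e2 t2) (dmult2 P) + fmult b3 P"
  by (simp add: C1_def act_add_left act_dop dmono_def numeral_2_eq_2)

lemma act_CM:
  "act (CM e1 e2 b0 k l) P =
     fmult (ck k * 2 * (t1\<^sup>2 - 1) * t1 + ck l * mixed e1 e2 * cm e1 t1) (dmult1 P)
     + fmult (ck l * 2 * (t2\<^sup>2 - 1) * t2 + ck k * mixed e1 e2 * cm e2 t2) (dmult2 P)
     + fmult (- (ck k * ck l * mixed e1 e2 + b0 * (ck k + ck l))) P"
  by (simp add: CM_def act_add_left act_dop dmono_def)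

lemma act_C2:
  "act (C2 e1 e2 b0 b1 b2) P =
     fmult (2 * gap e1 e2)
       (fmult (cs e1 * (cm e1 t1)\<^sup>2) (fmult (lead e2 t2) (dmult1 (dmult2 (dmult2 P)))
          + fmult (sublead b0 e2 t2) (dmult1 (dmult2 P)) + fmult b1 (dmult1 P))
        + fmult (cs e2 * (cm e2 t2)\<^sup>2) (fmult (lead e1 t1) (dmult1 (dmult1 (dmult2 P)))
          + fmult (sublead b0 e1 t1) (dmult1 (dmult2 P)) + fmult b2 (dmult2 P)))
     - fmult ((2 + b0) * cm e1 t1 * cm e2 t2)
       (fmult (lead e2 t2) (dmult2 (dmult2 P)) + fmult (sublead b0 e2 t2) (dmult2 P) + fmult b1 P
        - (fmult (lead e1 t1) (dmult1 (dmult1 P)) + fmult (sublead b0 e1 t1) (dmult1 P) + fmult b2 P))"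
  by (simp add: C2_def act_add_left act_diff act_fmult act_dop dmono_def numeral_2_eq_2)

section \<open>Coefficients of the chart operators and their commutator\<close>

lemma pd_t_power [simp]: "pd1 (t2 ^ n) = 0" "pd2 (t1 ^ n) = 0"
  by (induction n) (simp_all add: pd_simps)

lemma pd_t_powers:
  "pd1 (t1\<^sup>2) = 2 * t1" "pd1 (t1 ^ 3) = 3 * t1\<^sup>2" "pd1 (t1 ^ 4) = 4 * t1 ^ 3" "pd1 (t1 ^ 5) = 5 * t1 ^ 4"
  "pd2 (t2\<^sup>2) = 2 * t2" "pd2 (t2 ^ 3) = 3 * t2\<^sup>2" "pd2 (t2 ^ 4) = 4 * t2 ^ 3" "pd2 (t2 ^ 5) = 5 * t2 ^ 4"
  by (simp_all add: eval_nat_numeral pd_simps algebra_simps)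

lemma lookup_dmult_Suc:
  "lookup (dmult1 P) (0, j) = pd1 (lookup P (0, j))"
  "lookup (dmult1 P) (Suc i, j) = pd1 (lookup P (Suc i, j)) + lookup P (i, j)"
  "lookup (dmult2 P) (i, 0) = pd2 (lookup P (i, 0))"
  "lookup (dmult2 P) (i, Suc j) = pd2 (lookup P (i, Suc j)) + lookup P (i, j)"
  by (simp_all add: lookup_dmult1 lookup_dmult2)

lemma lookup_C1:
  "lookup (C1 e1 e2 b0 b3) (0, 0) = b3"
  "lookup (C1 e1 e2 b0 b3) (Suc 0, 0) = sublead b0 e1 t1"
  "lookup (C1 e1 e2 b0 b3) (0, Suc 0) = sublead b0 e2 t2"
  "lookup (C1 e1 e2 b0 b3) (Suc (Suc 0), 0) = lead e1 t1"
  "lookup (C1 e1 e2 b0 b3) (Suc 0, Suc 0) = mixed e1 e2 * cm e1 t1 * cm e2 t2"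
  "lookup (C1 e1 e2 b0 b3) (0, Suc (Suc 0)) = lead e2 t2"
  "lookup (C1 e1 e2 b0 b3) (Suc (Suc (Suc i)), j) = 0"
  "lookup (C1 e1 e2 b0 b3) (Suc (Suc 0), Suc j) = 0"
  "lookup (C1 e1 e2 b0 b3) (Suc 0, Suc (Suc j)) = 0"
  "lookup (C1 e1 e2 b0 b3) (0, Suc (Suc (Suc j))) = 0"
  by (simp_all add: C1_def lookup_add lookup_dop)

lemma lookup_C2:
  "lookup (C2 e1 e2 b0 b1 b2) (0, 0) = (2 + b0) * cm e1 t1 * cm e2 t2 * (b2 - b1)"
  "lookup (C2 e1 e2 b0 b1 b2) (Suc 0, 0) =
     2 * gap e1 e2 * cs e1 * (cm e1 t1)\<^sup>2 * b1 + (2 + b0) * cm e1 t1 * cm e2 t2 * sublead b0 e1 t1"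
  "lookup (C2 e1 e2 b0 b1 b2) (0, Suc 0) =
     2 * gap e1 e2 * cs e2 * (cm e2 t2)\<^sup>2 * b2 - (2 + b0) * cm e1 t1 * cm e2 t2 * sublead b0 e2 t2"
  "lookup (C2 e1 e2 b0 b1 b2) (Suc (Suc 0), 0) = (2 + b0) * cm e1 t1 * cm e2 t2 * lead e1 t1"
  "lookup (C2 e1 e2 b0 b1 b2) (Suc 0, Suc 0) =
     2 * gap e1 e2 * (cs e1 * (cm e1 t1)\<^sup>2 * sublead b0 e2 t2 + cs e2 * (cm e2 t2)\<^sup>2 * sublead b0 e1 t1)"
  "lookup (C2 e1 e2 b0 b1 b2) (0, Suc (Suc 0)) = - ((2 + b0) * cm e1 t1 * cm e2 t2 * lead e2 t2)"
  "lookup (C2 e1 e2 b0 b1 b2) (Suc (Suc 0), Suc 0) = 2 * gap e1 e2 * cs e2 * (cm e2 t2)\<^sup>2 * lead e1 t1"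
  "lookup (C2 e1 e2 b0 b1 b2) (Suc 0, Suc (Suc 0)) = 2 * gap e1 e2 * cs e1 * (cm e1 t1)\<^sup>2 * lead e2 t2"
  "lookup (C2 e1 e2 b0 b1 b2) (Suc (Suc (Suc i)), j) = 0"
  "lookup (C2 e1 e2 b0 b1 b2) (Suc (Suc 0), Suc (Suc j)) = 0"
  "lookup (C2 e1 e2 b0 b1 b2) (Suc 0, Suc (Suc (Suc j))) = 0"
  "lookup (C2 e1 e2 b0 b1 b2) (0, Suc (Suc (Suc j))) = 0"
  by (simp_all add: C2_def lookup_add lookup_minus lookup_dop algebra_simps numeral_eq_Suc)

lemmas one_clean = mult_zero_left mult_zero_right add_0_left add_0_right mult_1_left mult_1_right diff_0_right power_one minus_zero diff_zero
    mult_minus1 mult_minus1_right power2_minus mult_minus_left mult_minus_right minus_minus diff_0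

text \<open>For each chart the coefficients are expanded into monomials once, so that the
  derivatives taken in the commutator fall on powers up to the fifth only.\<close>

lemma lookup_chart_FF:
  "lookup (C1 False False b0 b3) (0, 0) = b3"
  "lookup (C1 False False b0 b3) (0, Suc 0) = t2 * b0"
  "lookup (C1 False False b0 b3) (0, Suc (Suc 0)) = 1 - t2^2"
  "lookup (C1 False False b0 b3) (Suc 0, 0) = t1 * b0"
  "lookup (C1 False False b0 b3) (Suc 0, Suc 0) = 2 - 2 * t1 * t2"
  "lookup (C1 False False b0 b3) (Suc (Suc 0), 0) = 1 - t1^2"
  "lookup (C2 False False b0 b1 b2) (0, 0) = b0 * b2 - b0 * b1 - 2 * b1 + 2 * b2"
  "lookup (C2 False False b0 b1 b2) (0, Suc 0) = 2 * t1 * b2 - t2 * b0^2 - 2 * t2 * b0 - 2 * t2 * b2"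
  "lookup (C2 False False b0 b1 b2) (0, Suc (Suc 0)) = t2^2 * b0 + 2 * t2^2 - b0 - 2"
  "lookup (C2 False False b0 b1 b2) (Suc 0, 0) = t1 * b0^2 + 2 * t1 * b0 + 2 * t1 * b1 - 2 * t2 * b1"
  "lookup (C2 False False b0 b1 b2) (Suc 0, Suc 0) = 2 * t1^2 * b0 - 2 * t2^2 * b0"
  "lookup (C2 False False b0 b1 b2) (Suc 0, Suc (Suc 0)) = 2 * t1 - 2 * t1 * t2^2 + 2 * t2^3 - 2 * t2"
  "lookup (C2 False False b0 b1 b2) (Suc (Suc 0), 0) = b0 - t1^2 * b0 - 2 * t1^2 + 2"
  "lookup (C2 False False b0 b1 b2) (Suc (Suc 0), Suc 0) = 2 * t1^2 * t2 - 2 * t1^3 + 2 * t1 - 2 * t2"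
  unfolding lookup_C1 lookup_C2 chart_data if_True if_False one_clean
  by (algebra+)?

lemma lookup_chart_FT:
  "lookup (C1 False True b0 b3) (0, 0) = b3"
  "lookup (C1 False True b0 b3) (0, Suc 0) = 2 * t2^3 - t2 * b0 - 2 * t2"
  "lookup (C1 False True b0 b3) (0, Suc (Suc 0)) = t2^4 - t2^2"
  "lookup (C1 False True b0 b3) (Suc 0, 0) = t1 * b0"
  "lookup (C1 False True b0 b3) (Suc 0, Suc 0) = 2 * t1 * t2 - 2 * t2^2"
  "lookup (C1 False True b0 b3) (Suc (Suc 0), 0) = 1 - t1^2"
  "lookup (C2 False True b0 b1 b2) (0, 0) = t2 * b0 * b2 - t2 * b0 * b1 - 2 * t2 * b1 + 2 * t2 * b2"
  "lookup (C2 False True b0 b1 b2) (0, Suc 0) = t2^2 * b0^2 - 2 * t1 * t2^3 * b2 - 2 * t2^4 * b0 - 4 * t2^4 + 4 * t2^2 * b0 + 2 * t2^2 * b2 + 4 * t2^2"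
  "lookup (C2 False True b0 b1 b2) (0, Suc (Suc 0)) = t2^3 * b0 - t2^5 * b0 - 2 * t2^5 + 2 * t2^3"
  "lookup (C2 False True b0 b1 b2) (Suc 0, 0) = t1 * t2 * b0^2 + 2 * t1 * t2 * b0 + 2 * t1 * t2 * b1 - 2 * b1"
  "lookup (C2 False True b0 b1 b2) (Suc 0, Suc 0) = 4 * t1 * t2^4 - 2 * t1^2 * t2^3 * b0 - 4 * t1 * t2^2 - 4 * t2^3 + 2 * t2 * b0 + 4 * t2"
  "lookup (C2 False True b0 b1 b2) (Suc 0, Suc (Suc 0)) = 2 * t1 * t2^5 - 2 * t1 * t2^3 - 2 * t2^4 + 2 * t2^2"
  "lookup (C2 False True b0 b1 b2) (Suc (Suc 0), 0) = t2 * b0 - t1^2 * t2 * b0 - 2 * t1^2 * t2 + 2 * t2"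
  "lookup (C2 False True b0 b1 b2) (Suc (Suc 0), Suc 0) = 2 * t1^3 * t2^3 - 2 * t1^2 * t2^2 - 2 * t1 * t2^3 + 2 * t2^2"
  unfolding lookup_C1 lookup_C2 chart_data if_True if_False one_clean
  by (algebra+)?

lemma lookup_chart_TF:
  "lookup (C1 True False b0 b3) (0, 0) = b3"
  "lookup (C1 True False b0 b3) (0, Suc 0) = t2 * b0"
  "lookup (C1 True False b0 b3) (0, Suc (Suc 0)) = 1 - t2^2"
  "lookup (C1 True False b0 b3) (Suc 0, 0) = 2 * t1^3 - t1 * b0 - 2 * t1"
  "lookup (C1 True False b0 b3) (Suc 0, Suc 0) = 2 * t1 * t2 - 2 * t1^2"
  "lookup (C1 True False b0 b3) (Suc (Suc 0), 0) = t1^4 - t1^2"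
  "lookup (C2 True False b0 b1 b2) (0, 0) = t1 * b0 * b2 - t1 * b0 * b1 - 2 * t1 * b1 + 2 * t1 * b2"
  "lookup (C2 True False b0 b1 b2) (0, Suc 0) = 2 * b2 - t1 * t2 * b0^2 - 2 * t1 * t2 * b0 - 2 * t1 * t2 * b2"
  "lookup (C2 True False b0 b1 b2) (0, Suc (Suc 0)) = t1 * t2^2 * b0 + 2 * t1 * t2^2 - t1 * b0 - 2 * t1"
  "lookup (C2 True False b0 b1 b2) (Suc 0, 0) = 2 * t1^4 * b0 + 4 * t1^4 + 2 * t1^3 * t2 * b1 - t1^2 * b0^2 - 4 * t1^2 * b0 - 2 * t1^2 * b1 - 4 * t1^2"
  "lookup (C2 True False b0 b1 b2) (Suc 0, Suc 0) = 2 * t1^3 * t2^2 * b0 - 4 * t1^4 * t2 + 4 * t1^3 + 4 * t1^2 * t2 - 2 * t1 * b0 - 4 * t1"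
  "lookup (C2 True False b0 b1 b2) (Suc 0, Suc (Suc 0)) = 2 * t1^3 * t2 - 2 * t1^3 * t2^3 + 2 * t1^2 * t2^2 - 2 * t1^2"
  "lookup (C2 True False b0 b1 b2) (Suc (Suc 0), 0) = t1^5 * b0 + 2 * t1^5 - t1^3 * b0 - 2 * t1^3"
  "lookup (C2 True False b0 b1 b2) (Suc (Suc 0), Suc 0) = 2 * t1^4 - 2 * t1^5 * t2 + 2 * t1^3 * t2 - 2 * t1^2"
  unfolding lookup_C1 lookup_C2 chart_data if_True if_False one_clean
  by (algebra+)?

lemma lookup_chart_TT:
  "lookup (C1 True True b0 b3) (0, 0) = b3"
  "lookup (C1 True True b0 b3) (0, Suc 0) = 2 * t2^3 - t2 * b0 - 2 * t2"
  "lookup (C1 True True b0 b3) (0, Suc (Suc 0)) = t2^4 - t2^2"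
  "lookup (C1 True True b0 b3) (Suc 0, 0) = 2 * t1^3 - t1 * b0 - 2 * t1"
  "lookup (C1 True True b0 b3) (Suc 0, Suc 0) = 2 * t1^2 * t2^2 - 2 * t1 * t2"
  "lookup (C1 True True b0 b3) (Suc (Suc 0), 0) = t1^4 - t1^2"
  "lookup (C2 True True b0 b1 b2) (0, 0) = t1 * t2 * b0 * b2 - t1 * t2 * b0 * b1 - 2 * t1 * t2 * b1 + 2 * t1 * t2 * b2"
  "lookup (C2 True True b0 b1 b2) (0, Suc 0) = t1 * t2^2 * b0^2 - 2 * t1 * t2^4 * b0 - 4 * t1 * t2^4 + 4 * t1 * t2^2 * b0 + 2 * t1 * t2^2 * b2 + 4 * t1 * t2^2 - 2 * t2^3 * b2"
  "lookup (C2 True True b0 b1 b2) (0, Suc (Suc 0)) = t1 * t2^3 * b0 - t1 * t2^5 * b0 - 2 * t1 * t2^5 + 2 * t1 * t2^3"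
  "lookup (C2 True True b0 b1 b2) (Suc 0, 0) = 2 * t1^4 * t2 * b0 + 4 * t1^4 * t2 + 2 * t1^3 * b1 - t1^2 * t2 * b0^2 - 4 * t1^2 * t2 * b0 - 2 * t1^2 * t2 * b1 - 4 * t1^2 * t2"
  "lookup (C2 True True b0 b1 b2) (Suc 0, Suc 0) = 4 * t1^4 * t2^2 - 2 * t1^3 * t2 * b0 - 4 * t1^3 * t2 - 4 * t1^2 * t2^4 + 2 * t1 * t2^3 * b0 + 4 * t1 * t2^3"
  "lookup (C2 True True b0 b1 b2) (Suc 0, Suc (Suc 0)) = 2 * t1^3 * t2^4 - 2 * t1^3 * t2^2 - 2 * t1^2 * t2^5 + 2 * t1^2 * t2^3"
  "lookup (C2 True True b0 b1 b2) (Suc (Suc 0), 0) = t1^5 * t2 * b0 + 2 * t1^5 * t2 - t1^3 * t2 * b0 - 2 * t1^3 * t2"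
  "lookup (C2 True True b0 b1 b2) (Suc (Suc 0), Suc 0) = 2 * t1^5 * t2^2 - 2 * t1^4 * t2^3 - 2 * t1^3 * t2^2 + 2 * t1^2 * t2^3"
  unfolding lookup_C1 lookup_C2 chart_data if_True if_False one_clean
  by (algebra+)?

text \<open>All products involved have order at most 5, so the 21 coefficients with
  \<open>i + j < 6\<close> decide. The parameters enter solely as elements killed by both
  derivations.\<close>

lemma commutator_lookup:
  assumes pb: "pd1 b0 = 0" "pd1 b1 = 0" "pd1 b2 = 0" "pd1 b3 = 0" "pd2 b0 = 0" "pd2 b1 = 0" "pd2 b2 = 0" "pd2 b3 = 0"
    and ij: "i + j < 6"
  shows "lookup (act (C1 e1 e2 b0 b3) (C2 e1 e2 b0 b1 b2)) (i, j) =
    lookup (act (C2 e1 e2 b0 b1 b2) (C1 e1 e2 b0 b3)) (i, j) +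
    lookup (act (CM e1 e2 b0 e1 e2) (C2 e1 e2 b0 b1 b2)) (i, j)" (is "?R i j")
proof -
  note expand = act_C1 act_C2 act_CM lookup_add lookup_minus lookup_fmult chart_data if_True if_False
  have sq: "pd1 (b0\<^sup>2) = 0" "pd2 (b0\<^sup>2) = 0"
    by (simp_all add: power2_eq_square pd_simps pb)
  note eval = lookup_dmult_Suc lookup_chart_FF lookup_chart_FT lookup_chart_TF lookup_chart_TT lookup_C1(7-) lookup_C2(9-)
    pd_simps pd_t_powers pd_t_power pd_t pd_1 pd_numeral pb sq pd1_0 pd2_0
  have "i = 0 \<or> i = 1 \<or> i = 2 \<or> i = 3 \<or> i = 4 \<or> i = 5" "j = 0 \<or> j = 1 \<or> j = 2 \<or> j = 3 \<or> j = 4 \<or> j = 5"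
    using ij by linarith+
  moreover have
    "?R (0) (0)" "?R (0) (Suc 0)" "?R (0) (Suc (Suc 0))" "?R (0) (Suc (Suc (Suc 0)))" "?R (0) (Suc (Suc (Suc (Suc 0))))" "?R (0) (Suc (Suc (Suc (Suc (Suc 0)))))"
    "?R (Suc 0) (0)" "?R (Suc 0) (Suc 0)" "?R (Suc 0) (Suc (Suc 0))" "?R (Suc 0) (Suc (Suc (Suc 0)))" "?R (Suc 0) (Suc (Suc (Suc (Suc 0))))"
    "?R (Suc (Suc 0)) (0)" "?R (Suc (Suc 0)) (Suc 0)" "?R (Suc (Suc 0)) (Suc (Suc 0))" "?R (Suc (Suc 0)) (Suc (Suc (Suc 0)))"
    "?R (Suc (Suc (Suc 0))) (0)" "?R (Suc (Suc (Suc 0))) (Suc 0)" "?R (Suc (Suc (Suc 0))) (Suc (Suc 0))"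
    "?R (Suc (Suc (Suc (Suc 0)))) (0)" "?R (Suc (Suc (Suc (Suc 0)))) (Suc 0)"
    "?R (Suc (Suc (Suc (Suc (Suc 0))))) (0)"
    by (cases e1 rule: bool.exhaust; cases e2 rule: bool.exhaust; hypsubst; simp only: expand one_clean;
      simp only: eval one_clean; algebra?)+
  ultimately show ?thesis
    using ij by (elim disjE) (simp_all add: numeral_eq_Suc)
qed

text \<open>In the affine chart \<open>CM\<close> is zero and the two operators commute. Elsewhere
  \<open>C2\<close> is \<open>m\<^sub>1 m\<^sub>2\<close> times the transformed second operator, and
  the commutator with \<open>C1\<close> is produced by this factor alone.\<close>

lemma commutator_chart:
  assumes b: "\<And>b. b \<in> {b0, b1, b2, b3} \<Longrightarrow> pd1 b = 0 \<and> pd2 b = 0"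
  shows "act (C1 e1 e2 b0 b3) (C2 e1 e2 b0 b1 b2) - act (C2 e1 e2 b0 b1 b2) (C1 e1 e2 b0 b3) =
    act (CM e1 e2 b0 e1 e2) (C2 e1 e2 b0 b1 b2)" (is "?L - ?L' = ?R")
proof (rule diffop_eqI)
  fix i j
  have o: "ordb 6 ?L" "ordb 6 ?L'" "ordb 5 ?R"
    using ordb_act[OF ordb_chart(1), of 3 "C2 e1 e2 b0 b1 b2" e1 e2 b0 b3]
      ordb_act[OF ordb_chart(2), of 2 "C1 e1 e2 b0 b3" e1 e2 b0 b1 b2]
      ordb_act[OF ordb_chart(3), of 3 "C2 e1 e2 b0 b1 b2" e1 e2 b0 e1 e2]
      ordb_chart[of e1 e2 b0] by (simp_all add: eval_nat_numeral)
  show "lookup (?L - ?L') (i, j) = lookup ?R (i, j)"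
  proof (cases "6 \<le> i + j")
    case True
    then show ?thesis using ordb_lookup[OF o(1)] ordb_lookup[OF o(2)] ordb_lookup[OF o(3)]
      by (simp add: lookup_minus)
  next
    case False
    then show ?thesis using commutator_lookup[of b0 b1 b2 b3 i j e1 e2] b
      by (simp add: lookup_minus)
  qed
qed

section \<open>Holomorphic functions of two variables\<close>

lemma holo2_derivs:
  assumes "holomorphic2_on u U" "(x, y) \<in> U"
  shows "((\<lambda>z. u (z, y)) has_field_derivative D1 u (x, y)) (at x)"
    and "((\<lambda>z. u (x, z)) has_field_derivative D2 u (x, y)) (at y)"
proof -
  obtain a b where *: "(u has_derivative (\<lambda>(h, k). a * h + b * k)) (at (x, y))"
    using assms by (auto simp: holomorphic2_on_def)
  have "((\<lambda>z. u (z, y)) has_derivative (\<lambda>h. (\<lambda>(h, k). a * h + b * k) (h, 0))) (at x)"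
    by (rule has_derivative_compose[where f = "\<lambda>z. (z, y)", OF _ *]) (auto intro!: derivative_eq_intros)
  then have 1: "((\<lambda>z. u (z, y)) has_field_derivative a) (at x)"
    by (simp add: has_field_derivative_def)
  have "((\<lambda>z. u (x, z)) has_derivative (\<lambda>k. (\<lambda>(h, k). a * h + b * k) (0, k))) (at y)"
    by (rule has_derivative_compose[where f = "\<lambda>z. (x, z)", OF _ *]) (auto intro!: derivative_eq_intros)
  then have 2: "((\<lambda>z. u (x, z)) has_field_derivative b) (at y)"
    by (simp add: has_field_derivative_def)
  show "((\<lambda>z. u (z, y)) has_field_derivative D1 u (x, y)) (at x)"
    "((\<lambda>z. u (x, z)) has_field_derivative D2 u (x, y)) (at y)"
    using 1 2 by (simp_all add: D1_def D2_def DERIV_imp_deriv)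
qed

lemma holo2_open: "holomorphic2_on u U \<Longrightarrow> open U"
  by (simp add: holomorphic2_on_def)

lemma holo2_continuous: "holomorphic2_on u U \<Longrightarrow> continuous_on U u"
  unfolding holomorphic2_on_def
  by (metis continuous_at_imp_continuous_on has_derivative_continuous)

lemma polydisc_in_open:
  fixes U :: "(complex \<times> complex) set"
  assumes "open U" "(x, y) \<in> U"
  obtains r where "r > 0" "cball x r \<times> cball y r \<subseteq> U"
proof -
  obtain A B where AB: "open A" "open B" "(x, y) \<in> A \<times> B" "A \<times> B \<subseteq> U"
    using open_prod_elim[OF assms] by metis
  obtain r s where "r > 0" "cball x r \<subseteq> A" "s > 0" "cball y s \<subseteq> B"
    using AB open_contains_cball by (metis mem_Sigma_iff)
  then have "cball x (min r s) \<times> cball y (min r s) \<subseteq> U" "min r s > 0"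
    using AB(4) by force+
  then show ?thesis using that by blast
qed

text \<open>By Osgood's lemma this is equivalent to holomorphy.\<close>

definition sep_holo :: "(complex \<times> complex \<Rightarrow> complex) \<Rightarrow> (complex \<times> complex) set \<Rightarrow> bool" where
  "sep_holo u U \<longleftrightarrow> open U \<and> continuous_on U u \<and>
     (\<forall>x y. (x, y) \<in> U \<longrightarrow> (\<lambda>z. u (z, y)) field_differentiable (at x) \<and> (\<lambda>z. u (x, z)) field_differentiable (at y))"

lemma holo2_imp_sep: "holomorphic2_on u U \<Longrightarrow> sep_holo u U"
  unfolding sep_holo_def field_differentiable_def
  using holo2_open holo2_continuous holo2_derivs by blast

lemma sep_derivs:
  assumes "sep_holo u U" "(x, y) \<in> U"
  shows "((\<lambda>z. u (z, y)) has_field_derivative D1 u (x, y)) (at x)"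
    and "((\<lambda>z. u (x, z)) has_field_derivative D2 u (x, y)) (at y)"
  using assms by (auto simp: sep_holo_def D1_def D2_def field_differentiable_derivI)

lemma sep_swap: "sep_holo u U \<Longrightarrow> sep_holo (u \<circ> prod.swap) (prod.swap ` U)"
proof -
  assume u: "sep_holo u U"
  have eq: "prod.swap ` U = prod.swap -` U" by force
  have c: "continuous_on A (prod.swap :: complex \<times> complex \<Rightarrow> _)" for A
    by (auto simp: prod.swap_def intro!: continuous_intros)
  have "open (prod.swap -` U)"
    using u c[of UNIV] by (auto simp: sep_holo_def continuous_on_open_vimage)
  moreover have "continuous_on (prod.swap -` U) (u \<circ> prod.swap)"
    using u c by (intro continuous_on_compose) (auto simp: sep_holo_def intro: continuous_on_subset)
  ultimately show ?thesis
    unfolding eq using u by (auto simp: sep_holo_def)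
qed

section \<open>Cauchy's formula in one variable with the other as parameter\<close>

definition circ :: "complex \<Rightarrow> real \<Rightarrow> real \<Rightarrow> complex" where
  "circ x r t = x + r * exp (2 * of_real pi * \<i> * t)"

lemma circ_in: "r > 0 \<Longrightarrow> circ x r t \<in> cball x r" "r > 0 \<Longrightarrow> w \<in> ball x r \<Longrightarrow> circ x r t \<noteq> w"
proof -
  assume r: "r > 0"
  have "norm (exp (2 * of_real pi * \<i> * of_real t)) = 1"
    by (simp add: norm_exp_eq_Re)
  then have *: "dist x (circ x r t) = r"
    using r by (simp add: circ_def dist_norm norm_mult norm_minus_commute)
  then show "circ x r t \<in> cball x r" by simp
  show "circ x r t \<noteq> w" if "w \<in> ball x r" using * that by auto
qed

lemma continuous_circ [continuous_intros]: "continuous_on A f \<Longrightarrow> continuous_on A (\<lambda>q. circ x r (f q))"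
  unfolding circ_def by (intro continuous_intros)

text \<open>The kernel for the first derivative, with the velocity of the circle and the factor
  \<open>1 / (2 pi i)\<close> multiplied out.\<close>

definition cauchy_kernel :: "complex \<Rightarrow> real \<Rightarrow> complex \<Rightarrow> real \<Rightarrow> complex" where
  "cauchy_kernel x r w t = r * exp (2 * of_real pi * \<i> * t) / (circ x r t - w)\<^sup>2"

text \<open>Expresses \<open>D1 u\<close> through values of \<open>u\<close> on a circle; continuity
  and differentiability in the parameter \<open>y\<close> are thereby inherited from
  \<open>u\<close>.\<close>

lemma cauchy_D1:
  assumes u: "sep_holo u U" and r: "r > 0" "cball x r \<times> {y} \<subseteq> U" and w: "w \<in> ball x r"
  shows "D1 u (w, y) = integral (cbox 0 1) (\<lambda>t. u (circ x r t, y) * cauchy_kernel x r w t)"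
proof -
  have fd: "(\<lambda>z. u (z, y)) field_differentiable (at z)" if "z \<in> cball x r" for z
    using u r that by (auto simp: sep_holo_def subset_iff)
  then have hol: "(\<lambda>z. u (z, y)) holomorphic_on cball x r"
    by (auto simp: holomorphic_on_def field_differentiable_at_within)
  have "((\<lambda>z. u (z, y) / (z - w) ^ Suc 1) has_contour_integral
      (2 * pi * \<i>) / fact 1 * (deriv ^^ 1) (\<lambda>z. u (z, y)) w) (circlepath x r)"
    using hol w
    by (intro Cauchy_has_contour_integral_higher_derivative_circlepath)
      (auto intro: holomorphic_on_imp_continuous_on holomorphic_on_subset)
  then have "((\<lambda>t. u (circlepath x r t, y) / (circlepath x r t - w) ^ Suc 1 *
      vector_derivative (circlepath x r) (at t within {0..1})) has_integral
      (2 * pi * \<i>) * deriv (\<lambda>z. u (z, y)) w) {0..1}"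
    by (simp add: has_contour_integral_def)
  then have "((\<lambda>t. 1 / (2 * pi * \<i>) * (u (circlepath x r t, y) / (circlepath x r t - w) ^ Suc 1 *
      vector_derivative (circlepath x r) (at t within {0..1}))) has_integral
      1 / (2 * pi * \<i>) * ((2 * pi * \<i>) * deriv (\<lambda>z. u (z, y)) w)) {0..1}"
    by (rule has_integral_mult_right)
  then have "((\<lambda>t. u (circ x r t, y) * cauchy_kernel x r w t) has_integral deriv (\<lambda>z. u (z, y)) w) {0..1}"
  proof (rule has_integral_eq_rhs[OF has_integral_spike_eq[THEN iffD1, OF negligible_empty], rotated])
    fix t :: real assume "t \<in> {0..1} - {}"
    then have "vector_derivative (circlepath x r) (at t within {0..1}) =
      2 * pi * \<i> * r * exp (2 * of_real pi * \<i> * t)"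
      using vector_derivative_circlepath01 by auto
    then show "u (circ x r t, y) * cauchy_kernel x r w t = 1 / (2 * pi * \<i>) * (u (circlepath x r t, y) /
      (circlepath x r t - w) ^ Suc 1 * vector_derivative (circlepath x r) (at t within {0..1}))"
      by (simp add: circlepath circ_def cauchy_kernel_def power2_eq_square field_simps)
  qed auto
  then show ?thesis by (simp add: D1_def integral_unique)
qed

lemma continuous_cauchy_integrand:
  assumes "continuous_on (cball x r \<times> B) u" "r > 0" "A \<subseteq> ball x r"
  shows "continuous_on ((A \<times> B) \<times> cbox 0 1) (\<lambda>(q, t). u (circ x r t, snd q) * cauchy_kernel x r (fst q) t)"
proof -
  have "continuous_on ((A \<times> B) \<times> cbox 0 1) (\<lambda>p. u (circ x r (snd p), snd (fst p)))"
    using circ_in(1)[OF assms(2)]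
    by (intro continuous_on_compose2[OF assms(1)] continuous_intros) auto
  moreover have "continuous_on ((A \<times> B) \<times> cbox 0 1) (\<lambda>p. cauchy_kernel x r (fst (fst p)) (snd p))"
    unfolding cauchy_kernel_def using circ_in(2)[OF assms(2), of _ x] assms(3)
    by (intro continuous_intros) (auto simp del: mem_ball)
  ultimately show ?thesis by (auto simp: split_def intro!: continuous_on_mult)
qed

lemma sep_D1_continuous:
  assumes u: "sep_holo u U"
  shows "continuous_on U (D1 u)"
proof -
  have "continuous (at q) (D1 u)" if "q \<in> U" for q
  proof -
    obtain x y where q: "q = (x, y)" by force
    obtain r where r: "r > 0" "cball x r \<times> cball y r \<subseteq> U"
      using polydisc_in_open u \<open>q \<in> U\<close> unfolding q sep_holo_def by metis
    have "continuous_on (ball x r \<times> ball y r)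
      (\<lambda>q. integral (cbox 0 1) (\<lambda>t. u (circ x r t, snd q) * cauchy_kernel x r (fst q) t))"
      using u r by (intro integral_continuous_on_param continuous_cauchy_integrand)
        (auto simp: sep_holo_def elim!: continuous_on_subset)
    moreover have "D1 u q = integral (cbox 0 1) (\<lambda>t. u (circ x r t, snd q) * cauchy_kernel x r (fst q) t)"
      if "q \<in> ball x r \<times> ball y r" for q
      using cauchy_D1[OF u r(1), of x "snd q" "fst q"] that r(2) by (cases q) force
    ultimately have "continuous_on (ball x r \<times> ball y r) (D1 u)"
      by (simp cong: continuous_on_cong)
    then show ?thesis
      using r(1) by (simp add: continuous_on_eq_continuous_at open_Times q)
  qed
  then show ?thesis by (simp add: continuous_at_imp_continuous_on)
qed

lemma sep_D2_continuous:
  assumes "sep_holo u U"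
  shows "continuous_on U (D2 u)"
proof -
  have c: "continuous_on A (prod.swap :: complex \<times> complex \<Rightarrow> _)" for A
    by (auto simp: prod.swap_def intro!: continuous_intros)
  have "continuous_on U (D1 (u \<circ> prod.swap) \<circ> prod.swap)"
    using sep_D1_continuous[OF sep_swap[OF assms]] by (intro continuous_on_compose c)
  moreover have "D1 (u \<circ> prod.swap) \<circ> prod.swap = D2 u"
    by (auto simp: fun_eq_iff D1_def D2_def)
  ultimately show ?thesis by simp
qed

lemma sep_D1_differentiable1:
  assumes u: "sep_holo u U" and q: "(x, y) \<in> U"
  shows "(\<lambda>z. D1 u (z, y)) field_differentiable (at x)"
proof -
  obtain r where r: "r > 0" "cball x r \<times> cball y r \<subseteq> U"
    using polydisc_in_open u q unfolding sep_holo_def by metis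
  have "(\<lambda>z. u (z, y)) field_differentiable (at z)" if "z \<in> ball x r" for z
    using u r that by (auto simp: sep_holo_def subset_iff)
  then have "(\<lambda>z. u (z, y)) holomorphic_on ball x r"
    by (auto simp: holomorphic_on_def field_differentiable_at_within)
  then have "deriv (\<lambda>z. u (z, y)) holomorphic_on ball x r"
    by (intro holomorphic_deriv) auto
  then show ?thesis
    using r(1) by (auto simp: D1_def holomorphic_on_open field_differentiable_def)
qed

text \<open>Differentiation of Cauchy's integral under the integral sign. The result is Cauchy's
  integral of \<open>D2 u\<close>, which gives the holomorphy of \<open>D1 u\<close> in
  \<open>y\<close> and the symmetry of the mixed derivatives at once.\<close>

lemma sep_D1_has_D2:
  assumes u: "sep_holo u U" and q: "(x, y) \<in> U"
  obtains r where "r > 0" "cball x r \<times> cball y r \<subseteq> U"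
    "((\<lambda>z. D1 u (x, z)) has_field_derivative
       integral (cbox 0 1) (\<lambda>t. D2 u (circ x r t, y) * cauchy_kernel x r x t)) (at y)"
proof -
  obtain r where r: "r > 0" "cball x r \<times> cball y r \<subseteq> U"
    using polydisc_in_open u q unfolding sep_holo_def by metis
  let ?g = "\<lambda>w t. u (circ x r t, w) * cauchy_kernel x r x t"
  have sub: "(circ x r t, w) \<in> U" if "w \<in> ball y r" for t w
    using r circ_in(1)[OF r(1), of x t] that by (auto simp: subset_iff)
  have c: "continuous_on (ball y r \<times> cbox 0 1) (\<lambda>(w, t). v (circ x r t, w) * cauchy_kernel x r x t)"
    if "continuous_on U v" for v
  proof -
    have "continuous_on (({x} \<times> ball y r) \<times> cbox 0 1) (\<lambda>(q, t). v (circ x r t, snd q) * cauchy_kernel x r (fst q) t)"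
      using that r by (intro continuous_cauchy_integrand) (auto elim!: continuous_on_subset)
    then have "continuous_on (ball y r \<times> cbox 0 1)
        (\<lambda>p. (\<lambda>(q, t). v (circ x r t, snd q) * cauchy_kernel x r (fst q) t) ((x, fst p), snd p))"
      by (rule continuous_on_compose2) (auto intro!: continuous_intros)
    then show ?thesis by (simp add: split_def)
  qed
  have "((\<lambda>w. integral (cbox 0 1) (?g w)) has_field_derivative
      integral (cbox 0 1) (\<lambda>t. D2 u (circ x r t, y) * cauchy_kernel x r x t)) (at y within ball y r)"
  proof (rule leibniz_rule_field_derivative)
    show "((\<lambda>w. ?g w t) has_field_derivative D2 u (circ x r t, w) * cauchy_kernel x r x t) (at w within ball y r)"
      if "w \<in> ball y r" for w t
      using DERIV_cmult_right[OF sep_derivs(2)[OF u sub[OF that]]] by (rule has_field_derivative_at_within)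
    show "continuous_on (ball y r \<times> cbox 0 1) (\<lambda>(w, t). D2 u (circ x r t, w) * cauchy_kernel x r x t)"
      by (rule c) (rule sep_D2_continuous[OF u])
    show "?g w integrable_on cbox 0 1" if "w \<in> ball y r" for w
    proof -
      have "continuous_on (ball y r \<times> cbox 0 1) (\<lambda>(w, t). ?g w t)"
        using u by (intro c) (auto simp: sep_holo_def)
      then have "continuous_on (cbox 0 1) (\<lambda>t. (\<lambda>(w, t). ?g w t) (w, t))"
        by (rule continuous_on_compose2) (use that in \<open>auto intro!: continuous_intros\<close>)
      then show ?thesis by (intro integrable_continuous) simp
    qed
  qed (use r in auto)
  then have *: "((\<lambda>w. integral (cbox 0 1) (?g w)) has_field_derivative
      integral (cbox 0 1) (\<lambda>t. D2 u (circ x r t, y) * cauchy_kernel x r x t)) (at y)"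
    using r(1) at_within_open[of y "ball y r"] by simp
  have "((\<lambda>z. D1 u (x, z)) has_field_derivative
       integral (cbox 0 1) (\<lambda>t. D2 u (circ x r t, y) * cauchy_kernel x r x t)) (at y)"
  proof (rule has_field_derivative_transform_within[OF * r(1)])
    fix w assume "dist w y < r"
    then have "w \<in> cball y r" by (simp add: dist_commute)
    then have "cball x r \<times> {w} \<subseteq> U" using r(2) by blast
    then show "integral (cbox 0 1) (?g w) = D1 u (x, w)"
      using cauchy_D1[OF u r(1), of x w x] r(1) by simp
  qed simp
  then show ?thesis using that r by blast
qed

lemma sep_D1:
  assumes u: "sep_holo u U"
  shows "sep_holo (D1 u) U"
proof -
  have "(\<lambda>z. D1 u (x, z)) field_differentiable (at y)" if "(x, y) \<in> U" for x y
    using sep_D1_has_D2[OF u that] by (metis field_differentiable_def)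
  moreover have "open U" using u by (simp add: sep_holo_def)
  ultimately show ?thesis
    using sep_D1_continuous[OF u] sep_D1_differentiable1[OF u] unfolding sep_holo_def by simp
qed

lemma sep_D2:
  assumes "sep_holo u U"
  shows "sep_holo (D2 u) U"
proof -
  have "sep_holo (D1 (u \<circ> prod.swap) \<circ> prod.swap) (prod.swap ` prod.swap ` U)"
    by (intro sep_swap sep_D1 assms)
  moreover have "D1 (u \<circ> prod.swap) \<circ> prod.swap = D2 u"
    by (auto simp: fun_eq_iff D1_def D2_def)
  ultimately show ?thesis by (simp add: image_image)
qed

lemma sep_D1_D2:
  assumes u: "sep_holo u U" and q: "q \<in> U"
  shows "D2 (D1 u) q = D1 (D2 u) q"
proof -
  obtain x y where xy: "q = (x, y)" by force
  from sep_D1_has_D2[OF u q[unfolded xy]] obtain r where r: "r > 0" "cball x r \<times> cball y r \<subseteq> U"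
    and *: "((\<lambda>z. D1 u (x, z)) has_field_derivative
       integral (cbox 0 1) (\<lambda>t. D2 u (circ x r t, y) * cauchy_kernel x r x t)) (at y)" .
  have "D1 (D2 u) (x, y) = integral (cbox 0 1) (\<lambda>t. D2 u (circ x r t, y) * cauchy_kernel x r x t)"
    using r by (intro cauchy_D1[OF sep_D2[OF u]]) auto
  then show ?thesis using DERIV_imp_deriv[OF *] by (simp add: xy D2_def)
qed

text \<open>Separate holomorphy with continuity makes both partial derivatives continuous by
  Cauchy's formula, and continuous partial derivatives give total differentiability.\<close>

lemma sep_imp_holo2:
  assumes u: "sep_holo u U"
  shows "holomorphic2_on u U"
proof -
  have "\<exists>a b. (u has_derivative (\<lambda>(h, k). a * h + b * k)) (at q)" if "q \<in> U" for q
  proof -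
    obtain x y where q: "q = (x, y)" by force
    obtain r where r: "r > 0" "cball x r \<times> cball y r \<subseteq> U"
      using polydisc_in_open u \<open>q \<in> U\<close> unfolding q sep_holo_def by metis
    let ?X = "ball x r" and ?Y = "ball y r"
    have sub: "(a, b) \<in> U" if "a \<in> ?X" "b \<in> ?Y" for a b using r that by (auto simp: subset_iff)
    have c: "continuous_on (?X \<times> ?Y) (D2 u)"
      using sep_D2_continuous[OF u] sub by (auto elim: continuous_on_subset)
    have "((\<lambda>(a, b). u (a, b)) has_derivative
        (\<lambda>(tx, ty). D1 u (x, y) * tx + blinfun_mult_right (D2 u (x, y)) ty)) (at (x, y) within ?X \<times> ?Y)"
    proof (rule has_derivative_partialsI)
      show "((\<lambda>a. u (a, y)) has_derivative (*) (D1 u (x, y))) (at x within ?X)"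
        using sep_derivs(1)[OF u \<open>q \<in> U\<close>[unfolded q]]
        by (auto simp: has_field_derivative_def intro: has_derivative_at_withinI)
      show "((\<lambda>b. u (a, b)) has_derivative blinfun_apply (blinfun_mult_right (D2 u (a, b)))) (at b within ?Y)"
        if "a \<in> ?X" "b \<in> ?Y" for a b
        using sep_derivs(2)[OF u sub[OF that]]
        by (auto simp: has_field_derivative_def intro: has_derivative_at_withinI)
      have "continuous_on (?X \<times> ?Y) (\<lambda>q. blinfun_mult_right (D2 u q))"
        using c by (intro continuous_intros bounded_linear.continuous_on[OF bounded_linear_blinfun_mult_right])
      then show "continuous (at (x, y) within ?X \<times> ?Y) (\<lambda>(a, b). blinfun_mult_right (D2 u (a, b)))"
        using r(1) by (auto simp: continuous_on_eq_continuous_within split_def)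
    qed (use r in auto)
    moreover have "at (x, y) within ?X \<times> ?Y = at (x, y)"
      using r(1) by (intro at_within_open) (auto simp: open_Times)
    ultimately show ?thesis by (auto simp: q split_def)
  qed
  then show ?thesis using u by (auto simp: holomorphic2_on_def sep_holo_def)
qed

lemma holo2_iff_sep: "holomorphic2_on u U \<longleftrightarrow> sep_holo u U"
  using holo2_imp_sep sep_imp_holo2 by blast

section \<open>Calculus of \<open>D1\<close> and \<open>D2\<close> on holomorphic functions\<close>

lemma holo2_D1: "holomorphic2_on u U \<Longrightarrow> holomorphic2_on (D1 u) U"
  and holo2_D2: "holomorphic2_on u U \<Longrightarrow> holomorphic2_on (D2 u) U"
  by (simp_all add: holo2_iff_sep sep_D1 sep_D2)

lemma D2_D1: "holomorphic2_on u U \<Longrightarrow> q \<in> U \<Longrightarrow> D2 (D1 u) q = D1 (D2 u) q"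
  by (simp add: holo2_iff_sep sep_D1_D2)

lemma D_cong:
  assumes "open U" "q \<in> U" "\<And>p. p \<in> U \<Longrightarrow> f p = g p"
  shows "D1 f q = D1 g q" "D2 f q = D2 g q"
proof -
  obtain x y where q: "q = (x, y)" by force
  obtain r where r: "r > 0" "cball x r \<times> cball y r \<subseteq> U"
    using polydisc_in_open assms unfolding q by metis
  have "\<forall>\<^sub>F z in nhds x. z \<in> ball x r" "\<forall>\<^sub>F z in nhds y. z \<in> ball y r"
    using r(1) by (simp_all add: eventually_nhds_in_open del: mem_ball)
  then have "\<forall>\<^sub>F z in nhds x. f (z, y) = g (z, y)" "\<forall>\<^sub>F z in nhds y. f (x, z) = g (x, z)"
    using r by (auto elim!: eventually_mono intro!: assms(3))
  then show "D1 f q = D1 g q" "D2 f q = D2 g q"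
    by (simp_all add: q D1_def D2_def deriv_cong_ev)
qed

lemma holo2_subset: "holomorphic2_on u U \<Longrightarrow> open V \<Longrightarrow> V \<subseteq> U \<Longrightarrow> holomorphic2_on u V"
  by (auto simp: holomorphic2_on_def)

lemma holo2_basic:
  assumes "open U"
  shows "holomorphic2_on (\<lambda>q. c) U" "holomorphic2_on fst U" "holomorphic2_on snd U"
  using assms by (auto simp: holo2_iff_sep sep_holo_def intro!: continuous_intros)

lemma holo2_arith:
  assumes "holomorphic2_on f U" "holomorphic2_on g U"
  shows "holomorphic2_on (\<lambda>q. f q + g q) U" "holomorphic2_on (\<lambda>q. f q - g q) U"
    "holomorphic2_on (\<lambda>q. f q * g q) U"
    "(\<And>q. q \<in> U \<Longrightarrow> g q \<noteq> 0) \<Longrightarrow> holomorphic2_on (\<lambda>q. f q / g q) U"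
  using assms by (auto simp: holo2_iff_sep sep_holo_def intro!: continuous_intros derivative_intros)

lemma holo2_power: "holomorphic2_on f U \<Longrightarrow> holomorphic2_on (\<lambda>q. f q ^ n) U"
  by (auto simp: holo2_iff_sep sep_holo_def intro!: continuous_intros derivative_intros)

lemma holo2_sum: "open U \<Longrightarrow> (\<And>i. i \<in> I \<Longrightarrow> holomorphic2_on (f i) U) \<Longrightarrow> holomorphic2_on (\<lambda>q. \<Sum>i\<in>I. f i q) U"
  by (induction I rule: infinite_finite_induct) (auto intro: holo2_basic holo2_arith)

lemma D_eqI:
  "((\<lambda>z. f (z, y)) has_field_derivative d) (at x) \<Longrightarrow> D1 f (x, y) = d"
  "((\<lambda>z. f (x, z)) has_field_derivative d) (at y) \<Longrightarrow> D2 f (x, y) = d"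
  by (simp_all add: D1_def D2_def DERIV_imp_deriv)

lemma D_basic: "D1 (\<lambda>q. c) q = 0" "D2 (\<lambda>q. c) q = 0" "D1 fst q = 1" "D2 fst q = 0" "D1 snd q = 0" "D2 snd q = 1"
  by (simp_all add: D1_def D2_def split_def)

lemma D_arith:
  assumes "holomorphic2_on f U" "holomorphic2_on g U" "q \<in> U"
  shows "D1 (\<lambda>q. f q + g q) q = D1 f q + D1 g q" "D2 (\<lambda>q. f q + g q) q = D2 f q + D2 g q"
    "D1 (\<lambda>q. f q - g q) q = D1 f q - D1 g q" "D2 (\<lambda>q. f q - g q) q = D2 f q - D2 g q"
    "D1 (\<lambda>q. f q * g q) q = D1 f q * g q + f q * D1 g q" "D2 (\<lambda>q. f q * g q) q = D2 f q * g q + f q * D2 g q"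
proof -
  obtain x y where q: "q = (x, y)" by force
  note d = holo2_derivs[OF assms(1), of x y] holo2_derivs[OF assms(2), of x y]
  show "D1 (\<lambda>q. f q + g q) q = D1 f q + D1 g q" "D2 (\<lambda>q. f q + g q) q = D2 f q + D2 g q"
    "D1 (\<lambda>q. f q - g q) q = D1 f q - D1 g q" "D2 (\<lambda>q. f q - g q) q = D2 f q - D2 g q"
    "D1 (\<lambda>q. f q * g q) q = D1 f q * g q + f q * D1 g q" "D2 (\<lambda>q. f q * g q) q = D2 f q * g q + f q * D2 g q"
    using assms(3) d unfolding q
    by (auto intro!: D_eqI derivative_eq_intros)
qed

lemma D_sum:
  assumes "\<And>i. i \<in> I \<Longrightarrow> holomorphic2_on (f i) U" "q \<in> U" "open U"
  shows "D1 (\<lambda>q. \<Sum>i\<in>I. f i q) q = (\<Sum>i\<in>I. D1 (f i) q)" "D2 (\<lambda>q. \<Sum>i\<in>I. f i q) q = (\<Sum>i\<in>I. D2 (f i) q)"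
  using assms(1)
  by (induction I rule: infinite_finite_induct)
    (simp_all add: D_basic D_arith[OF _ holo2_sum assms(2)] assms(3))

section \<open>Linear Pfaffian systems\<close>

text \<open>On a closed disc the sum \<open>f\<close> of the norms attains its maximum; the mean
  value inequality bounds this maximum by \<open>n K r\<close>, hence by \<open>1 / 2\<close>, times
  itself, so it is zero.\<close>

lemma linear_ode_zero:
  fixes v :: "nat \<Rightarrow> complex \<Rightarrow> complex" and n :: nat
  assumes der: "\<And>i y. i < n \<Longrightarrow> y \<in> ball y0 r \<Longrightarrow> (v i has_field_derivative (\<Sum>j<n. m i j y * v j y)) (at y)"
    and bnd: "\<And>i j y. i < n \<Longrightarrow> j < n \<Longrightarrow> y \<in> ball y0 r \<Longrightarrow> norm (m i j y) \<le> K"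
    and init: "\<And>i. i < n \<Longrightarrow> v i y0 = 0"
    and K: "K \<ge> 0" "real n * K * r \<le> 1 / 2"
    and "i < n" "y \<in> ball y0 r"
  shows "v i y = 0"
proof -
  define s where "s = dist y0 y"
  have s: "0 \<le> s" "s < r" "cball y0 s \<subseteq> ball y0 r" using assms(7) by (auto simp: s_def)
  define f where "f z = (\<Sum>i<n. norm (v i z))" for z
  have "continuous_on (cball y0 s) (v i)" if "i < n" for i
    using der[OF that] s(3) by (meson DERIV_continuous continuous_at_imp_continuous_on in_mono)
  then have "continuous_on (cball y0 s) f"
    unfolding f_def by (intro continuous_intros) auto
  then obtain z0 where z0: "z0 \<in> cball y0 s" and max: "\<And>z. z \<in> cball y0 s \<Longrightarrow> f z \<le> f z0"
    using continuous_attains_sup[of "cball y0 s" f] s by auto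
  have "f z0 \<ge> 0" by (simp add: f_def sum_nonneg)
  have "norm (v i z0) \<le> K * f z0 * s" if "i < n" for i
  proof -
    have "norm (v i z0 - v i y0) \<le> (K * f z0) * norm (z0 - y0)"
    proof (rule field_differentiable_bound[of "cball y0 s"])
      show "(v i has_field_derivative (\<Sum>j<n. m i j z * v j z)) (at z within cball y0 s)" if "z \<in> cball y0 s" for z
        by (rule has_field_derivative_at_within[OF der[OF \<open>i < n\<close> subsetD[OF s(3) that]]])
      fix z assume z: "z \<in> cball y0 s"
      have "norm (\<Sum>j<n. m i j z * v j z) \<le> (\<Sum>j<n. K * norm (v j z))"
        using bnd[OF \<open>i < n\<close>] z s(3) by (intro sum_norm_le) (auto simp: norm_mult intro!: mult_right_mono)
      also have "\<dots> = K * f z" by (simp add: f_def sum_distrib_left)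
      also have "\<dots> \<le> K * f z0" using max[OF z] K(1) by (rule mult_left_mono)
      finally show "norm (\<Sum>j<n. m i j z * v j z) \<le> K * f z0" .
    qed (use z0 s in auto)
    also have "\<dots> \<le> (K * f z0) * s"
      using z0 K(1) \<open>f z0 \<ge> 0\<close> by (intro mult_left_mono) (auto simp: dist_norm norm_minus_commute)
    finally show ?thesis using init[OF that] by simp
  qed
  then have "f z0 \<le> (\<Sum>i<n. K * f z0 * s)"
    unfolding f_def[of z0] by (intro sum_mono) (simp add: f_def)
  also have "\<dots> = (real n * K * s) * f z0" by simp
  also have "\<dots> \<le> (real n * K * r) * f z0"
    using s K(1) \<open>f z0 \<ge> 0\<close> by (intro mult_right_mono mult_left_mono) auto
  also have "\<dots> \<le> 1 / 2 * f z0" using K(2) \<open>f z0 \<ge> 0\<close> by (rule mult_right_mono)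
  finally have "f z0 = 0" using \<open>f z0 \<ge> 0\<close> by simp
  then have "f y \<le> 0" using max[of y] by (simp add: s_def)
  moreover have "norm (v i y) \<le> f y"
    unfolding f_def using assms(6) by (intro member_le_sum) auto
  ultimately show ?thesis by (metis norm_le_zero_iff order_trans)
qed

text \<open>The primitive is the integral along the segment from \<open>y0\<close>, rescaled to
  \<open>[0, 1]\<close>. The fixed interval permits differentiation under the integral in
  \<open>x\<close>, while on each slice in \<open>y\<close> the integral agrees with an ordinary
  holomorphic primitive.\<close>

lemma holo2_primitive:
  assumes f: "holomorphic2_on f (X \<times> ball y0 r)" and X: "open X" and r: "r > 0"
  shows "\<exists>F. holomorphic2_on F (X \<times> ball y0 r) \<and> (\<forall>x\<in>X. F (x, y0) = 0) \<and> (\<forall>q\<in>X \<times> ball y0 r. D2 F q = f q)"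
proof -
  let ?B = "X \<times> ball y0 r"
  define I where "I q = integral (cbox 0 1) (\<lambda>t. f (fst q, y0 + of_real t * (snd q - y0)))" for q
  define F where "F q = (snd q - y0) * I q" for q
  have seg: "y0 + of_real t * (y - y0) \<in> ball y0 r" if "y \<in> ball y0 r" "t \<in> cbox 0 1" for y and t :: real
  proof -
    have "norm (of_real t * (y - y0)) \<le> 1 * norm (y - y0)"
      unfolding norm_mult using that by (intro mult_right_mono) auto
    then show ?thesis using that by (simp add: dist_norm norm_minus_commute)
  qed
  have c: "continuous_on (?B \<times> cbox 0 1) (\<lambda>(q, t). g (fst q, y0 + of_real t * (snd q - y0)))"
    if "continuous_on ?B g" for g :: "complex \<times> complex \<Rightarrow> complex"
    unfolding split_def
    by (rule continuous_on_compose2[OF that]) (use seg in \<open>force intro!: continuous_intros\<close>)+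
  have cont: "continuous_on ?B F"
    unfolding F_def I_def
    by (intro continuous_intros integral_continuous_on_param c holo2_continuous[OF f])
  have dy: "((\<lambda>z. F (x, z)) has_field_derivative f (x, y)) (at y)" if "x \<in> X" "y \<in> ball y0 r" for x y
  proof -
    have "(\<lambda>z. f (x, z)) holomorphic_on ball y0 r"
      unfolding holomorphic_on_open[OF open_ball] using holo2_derivs(2)[OF f] that(1) by blast
    then obtain G where "\<And>z. z \<in> ball y0 r \<Longrightarrow> (G has_field_derivative f (x, z)) (at z within ball y0 r)"
      using holomorphic_convex_primitive'[OF convex_ball open_ball] by blast
    then have G: "(G has_field_derivative f (x, z)) (at z)" if "z \<in> ball y0 r" for z
      using that at_within_open[OF that open_ball] by metis
    have FG: "F (x, z) = G z - G y0" if z: "z \<in> ball y0 r" for z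
    proof -
      have "((\<lambda>t. (z - y0) * f (x, y0 + of_real t * (z - y0))) has_integral
          G (y0 + of_real 1 * (z - y0)) - G (y0 + of_real 0 * (z - y0))) {0..1}"
      proof (rule fundamental_theorem_of_calculus)
        fix t :: real assume t: "t \<in> {0..1}"
        have "((\<lambda>t. y0 + of_real t * (z - y0)) has_vector_derivative (z - y0)) (at t within {0..1})"
          by (auto intro!: derivative_eq_intros)
        from field_vector_diff_chain_within[OF this, of G "f (x, y0 + of_real t * (z - y0))"]
          G[OF seg[OF z, of t]] t
        show "((\<lambda>t. G (y0 + of_real t * (z - y0))) has_vector_derivative
          (z - y0) * f (x, y0 + of_real t * (z - y0))) (at t within {0..1})"
          by (auto simp: o_def intro: has_field_derivative_at_within)
      qed auto
      from integral_unique[OF this] show ?thesis by (simp add: F_def I_def)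
    qed
    have "((\<lambda>z. G z - G y0) has_field_derivative f (x, y)) (at y)"
      using G[OF that(2)] by (auto intro!: derivative_eq_intros)
    then show ?thesis
      by (rule has_field_derivative_transform_within_open[of _ _ _ "ball y0 r"]) (use that FG in auto)
  qed
  have dx: "(\<lambda>z. F (z, y)) field_differentiable (at x)" if "x \<in> X" "y \<in> ball y0 r" for x y
  proof -
    note xX = that(1)
    obtain e where e: "e > 0" "ball x e \<subseteq> X" using openE[OF X xX] by blast
    let ?g = "\<lambda>z t. f (z, y0 + of_real t * (y - y0))"
    have c': "continuous_on (ball x e \<times> cbox 0 1) (\<lambda>(z, t). g (z, y0 + of_real t * (y - y0)))"
      if "continuous_on ?B g" for g :: "complex \<times> complex \<Rightarrow> complex"
      unfolding split_def
      by (rule continuous_on_compose2[OF that])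
        (use seg[OF \<open>y \<in> ball y0 r\<close>] e in \<open>force intro!: continuous_intros\<close>)+
    have "((\<lambda>z. integral (cbox 0 1) (?g z)) has_field_derivative
        integral (cbox 0 1) (\<lambda>t. D1 f (x, y0 + of_real t * (y - y0)))) (at x within ball x e)"
    proof (rule leibniz_rule_field_derivative)
      show "((\<lambda>z. ?g z t) has_field_derivative D1 f (z, y0 + of_real t * (y - y0))) (at z within ball x e)"
        if "z \<in> ball x e" "t \<in> cbox 0 1" for z t
      proof -
        have "(z, y0 + of_real t * (y - y0)) \<in> ?B"
          using subsetD[OF e(2) that(1)] seg[OF \<open>y \<in> ball y0 r\<close> that(2)] by blast
        then show ?thesis by (rule has_field_derivative_at_within[OF holo2_derivs(1)[OF f]])
      qed
      show "?g z integrable_on cbox 0 1" if "z \<in> ball x e" for z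
      proof -
        have "continuous_on (cbox 0 1) (\<lambda>t. (\<lambda>(z, t). ?g z t) (z, t))"
          by (rule continuous_on_compose2[OF c'[OF holo2_continuous[OF f]]])
            (use that in \<open>auto intro!: continuous_intros\<close>)
        then show ?thesis by (intro integrable_continuous) simp
      qed
      show "continuous_on (ball x e \<times> cbox 0 1) (\<lambda>(z, t). D1 f (z, y0 + of_real t * (y - y0)))"
        by (rule c'[OF holo2_continuous[OF holo2_D1[OF f]]])
    qed (use e in auto)
    then have "(\<lambda>z. integral (cbox 0 1) (?g z)) field_differentiable (at x)"
      unfolding field_differentiable_def using e(1) at_within_open[of x "ball x e"] by fastforce
    then show ?thesis
      unfolding F_def I_def by (auto intro!: derivative_intros)
  qed
  have fy: "(\<lambda>z. F (x, z)) field_differentiable (at y)" if "x \<in> X" "y \<in> ball y0 r" for x y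
    using dy[OF that] unfolding field_differentiable_def by blast
  have "holomorphic2_on F ?B"
    unfolding holo2_iff_sep sep_holo_def using cont dx fy X by (auto simp: open_Times)
  moreover have "F (x, y0) = 0" for x by (simp add: F_def)
  moreover have "D2 F q = f q" if "q \<in> ?B" for q
    using dy that by (cases q) (auto simp: D_eqI)
  ultimately show ?thesis by blast
qed

text \<open>Weierstrass' theorem on every slice; joint continuity also survives the uniform limit,
  so separate holomorphy suffices.\<close>

lemma holo2_uniform_limit:
  assumes f: "\<And>n. holomorphic2_on (f n) B" and lim: "uniform_limit B f g sequentially"
  shows "holomorphic2_on g B"
proof -
  have B: "open B" using f holo2_open by blast
  have slice: "open {z. (z, y) \<in> B}" "open {z. (x, z) \<in> B}" for x y
    using open_vimage[OF B, of "\<lambda>z. (z, y)"] open_vimage[OF B, of "\<lambda>z. (x, z)"]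
    by (simp_all add: vimage_def continuous_on_Pair)
  have "(\<lambda>z. g (z, y)) holomorphic_on {z. (z, y) \<in> B}" for y
  proof (rule holomorphic_uniform_sequence[OF slice(1)])
    show "(\<lambda>z. f n (z, y)) holomorphic_on {z. (z, y) \<in> B}" for n
      unfolding holomorphic_on_open[OF slice(1)] using holo2_derivs(1)[OF f] by blast
    fix x assume "x \<in> {z. (z, y) \<in> B}"
    then obtain d where d: "d > 0" "cball x d \<subseteq> {z. (z, y) \<in> B}"
      using slice(1) open_contains_cball by meson
    then show "\<exists>d>0. cball x d \<subseteq> {z. (z, y) \<in> B} \<and>
        uniform_limit (cball x d) (\<lambda>n z. f n (z, y)) (\<lambda>z. g (z, y)) sequentially"
      using uniform_limit_compose'[OF lim, of "\<lambda>z. (z, y)" "cball x d"] by blast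
  qed
  moreover have "(\<lambda>z. g (x, z)) holomorphic_on {z. (x, z) \<in> B}" for x
  proof (rule holomorphic_uniform_sequence[OF slice(2)])
    show "(\<lambda>z. f n (x, z)) holomorphic_on {z. (x, z) \<in> B}" for n
      unfolding holomorphic_on_open[OF slice(2)] using holo2_derivs(2)[OF f] by blast
    fix y assume "y \<in> {z. (x, z) \<in> B}"
    then obtain d where d: "d > 0" "cball y d \<subseteq> {z. (x, z) \<in> B}"
      using slice(2) open_contains_cball by meson
    then show "\<exists>d>0. cball y d \<subseteq> {z. (x, z) \<in> B} \<and>
        uniform_limit (cball y d) (\<lambda>n z. f n (x, z)) (\<lambda>z. g (x, z)) sequentially"
      using uniform_limit_compose'[OF lim, of "\<lambda>z. (x, z)" "cball y d"] by blast
  qed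
  moreover have "continuous_on B g"
    using f by (intro uniform_limit_theorem[OF always_eventually lim]) (auto intro: holo2_continuous)
  ultimately show ?thesis
    unfolding holo2_iff_sep sep_holo_def using B slice
    by (auto simp: holomorphic_on_open field_differentiable_def)
qed

text \<open>Picard iteration in the second variable; the first one is a parameter.\<close>

lemma linear_ode_param:
  fixes M :: "nat \<Rightarrow> nat \<Rightarrow> complex \<times> complex \<Rightarrow> complex" and n :: nat
  assumes M: "\<And>i j. i < n \<Longrightarrow> j < n \<Longrightarrow> holomorphic2_on (M i j) (X \<times> ball y0 r)"
    and bnd: "\<And>i j q. i < n \<Longrightarrow> j < n \<Longrightarrow> q \<in> X \<times> ball y0 r \<Longrightarrow> norm (M i j q) \<le> K"
    and u: "\<And>i. i < n \<Longrightarrow> u i holomorphic_on X" "\<And>i x. i < n \<Longrightarrow> x \<in> X \<Longrightarrow> norm (u i x) \<le> C"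
    and X: "open X" and r: "r > 0" and K: "K \<ge> 0" "real n * K * r \<le> 1 / 2" and C: "C \<ge> 0"
  shows "\<exists>W. \<forall>i<n. holomorphic2_on (W i) (X \<times> ball y0 r) \<and> (\<forall>x\<in>X. W i (x, y0) = u i x) \<and>
    (\<forall>q\<in>X \<times> ball y0 r. D2 (W i) q = (\<Sum>j<n. M i j q * W j q))"
proof -
  let ?B = "X \<times> ball y0 r"
  have B: "open ?B" using X by (simp add: open_Times)
  define prim where "prim f = (SOME F. holomorphic2_on F ?B \<and> (\<forall>x\<in>X. F (x, y0) = 0) \<and> (\<forall>q\<in>?B. D2 F q = f q))" for f
  have prim: "holomorphic2_on (prim f) ?B" "\<And>x. x \<in> X \<Longrightarrow> prim f (x, y0) = 0" "\<And>q. q \<in> ?B \<Longrightarrow> D2 (prim f) q = f q"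
    if "holomorphic2_on f ?B" for f
    using someI_ex[OF holo2_primitive[OF that X r]] by (auto simp: prim_def)
  have prim_bound: "norm (prim f (x, y)) \<le> D * r" if f: "holomorphic2_on f ?B"
    and D: "\<And>q. q \<in> ?B \<Longrightarrow> norm (f q) \<le> D" and xy: "(x, y) \<in> ?B" for f D x y
  proof -
    have "D \<ge> 0" using D[OF xy] norm_ge_zero order_trans by blast
    have "norm (prim f (x, y) - prim f (x, y0)) \<le> D * norm (y - y0)"
    proof (rule field_differentiable_bound[of "ball y0 r"])
      fix z assume z: "z \<in> ball y0 r"
      have "((\<lambda>z. prim f (x, z)) has_field_derivative D2 (prim f) (x, z)) (at z)"
        using xy z by (intro holo2_derivs[OF prim(1)[OF f]]) auto
      then show "((\<lambda>z. prim f (x, z)) has_field_derivative f (x, z)) (at z within ball y0 r)"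
        using prim(3)[OF f, of "(x, z)"] xy z by (auto intro: has_field_derivative_at_within)
      show "norm (f (x, z)) \<le> D" using D[of "(x, z)"] xy z by auto
    qed (use xy r in auto)
    also have "\<dots> \<le> D * r"
      using xy \<open>D \<ge> 0\<close> by (intro mult_left_mono) (auto simp: dist_norm norm_minus_commute)
    finally show ?thesis using prim(2)[OF f, of x] xy by auto
  qed
  \<comment> \<open>\<open>W k\<close> is the \<open>k\<close>-th increment of the Picard iteration,
    not the \<open>k\<close>-th iterate. The condition \<open>n K r \<le> 1 / 2\<close> makes it
    decay like \<open>C / 2 ^ k\<close>, and the solution is the series of the increments.\<close>
  define W where "W = rec_nat (\<lambda>i q. u i (fst q)) (\<lambda>k W i. prim (\<lambda>q. \<Sum>j<n. M i j q * W j q))"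
  have W0: "W 0 = (\<lambda>i q. u i (fst q))"
    and WS: "W (Suc k) = (\<lambda>i. prim (\<lambda>q. \<Sum>j<n. M i j q * W k j q))" for k
    by (simp_all add: W_def)
  have W: "holomorphic2_on (W k i) ?B \<and> (\<forall>q\<in>?B. norm (W k i q) \<le> C / 2 ^ k)" if "i < n" for k i
    using that
  proof (induction k arbitrary: i)
    case 0
    have "continuous_on ?B (\<lambda>q. u i (fst q))"
      by (rule continuous_on_compose2[OF holomorphic_on_imp_continuous_on[OF u(1)[OF 0]]])
        (auto intro!: continuous_intros)
    moreover have "u i field_differentiable (at x)" if "x \<in> X" for x
      using u(1)[OF 0] X that by (auto simp: holomorphic_on_open field_differentiable_def)
    ultimately show ?case
      using u(2)[OF 0] B by (auto simp: W0 holo2_iff_sep sep_holo_def)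
  next
    case (Suc k)
    let ?f = "\<lambda>q. \<Sum>j<n. M i j q * W k j q"
    have f: "holomorphic2_on ?f ?B"
      using Suc M B by (intro holo2_sum holo2_arith) auto
    have "norm (?f q) \<le> real n * K * (C / 2 ^ k)" if "q \<in> ?B" for q
    proof -
      have "norm (?f q) \<le> (\<Sum>j<n. K * (C / 2 ^ k))"
      proof (rule sum_norm_le)
        fix j assume "j \<in> {..<n}"
        then show "norm (M i j q * W k j q) \<le> K * (C / 2 ^ k)"
          unfolding norm_mult using bnd[OF Suc.prems _ that] Suc.IH that K C by (intro mult_mono) auto
      qed
      then show ?thesis by simp
    qed
    then have 1: "norm (prim ?f q) \<le> real n * K * (C / 2 ^ k) * r" if "q \<in> ?B" for q
      using prim_bound[OF f, of "real n * K * (C / 2 ^ k)" "fst q" "snd q"] that by simp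
    have 2: "real n * K * (C / 2 ^ k) * r \<le> C / 2 ^ Suc k"
    proof -
      have "real n * K * r * (C / 2 ^ k) \<le> 1 / 2 * (C / 2 ^ k)"
        using K C by (intro mult_right_mono) auto
      then show ?thesis by (simp add: mult_ac)
    qed
    have "norm (prim ?f q) \<le> C / 2 ^ Suc k" if "q \<in> ?B" for q
      by (rule order_trans[OF 1[OF that] 2])
    then show ?case using prim(1)[OF f] by (simp add: WS)
  qed
  have geo: "summable (\<lambda>k. D / 2 ^ k)" for D :: real
    using summable_mult[OF summable_geometric[of "1 / 2 :: real"], of D] by (simp add: power_divide)
  have sm: "summable (\<lambda>k. W k i q)" if "i < n" "q \<in> ?B" for i q
    by (rule summable_comparison_test'[OF geo[of C], of 0]) (use W that in auto)
  define S where "S i q = suminf (\<lambda>k. W k i q)" for i q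
  have S: "holomorphic2_on (S i) ?B" if "i < n" for i
  proof (rule holo2_uniform_limit)
    show "holomorphic2_on (\<lambda>q. \<Sum>k<N. W k i q) ?B" for N
      using W[OF that] B by (intro holo2_sum) auto
    show "uniform_limit ?B (\<lambda>N q. \<Sum>k<N. W k i q) (S i) sequentially"
      unfolding S_def by (rule Weierstrass_m_test[OF _ geo[of C]]) (use W that in auto)
  qed
  have W_init: "W (Suc k) i (x, y0) = 0" if "x \<in> X" "i < n" for k i x
    unfolding WS by (rule prim(2)) (use W M B that in \<open>auto intro!: holo2_sum holo2_arith\<close>)
  have "S i (x, y0) = u i x" if "x \<in> X" "i < n" for i x
  proof -
    have "(\<lambda>k. W k i (x, y0)) sums (\<Sum>k\<in>{0}. W k i (x, y0))"
    proof (rule sums_finite)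
      fix k :: nat assume "k \<notin> {0}"
      then show "W k i (x, y0) = 0" using W_init[OF that, of "k - 1"] by (cases k) auto
    qed auto
    then show ?thesis by (simp add: S_def sums_iff W0)
  qed
  moreover have "D2 (S i) q = (\<Sum>j<n. M i j q * S j q)" if i: "i < n" and q: "q \<in> ?B" for i q
  proof -
    obtain x y where xy: "q = (x, y)" "x \<in> X" "y \<in> ball y0 r" using q by auto
    \<comment> \<open>\<open>g k\<close> is the derivative of \<open>W k\<close> in the second
      variable: zero for \<open>k = 0\<close>, where \<open>W\<close> depends on the first variable
      only, and otherwise the matrix applied to the preceding increment. The index shift turns the
      differentiated series back into the matrix applied to \<open>S\<close>.\<close>
    define g where "g k z = (case k of 0 \<Rightarrow> 0 | Suc k \<Rightarrow> \<Sum>j<n. M i j (x, z) * W k j (x, z))" for k z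
    have der: "((\<lambda>z. W k i (x, z)) has_field_derivative g k z) (at z within ball y0 r)"
      if z: "z \<in> ball y0 r" for k z
    proof (cases k)
      case 0
      then show ?thesis by (simp add: W0 g_def)
    next
      case (Suc k')
      have "D2 (W k i) (x, z) = g k z"
        unfolding Suc WS g_def using W M B xy z i
        by (subst prim(3)) (auto intro!: holo2_sum holo2_arith)
      moreover have "((\<lambda>z. W k i (x, z)) has_field_derivative D2 (W k i) (x, z)) (at z)"
        using W[OF i, of k] xy z by (intro holo2_derivs(2)[of _ ?B]) auto
      ultimately show ?thesis by (auto intro: has_field_derivative_at_within)
    qed
    have gb: "norm (g k z) \<le> 2 * real n * K * C / 2 ^ k" if z: "z \<in> ball y0 r" for k z
    proof (cases k)
      case (Suc k')
      have "norm (\<Sum>j<n. M i j (x, z) * W k' j (x, z)) \<le> (\<Sum>j<n. K * (C / 2 ^ k'))"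
      proof (rule sum_norm_le)
        fix j assume "j \<in> {..<n}"
        then show "norm (M i j (x, z) * W k' j (x, z)) \<le> K * (C / 2 ^ k')"
          unfolding norm_mult using bnd[OF i, of _ "(x, z)"] W xy z K C by (intro mult_mono) auto
      qed
      then show ?thesis by (simp add: g_def Suc)
    qed (use K C in \<open>simp add: g_def\<close>)
    have "uniformly_convergent_on (ball y0 r) (\<lambda>N z. \<Sum>k<N. g k z)"
      by (rule Weierstrass_m_test'[OF _ geo]) (use gb in auto)
    from has_field_derivative_series'(2)[OF convex_ball der this, of y0 y] sm[OF i] xy r
    have "((\<lambda>z. S i (x, z)) has_field_derivative suminf (\<lambda>k. g k y)) (at y)"
      by (auto simp: S_def interior_open)
    then have "D2 (S i) q = suminf (\<lambda>k. g k y)" by (simp add: xy D_eqI)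
    also have "\<dots> = suminf (\<lambda>k. g (Suc k) y)"
    proof (subst suminf_split_head)
      show "summable (\<lambda>k. g k y)"
        by (rule summable_comparison_test'[OF geo[of "2 * real n * K * C"], of 0]) (use gb xy in auto)
    qed (simp add: g_def)
    also have "\<dots> = (\<Sum>j<n. M i j q * S j q)"
    proof -
      have s: "summable (\<lambda>k. W k j (x, y))" if "j < n" for j
        using sm[OF that q] by (simp add: xy)
      have "suminf (\<lambda>k. g (Suc k) y) = (\<Sum>j<n. suminf (\<lambda>k. M i j (x, y) * W k j (x, y)))"
        unfolding g_def nat.case by (rule suminf_sum) (use s in \<open>auto intro: summable_mult\<close>)
      then show ?thesis using s by (simp add: S_def xy suminf_mult)
    qed
    finally show ?thesis .
  qed
  ultimately show ?thesis using S by blast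
qed

section \<open>Uniqueness and existence for flat Pfaffian systems\<close>

lemma holo2_restrict:
  assumes f: "holomorphic2_on f U" and y: "\<And>x. x \<in> X \<Longrightarrow> (x, y) \<in> U" and X: "open X"
  shows "holomorphic2_on (\<lambda>q. f (snd q, y)) (UNIV \<times> X)"
proof -
  have "continuous_on (UNIV \<times> X) (\<lambda>q. f (snd q, y))"
    by (rule continuous_on_compose2[OF holo2_continuous[OF f]]) (auto intro!: continuous_intros y)
  then show ?thesis
    using holo2_derivs(1)[OF f y] X
    by (auto simp: holo2_iff_sep sep_holo_def open_Times field_differentiable_def)
qed

lemma holo2_bounded:
  assumes "holomorphic2_on f U" "cball x r \<times> cball y r \<subseteq> U"
  obtains C where "C \<ge> 0" "\<And>q. q \<in> cball x r \<times> cball y r \<Longrightarrow> norm (f q) \<le> C"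
proof -
  have "compact (f ` (cball x r \<times> cball y r))"
    using assms by (intro compact_continuous_image compact_Times compact_cball)
      (auto intro: continuous_on_subset holo2_continuous)
  then obtain C where C: "\<forall>z\<in>f ` (cball x r \<times> cball y r). norm z \<le> C"
    using compact_imp_bounded bounded_iff by metis
  show ?thesis by (rule that[of "max C 0"]) (use C in force)+
qed

lemma contraction_polydisc:
  fixes M N :: "nat \<Rightarrow> nat \<Rightarrow> complex \<times> complex \<Rightarrow> complex" and n :: nat
  assumes U: "open U" "(x, y) \<in> U" and M: "\<And>i j. i < n \<Longrightarrow> j < n \<Longrightarrow> holomorphic2_on (M i j) U"
    and N: "\<And>i j. i < n \<Longrightarrow> j < n \<Longrightarrow> holomorphic2_on (N i j) U"
  shows "\<exists>r K. r > 0 \<and> K \<ge> 0 \<and> cball x r \<times> cball y r \<subseteq> U \<and> real n * K * r \<le> 1 / 2 \<and>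
    (\<forall>i j q. i < n \<longrightarrow> j < n \<longrightarrow> q \<in> cball x r \<times> cball y r \<longrightarrow> norm (M i j q) \<le> K \<and> norm (N i j q) \<le> K)"
proof -
  obtain s where s: "s > 0" "cball x s \<times> cball y s \<subseteq> U" using polydisc_in_open[OF U] .
  have "\<exists>C\<ge>0. \<forall>q\<in>cball x s \<times> cball y s. norm (M i j q) \<le> C \<and> norm (N i j q) \<le> C" if "i < n" "j < n" for i j
  proof -
    note ij = that
    obtain C C' where "C \<ge> 0" "\<And>q. q \<in> cball x s \<times> cball y s \<Longrightarrow> norm (M i j q) \<le> C"
      "C' \<ge> 0" "\<And>q. q \<in> cball x s \<times> cball y s \<Longrightarrow> norm (N i j q) \<le> C'"
      using holo2_bounded[OF M[OF ij] s(2)] holo2_bounded[OF N[OF ij] s(2)] by metis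
    then show ?thesis by (intro exI[of _ "C + C'"]) (auto intro: add_increasing add_increasing2)
  qed
  then obtain C where C: "\<And>i j. i < n \<Longrightarrow> j < n \<Longrightarrow> C i j \<ge> 0"
    "\<And>i j q. i < n \<Longrightarrow> j < n \<Longrightarrow> q \<in> cball x s \<times> cball y s \<Longrightarrow> norm (M i j q) \<le> C i j \<and> norm (N i j q) \<le> C i j"
    by metis
  define K where "K = (\<Sum>i<n. \<Sum>j<n. C i j)"
  have CK: "C i j \<le> K" if "i < n" "j < n" for i j
  proof -
    have "C i j \<le> (\<Sum>j<n. C i j)" using that C(1) by (intro member_le_sum) auto
    also have "\<dots> \<le> K" unfolding K_def
      using that C(1) by (intro member_le_sum[where f = "\<lambda>i. \<Sum>j<n. C i j"]) (auto intro: sum_nonneg)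
    finally show ?thesis .
  qed
  have K: "K \<ge> 0" unfolding K_def using C(1) by (intro sum_nonneg) auto
  \<comment> \<open>\<open>K\<close> is bounded on the larger polydisc first and only then is the
    radius reduced, so the bound persists. The \<open>+ 1\<close> keeps the denominator positive if
    \<open>n K = 0\<close>.\<close>
  define r where "r = min s (1 / (2 * (real n * K + 1)))"
  have nK: "real n * K + 1 > 0" using K by (simp add: add_nonneg_pos)
  have r: "r > 0" "r \<le> s" "r \<le> 1 / (2 * (real n * K + 1))"
    using s(1) nK by (auto simp: r_def)
  have "real n * K * r \<le> (real n * K + 1) * (1 / (2 * (real n * K + 1)))"
    using r K by (intro mult_mono) auto
  also have "\<dots> = 1 / 2" using nK by simp
  finally have "real n * K * r \<le> 1 / 2" .
  moreover have sub: "cball x r \<times> cball y r \<subseteq> cball x s \<times> cball y s" using r(2) by auto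
  moreover have "norm (M i j q) \<le> K \<and> norm (N i j q) \<le> K" if "i < n" "j < n" "q \<in> cball x r \<times> cball y r" for i j q
    using C(2)[OF that(1,2) subsetD[OF sub that(3)]] CK[OF that(1,2)] by linarith
  ultimately show ?thesis
    using s(2) K r(1) by (intro exI[of _ r] exI[of _ K]) blast
qed

lemma D_sum_mult:
  assumes "\<And>j. j \<in> I \<Longrightarrow> holomorphic2_on (f j) U" "\<And>j. j \<in> I \<Longrightarrow> holomorphic2_on (g j) U" "q \<in> U"
  shows "D1 (\<lambda>q. \<Sum>j\<in>I. f j q * g j q) q = (\<Sum>j\<in>I. D1 (f j) q * g j q + f j q * D1 (g j) q)"
    "D2 (\<lambda>q. \<Sum>j\<in>I. f j q * g j q) q = (\<Sum>j\<in>I. D2 (f j) q * g j q + f j q * D2 (g j) q)"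
proof -
  have h: "holomorphic2_on (\<lambda>q. f j q * g j q) U" if "j \<in> I" for j
    using assms that by (intro holo2_arith) auto
  have "D1 (\<lambda>q. \<Sum>j\<in>I. f j q * g j q) q = (\<Sum>j\<in>I. D1 (f j) q * g j q + f j q * D1 (g j) q) \<and>
    D2 (\<lambda>q. \<Sum>j\<in>I. f j q * g j q) q = (\<Sum>j\<in>I. D2 (f j) q * g j q + f j q * D2 (g j) q)"
  proof (cases "I = {}")
    case False
    then have U: "open U" using assms(1) holo2_open by blast
    show ?thesis
      using D_sum[where f = "\<lambda>j q. f j q * g j q", OF h assms(3) U]
        D_arith(5,6)[OF assms(1) assms(2) assms(3)] by simp
  qed (simp add: D_basic)
  then show "D1 (\<lambda>q. \<Sum>j\<in>I. f j q * g j q) q = (\<Sum>j\<in>I. D1 (f j) q * g j q + f j q * D1 (g j) q)"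
    "D2 (\<lambda>q. \<Sum>j\<in>I. f j q * g j q) q = (\<Sum>j\<in>I. D2 (f j) q * g j q + f j q * D2 (g j) q)" by simp_all
qed

text \<open>The initial value propagates along the line \<open>y = y0\<close> by the first system
  and from there along every vertical line by the second.\<close>

lemma pfaffian_unique:
  fixes M1 M2 :: "nat \<Rightarrow> nat \<Rightarrow> complex \<times> complex \<Rightarrow> complex" and n :: nat
  assumes U: "open U" "p \<in> U"
    and M: "\<And>i j. i < n \<Longrightarrow> j < n \<Longrightarrow> holomorphic2_on (M1 i j) U" "\<And>i j. i < n \<Longrightarrow> j < n \<Longrightarrow> holomorphic2_on (M2 i j) U"
    and W: "\<And>i. i < n \<Longrightarrow> holomorphic2_on (W i) U" "\<And>i. i < n \<Longrightarrow> W i p = 0"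
    and eq: "\<And>i q. i < n \<Longrightarrow> q \<in> U \<Longrightarrow> D1 (W i) q = (\<Sum>j<n. M1 i j q * W j q)"
      "\<And>i q. i < n \<Longrightarrow> q \<in> U \<Longrightarrow> D2 (W i) q = (\<Sum>j<n. M2 i j q * W j q)"
  shows "\<forall>\<^sub>F q in nhds p. \<forall>i<n. W i q = 0"
proof -
  obtain x0 y0 where p: "p = (x0, y0)" by force
  obtain r K where r: "r > 0" "K \<ge> 0" "cball x0 r \<times> cball y0 r \<subseteq> U" "real n * K * r \<le> 1 / 2"
    "\<And>i j q. i < n \<Longrightarrow> j < n \<Longrightarrow> q \<in> cball x0 r \<times> cball y0 r \<Longrightarrow> norm (M1 i j q) \<le> K \<and> norm (M2 i j q) \<le> K"
    using contraction_polydisc[where M = M1 and N = M2 and n = n, OF U[unfolded p] M] by blast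
  have sub: "(x, y) \<in> U" if "x \<in> ball x0 r" "y \<in> ball y0 r" for x y
    using r(3) that by (auto simp: subset_iff)
  have x: "W i (x, y0) = 0" if "i < n" "x \<in> ball x0 r" for i x
  proof (rule linear_ode_zero[of n x0 r "\<lambda>i x. W i (x, y0)" "\<lambda>i j x. M1 i j (x, y0)" K])
    show "((\<lambda>x. W i (x, y0)) has_field_derivative (\<Sum>j<n. M1 i j (x, y0) * W j (x, y0))) (at x)"
      if "i < n" "x \<in> ball x0 r" for i x
      using holo2_derivs(1)[OF W(1)[OF that(1)], of x y0] eq(1)[OF that(1), of "(x, y0)"] sub[OF that(2), of y0] r(1)
      by simp
    show "norm (M1 i j (x, y0)) \<le> K" if "i < n" "j < n" "x \<in> ball x0 r" for i j x
      using r(1) r(5)[OF that(1,2), of "(x, y0)"] that(3) by simp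
  qed (use W(2) p r that in auto)
  have "W i (x, y) = 0" if "i < n" "x \<in> ball x0 r" "y \<in> ball y0 r" for i x y
  proof (rule linear_ode_zero[of n y0 r "\<lambda>i y. W i (x, y)" "\<lambda>i j y. M2 i j (x, y)" K])
    show "((\<lambda>y. W i (x, y)) has_field_derivative (\<Sum>j<n. M2 i j (x, y) * W j (x, y))) (at y)"
      if "i < n" "y \<in> ball y0 r" for i y
      using holo2_derivs(2)[OF W(1)[OF that(1)], of x y] eq(2)[OF that(1), of "(x, y)"] sub[OF \<open>x \<in> ball x0 r\<close> that(2)]
      by simp
    show "norm (M2 i j (x, y)) \<le> K" if "i < n" "j < n" "y \<in> ball y0 r" for i j y
      using r(5)[OF that(1,2), of "(x, y)"] that(3) \<open>x \<in> ball x0 r\<close> by simp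
  qed (use x r that in auto)
  moreover have "\<forall>\<^sub>F q in nhds p. q \<in> ball x0 r \<times> ball y0 r"
    using r(1) p by (intro eventually_nhds_in_open) (auto simp: open_Times)
  ultimately show ?thesis by (auto elim!: eventually_mono)
qed

text \<open>Frobenius' theorem for linear systems: the first system is solved along
  \<open>y = y0\<close>, then the second in \<open>y\<close> with \<open>x\<close> as parameter.
  Flatness ensures that the first system stays valid off the initial line.\<close>

lemma pfaffian_exists:
  fixes M1 M2 :: "nat \<Rightarrow> nat \<Rightarrow> complex \<times> complex \<Rightarrow> complex" and n :: nat
  assumes U: "open U" "p \<in> U"
    and M: "\<And>i j. i < n \<Longrightarrow> j < n \<Longrightarrow> holomorphic2_on (M1 i j) U" "\<And>i j. i < n \<Longrightarrow> j < n \<Longrightarrow> holomorphic2_on (M2 i j) U"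
    and flat: "\<And>i j q. i < n \<Longrightarrow> j < n \<Longrightarrow> q \<in> U \<Longrightarrow>
      D2 (M1 i j) q + (\<Sum>k<n. M1 i k q * M2 k j q) = D1 (M2 i j) q + (\<Sum>k<n. M2 i k q * M1 k j q)"
  shows "\<exists>W V. open V \<and> p \<in> V \<and> V \<subseteq> U \<and> (\<forall>i<n. holomorphic2_on (W i) V \<and> W i p = c i \<and>
    (\<forall>q\<in>V. D1 (W i) q = (\<Sum>j<n. M1 i j q * W j q) \<and> D2 (W i) q = (\<Sum>j<n. M2 i j q * W j q)))"
proof -
  obtain x0 y0 where p: "p = (x0, y0)" by force
  obtain r K where r: "r > 0" "K \<ge> 0" "cball x0 r \<times> cball y0 r \<subseteq> U" "real n * K * r \<le> 1 / 2"
    "\<And>i j q. i < n \<Longrightarrow> j < n \<Longrightarrow> q \<in> cball x0 r \<times> cball y0 r \<Longrightarrow> norm (M1 i j q) \<le> K \<and> norm (M2 i j q) \<le> K"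
    using contraction_polydisc[where M = M1 and N = M2 and n = n, OF U[unfolded p] M] by blast
  have sub: "(x, y) \<in> U" if "x \<in> ball x0 r" "y \<in> ball y0 r" for x y
    using r(3) that by (auto simp: subset_iff)
  \<comment> \<open>An ordinary equation in \<open>x\<close> is viewed as one with a dummy parameter
    ranging over the whole plane; the first slot holds the dummy and is set to 0 in the definition
    of \<open>u\<close>.\<close>
  have "\<exists>Z. \<forall>i<n. holomorphic2_on (Z i) (UNIV \<times> ball x0 r) \<and> (\<forall>x\<in>UNIV. Z i (x, x0) = c i) \<and>
    (\<forall>q\<in>UNIV \<times> ball x0 r. D2 (Z i) q = (\<Sum>j<n. M1 i j (snd q, y0) * Z j q))"
  proof (rule linear_ode_param[where K = K and C = "\<Sum>i<n. norm (c i)"])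
    show "holomorphic2_on (\<lambda>q. M1 i j (snd q, y0)) (UNIV \<times> ball x0 r)" if "i < n" "j < n" for i j
      using sub r(1) by (intro holo2_restrict[OF M(1)[OF that]]) auto
    show "norm (M1 i j (snd q, y0)) \<le> K" if "i < n" "j < n" "q \<in> UNIV \<times> ball x0 r" for i j q
      using r(1) r(5)[OF that(1,2), of "(snd q, y0)"] that(3) by auto
    show "norm (c i) \<le> (\<Sum>i<n. norm (c i))" if "i < n" for i
      using that by (intro member_le_sum) auto
  qed (use r in \<open>auto intro: sum_nonneg\<close>)
  then obtain Z where Z': "\<forall>i<n. holomorphic2_on (Z i) (UNIV \<times> ball x0 r) \<and> (\<forall>x\<in>UNIV. Z i (x, x0) = c i) \<and>
    (\<forall>q\<in>UNIV \<times> ball x0 r. D2 (Z i) q = (\<Sum>j<n. M1 i j (snd q, y0) * Z j q))" by (rule exE)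
  have Z: "\<And>i. i < n \<Longrightarrow> holomorphic2_on (Z i) (UNIV \<times> ball x0 r)" "\<And>i. i < n \<Longrightarrow> Z i (0, x0) = c i"
    "\<And>i x. i < n \<Longrightarrow> x \<in> ball x0 r \<Longrightarrow> D2 (Z i) (0, x) = (\<Sum>j<n. M1 i j (x, y0) * Z j (0, x))"
    using Z' by simp_all
  define u where "u i x = Z i (0, x)" for i x
  have u: "(u i has_field_derivative (\<Sum>j<n. M1 i j (x, y0) * u j x)) (at x)" if "i < n" "x \<in> ball x0 r" for i x
    using holo2_derivs(2)[OF Z(1)[OF that(1)], of 0 x] Z(3)[OF that] that by (simp add: u_def[abs_def])
  \<comment> \<open>Halving the radius places the disc in a compact subset of the domain of
    \<open>u\<close>, which supplies the bound on the initial values.\<close>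
  let ?X = "ball x0 (r / 2)"
  have X: "?X \<subseteq> ball x0 r" using r(1) by auto
  have "\<exists>C\<ge>0. \<forall>x\<in>?X. norm (u i x) \<le> C" if "i < n" for i
  proof -
    have "continuous_on (cball x0 (r / 2)) (u i)"
      using DERIV_isCont[OF u[OF that]] r(1) by (intro continuous_at_imp_continuous_on) auto
    then have "bounded (u i ` cball x0 (r / 2))"
      using compact_continuous_image compact_imp_bounded compact_cball by blast
    then obtain C where C: "\<forall>x\<in>cball x0 (r / 2). norm (u i x) \<le> C"
      by (auto simp: bounded_iff)
    have "norm (u i x) \<le> max C 0" if "x \<in> ?X" for x
      using bspec[OF C, of x] that by auto
    then show ?thesis by (intro exI[of _ "max C 0"]) simp
  qed
  then obtain C where C: "\<And>i. i < n \<Longrightarrow> C i \<ge> 0" "\<And>i x. i < n \<Longrightarrow> x \<in> ?X \<Longrightarrow> norm (u i x) \<le> C i"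
    by metis
  let ?B = "?X \<times> ball y0 r"
  have BU: "?B \<subseteq> U" using sub X by auto
  have "\<exists>W. \<forall>i<n. holomorphic2_on (W i) ?B \<and> (\<forall>x\<in>?X. W i (x, y0) = u i x) \<and>
    (\<forall>q\<in>?B. D2 (W i) q = (\<Sum>j<n. M2 i j q * W j q))"
  proof (rule linear_ode_param[where K = K and C = "\<Sum>i<n. C i"])
    show "holomorphic2_on (M2 i j) ?B" if "i < n" "j < n" for i j
      using BU by (intro holo2_subset[OF M(2)[OF that]]) (auto simp: open_Times)
    show "norm (M2 i j q) \<le> K" if "i < n" "j < n" "q \<in> ?B" for i j q
      using r(5)[OF that(1,2), of q] that(3) r(1) by auto
    show "u i holomorphic_on ?X" if "i < n" for i
      unfolding holomorphic_on_open[OF open_ball] using u[OF that] X by blast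
    show "norm (u i x) \<le> (\<Sum>i<n. C i)" if "i < n" "x \<in> ?X" for i x
      using C(2)[OF that] member_le_sum[of i "{..<n}" C] that C(1) by force
  qed (use r C in \<open>auto intro: sum_nonneg\<close>)
  then obtain W where W': "\<forall>i<n. holomorphic2_on (W i) ?B \<and> (\<forall>x\<in>?X. W i (x, y0) = u i x) \<and>
    (\<forall>q\<in>?B. D2 (W i) q = (\<Sum>j<n. M2 i j q * W j q))" by (rule exE)
  have W: "\<And>i. i < n \<Longrightarrow> holomorphic2_on (W i) ?B" "\<And>i x. i < n \<Longrightarrow> x \<in> ?X \<Longrightarrow> W i (x, y0) = u i x"
    "\<And>i q. i < n \<Longrightarrow> q \<in> ?B \<Longrightarrow> D2 (W i) q = (\<Sum>j<n. M2 i j q * W j q)"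
    using W' by blast+
  have B: "open ?B" by (simp add: open_Times)
  have MB: "holomorphic2_on (M1 i j) ?B" "holomorphic2_on (M2 i j) ?B" if "i < n" "j < n" for i j
    using M[OF that] holo2_subset B BU by auto
  \<comment> \<open>The defect of the first system. By flatness it solves the second, linear system
    in \<open>y\<close>, and it vanishes at \<open>y0\<close> by the choice of \<open>u\<close>;
    hence it is zero.\<close>
  define V where "V i q = D1 (W i) q - (\<Sum>j<n. M1 i j q * W j q)" for i q
  have hsum: "holomorphic2_on (\<lambda>q. \<Sum>j<n. M1 i j q * W j q) ?B" if "i < n" for i
    using MB W(1) that B by (intro holo2_sum holo2_arith) auto
  have V: "holomorphic2_on (V i) ?B" if "i < n" for i
    unfolding V_def using hsum W(1) that by (intro holo2_arith holo2_D1) auto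
  have DV: "D2 (V i) q = (\<Sum>j<n. M2 i j q * V j q)" if i: "i < n" and q: "q \<in> ?B" for i q
  proof -
    have "D2 (V i) q = D2 (D1 (W i)) q - (\<Sum>j<n. D2 (M1 i j) q * W j q + M1 i j q * D2 (W j) q)"
      unfolding V_def D_arith(4)[OF holo2_D1[OF W(1)[OF i]] hsum[OF i] q]
      using MB W(1) i by (subst D_sum_mult(2)[OF _ _ q]) auto
    also have "D2 (D1 (W i)) q = D1 (\<lambda>q. \<Sum>j<n. M2 i j q * W j q) q"
      using D2_D1[OF W(1)[OF i] q] D_cong(1)[OF B q, of "D2 (W i)"] W(3)[OF i] by simp
    also have "\<dots> = (\<Sum>j<n. D1 (M2 i j) q * W j q + M2 i j q * D1 (W j) q)"
      using MB W(1) i by (subst D_sum_mult(1)[OF _ _ q]) auto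
    finally have "D2 (V i) q = (\<Sum>j<n. D1 (M2 i j) q * W j q + M2 i j q * D1 (W j) q)
      - (\<Sum>j<n. D2 (M1 i j) q * W j q + M1 i j q * D2 (W j) q)" .
    also have "(\<Sum>j<n. D2 (M1 i j) q * W j q + M1 i j q * D2 (W j) q) =
        (\<Sum>j<n. D2 (M1 i j) q * W j q) + (\<Sum>j<n. \<Sum>k<n. M1 i j q * M2 j k q * W k q)"
      using W(3) q by (simp add: sum.distrib sum_distrib_left mult.assoc)
    also have "\<dots> = (\<Sum>j<n. D2 (M1 i j) q * W j q) + (\<Sum>k<n. (\<Sum>j<n. M1 i j q * M2 j k q) * W k q)"
      by (subst sum.swap) (simp add: sum_distrib_right)
    also have "\<dots> = (\<Sum>j<n. (D2 (M1 i j) q + (\<Sum>k<n. M1 i k q * M2 k j q)) * W j q)"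
      by (simp add: sum.distrib distrib_right)
    also have "\<dots> = (\<Sum>j<n. (D1 (M2 i j) q + (\<Sum>k<n. M2 i k q * M1 k j q)) * W j q)"
      using flat[OF i _ subsetD[OF BU q]] by simp
    also have "\<dots> = (\<Sum>j<n. D1 (M2 i j) q * W j q) + (\<Sum>j<n. \<Sum>k<n. M2 i k q * M1 k j q * W j q)"
      by (simp add: sum.distrib distrib_right sum_distrib_right)
    also have "(\<Sum>j<n. \<Sum>k<n. M2 i k q * M1 k j q * W j q) = (\<Sum>k<n. M2 i k q * (\<Sum>j<n. M1 k j q * W j q))"
      by (subst sum.swap) (simp add: sum_distrib_left mult.assoc)
    finally show ?thesis
      by (simp add: V_def[abs_def] sum.distrib sum_subtractf right_diff_distrib)
  qed
  have "V i (x, y) = 0" if "i < n" "x \<in> ?X" "y \<in> ball y0 r" for i x y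
  proof (rule linear_ode_zero[of n y0 r "\<lambda>i y. V i (x, y)" "\<lambda>i j y. M2 i j (x, y)" K])
    show "((\<lambda>y. V i (x, y)) has_field_derivative (\<Sum>j<n. M2 i j (x, y) * V j (x, y))) (at y)"
      if "i < n" "y \<in> ball y0 r" for i y
      using holo2_derivs(2)[OF V[OF that(1)], of x y] DV[OF that(1), of "(x, y)"] that \<open>x \<in> ?X\<close> by simp
    show "norm (M2 i j (x, y)) \<le> K" if "i < n" "j < n" "y \<in> ball y0 r" for i j y
      using r(1) r(5)[OF that(1,2), of "(x, y)"] that(3) \<open>x \<in> ?X\<close> by auto
    show "V i (x, y0) = 0" if "i < n" for i
    proof -
      have "((\<lambda>z. W i (z, y0)) has_field_derivative (\<Sum>j<n. M1 i j (x, y0) * u j x)) (at x)"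
        by (rule has_field_derivative_transform_within_open[OF u open_ball \<open>x \<in> ?X\<close>])
          (use that \<open>x \<in> ?X\<close> X W(2) in auto)
      then have "D1 (W i) (x, y0) = (\<Sum>j<n. M1 i j (x, y0) * u j x)" by (rule D_eqI)
      then show ?thesis using W(2) \<open>x \<in> ?X\<close> by (simp add: V_def)
    qed
  qed (use r that in auto)
  then have "D1 (W i) q = (\<Sum>j<n. M1 i j q * W j q)" if "i < n" "q \<in> ?B" for i q
    using that by (cases q) (auto simp: V_def)
  moreover have "W i p = c i" if "i < n" for i
    using W(2)[OF that, of x0] Z(2)[OF that] r(1) by (simp add: p u_def)
  moreover have "p \<in> ?B" using r(1) by (simp add: p)
  ultimately show ?thesis
    using W(1,3) B BU by (intro exI[of _ W] exI[of _ ?B] conjI allI impI ballI) simp_all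
qed

section \<open>Operators acting on holomorphic functions\<close>

lemma eval2_pCons: "eval2 (pCons a p) q = poly a (fst q) + snd q * eval2 p q"
  by (simp add: eval2_def split_def)

lemma eval2_pd_pCons:
  "eval2 (pd1 (pCons a p)) q = poly (pderiv a) (fst q) + snd q * eval2 (pd1 p) q"
  "eval2 (pd2 (pCons a p)) q = eval2 p q + snd q * eval2 (pd2 p) q"
  by (simp_all add: pd1_def pd2_def map_poly_pCons pderiv_pCons eval2_pCons)

lemma eval2_derivs:
  "((\<lambda>z. eval2 p (z, y)) has_field_derivative eval2 (pd1 p) (x, y)) (at x)"
  "((\<lambda>z. eval2 p (x, z)) has_field_derivative eval2 (pd2 p) (x, y)) (at y)"
  by (induction p)
    (auto simp: eval2_pCons eval2_pd_pCons intro!: derivative_eq_intros poly_DERIV)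

lemma D_eval2: "D1 (eval2 p) q = eval2 (pd1 p) q" "D2 (eval2 p) q = eval2 (pd2 p) q"
  using eval2_derivs by (cases q; auto intro: D_eqI)+

lemma continuous_eval2: "continuous_on A (eval2 p)"
proof (induction p)
  case (pCons a p)
  have "continuous_on A (\<lambda>q. poly a (fst q) + snd q * eval2 p q)"
    using pCons by (intro continuous_intros)
  then show ?case by (simp add: eval2_pCons[abs_def])
qed (simp add: eval2_def split_def)

lemma holo2_eval2: "open U \<Longrightarrow> holomorphic2_on (eval2 p) U"
  unfolding holo2_iff_sep sep_holo_def field_differentiable_def
  using eval2_derivs continuous_eval2 by blast

definition dapp :: "nat \<Rightarrow> nat \<Rightarrow> (complex \<times> complex \<Rightarrow> complex) \<Rightarrow> complex \<times> complex \<Rightarrow> complex" where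
  "dapp i j u = (D1 ^^ i) ((D2 ^^ j) u)"

lemma dapp_simps [simp]: "dapp 0 0 u = u" "dapp (Suc i) j u = D1 (dapp i j u)" "dapp 0 (Suc j) u = D2 (dapp 0 j u)"
  by (simp_all add: dapp_def)

lemma holo2_dapp: "holomorphic2_on u U \<Longrightarrow> holomorphic2_on (dapp i j u) U"
proof (induction i)
  case 0
  then show ?case by (induction j) (auto intro: holo2_D2)
qed (auto intro: holo2_D1)

lemma D2_dapp:
  assumes u: "holomorphic2_on u U" and q: "q \<in> U"
  shows "D2 (dapp i j u) q = dapp i (Suc j) u q"
  using q
proof (induction i arbitrary: q)
  case (Suc i)
  have "D2 (dapp (Suc i) j u) q = D1 (D2 (dapp i j u)) q"
    using D2_D1[OF holo2_dapp[OF u] Suc.prems] by simp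
  also have "\<dots> = D1 (dapp i (Suc j) u) q"
    using Suc.IH by (intro D_cong(1)[OF holo2_open[OF u] Suc.prems])
  finally show ?case by simp
qed simp

lemma dop_apply_superset:
  assumes "finite S" "Poly_Mapping.keys P \<subseteq> S"
  shows "dop_apply P u q = (\<Sum>(i, j)\<in>S. eval2 (lookup P (i, j)) q * dapp i j u q)"
  using lookup_sum_superset[OF assms, of "\<lambda>(i, j) c. eval2 c q * dapp i j u q"]
  by (auto simp: dop_apply_def dapp_def split_def)

lemma dop_apply_0 [simp]: "dop_apply 0 u q = 0"
  by (simp add: dop_apply_def)

lemma dop_apply_dop: "dop_apply (dop c i j) u q = eval2 c q * dapp i j u q"
  by (subst dop_apply_superset[of "{(i, j)}"]) (auto simp: dop_def lookup_single)

lemma dop_apply_add: "dop_apply (P + Q) u q = dop_apply P u q + dop_apply Q u q"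
proof -
  let ?S = "Poly_Mapping.keys P \<union> Poly_Mapping.keys Q"
  have "dop_apply (P + Q) u q = (\<Sum>(i, j)\<in>?S. eval2 (lookup (P + Q) (i, j)) q * dapp i j u q)"
    by (rule dop_apply_superset) (auto simp: Poly_Mapping.keys_add)
  also have "\<dots> = (\<Sum>(i, j)\<in>?S. eval2 (lookup P (i, j)) q * dapp i j u q)
      + (\<Sum>(i, j)\<in>?S. eval2 (lookup Q (i, j)) q * dapp i j u q)"
    by (simp add: split_def lookup_add distrib_right sum.distrib)
  also have "\<dots> = dop_apply P u q + dop_apply Q u q"
    by (subst (1 2) dop_apply_superset[symmetric]) auto
  finally show ?thesis .
qed

lemma dop_apply_fmult: "dop_apply (fmult f P) u q = eval2 f q * dop_apply P u q"
proof -
  have "dop_apply (fmult f P) u q = (\<Sum>(i, j)\<in>Poly_Mapping.keys P. eval2 (lookup (fmult f P) (i, j)) q * dapp i j u q)"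
    by (rule dop_apply_superset) (auto simp: in_keys_iff)
  then show ?thesis by (simp add: dop_apply_def dapp_def split_def sum_distrib_left mult.assoc)
qed

lemma dop_apply_diff: "dop_apply (P - Q) u q = dop_apply P u q - dop_apply Q u q"
  using dop_apply_add[of "P - Q" Q u q] by simp

lemma holo2_dop_apply:
  assumes "holomorphic2_on u U"
  shows "holomorphic2_on (dop_apply P u) U"
proof (induction P rule: diffop_induct)
  case (add P Q)
  then show ?case using holo2_arith(1) by (simp add: dop_apply_add[abs_def])
next
  case (dop c i j)
  then show ?case using holo2_arith(3)[OF holo2_eval2 holo2_dapp] holo2_open assms
    by (simp add: dop_apply_dop[abs_def])
qed

lemma dop_apply_dmult:
  assumes u: "holomorphic2_on u U" and q: "q \<in> U"
  shows "dop_apply (dmult1 P) u q = D1 (dop_apply P u) q"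
    and "dop_apply (dmult2 P) u q = D2 (dop_apply P u) q"
proof -
  have "dop_apply (dmult1 P) u q = D1 (dop_apply P u) q \<and> dop_apply (dmult2 P) u q = D2 (dop_apply P u) q"
  proof (induction P rule: diffop_induct)
    case (add P Q)
    then show ?case
      by (simp add: dop_apply_add[abs_def] dmult1_add dmult2_add
          D_arith[OF holo2_dop_apply[OF u] holo2_dop_apply[OF u] q])
  next
    case (dop c i j)
    have "holomorphic2_on (eval2 c) U" using u holo2_eval2 holo2_open by blast
    then show ?case
      using D2_dapp[OF u q]
      by (simp add: dmult_dop dop_apply_add dop_apply_dop[abs_def] D_eval2
          D_arith[OF _ holo2_dapp[OF u] q])
  qed
  then show "dop_apply (dmult1 P) u q = D1 (dop_apply P u) q" "dop_apply (dmult2 P) u q = D2 (dop_apply P u) q"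
    by simp_all
qed

lemma left_ideal_annihilates:
  assumes u: "holomorphic2_on u U" and S: "\<And>P q. P \<in> S \<Longrightarrow> q \<in> U \<Longrightarrow> dop_apply P u q = 0"
    and P: "P \<in> left_ideal S" and q: "q \<in> U"
  shows "dop_apply P u q = 0"
  using P q
proof (induction arbitrary: q)
  case (dmult1 P)
  then show ?case
    using dop_apply_dmult(1)[OF u] D_cong(1)[OF holo2_open[OF u], of q "dop_apply P u" "\<lambda>_. 0"]
    by (simp add: D_basic)
next
  case (dmult2 P)
  then show ?case
    using dop_apply_dmult(2)[OF u] D_cong(2)[OF holo2_open[OF u], of q "dop_apply P u" "\<lambda>_. 0"]
    by (simp add: D_basic)
qed (auto simp: dop_apply_add dop_apply_fmult S)

lemma dop_apply_C1:
  "dop_apply (C1 e1 e2 b0 b3) u q =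
    eval2 (lead e1 t1) q * D1 (D1 u) q + eval2 (mixed e1 e2 * cm e1 t1 * cm e2 t2) q * D1 (D2 u) q
    + eval2 (lead e2 t2) q * D2 (D2 u) q + eval2 (sublead b0 e1 t1) q * D1 u q
    + eval2 (sublead b0 e2 t2) q * D2 u q + eval2 b3 q * u q"
  by (simp add: C1_def dop_apply_add dop_apply_dop numeral_2_eq_2)

lemma dop_apply_C2:
  "dop_apply (C2 e1 e2 b0 b1 b2) u q =
     eval2 (2 * gap e1 e2) q *
       (eval2 (cs e1 * (cm e1 t1)\<^sup>2) q * (eval2 (lead e2 t2) q * D1 (D2 (D2 u)) q
          + eval2 (sublead b0 e2 t2) q * D1 (D2 u) q + eval2 b1 q * D1 u q)
        + eval2 (cs e2 * (cm e2 t2)\<^sup>2) q * (eval2 (lead e1 t1) q * D1 (D1 (D2 u)) q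
          + eval2 (sublead b0 e1 t1) q * D1 (D2 u) q + eval2 b2 q * D2 u q))
     - eval2 ((2 + b0) * cm e1 t1 * cm e2 t2) q *
       (eval2 (lead e2 t2) q * D2 (D2 u) q + eval2 (sublead b0 e2 t2) q * D2 u q + eval2 b1 q * u q
        - (eval2 (lead e1 t1) q * D1 (D1 u) q + eval2 (sublead b0 e1 t1) q * D1 u q + eval2 b2 q * u q))"
  by (simp add: C2_def dop_apply_add dop_apply_diff dop_apply_fmult dop_apply_dop numeral_2_eq_2)

lemma Z2_gens_chart:
  "Z2_P1 A0 A1 A2 A3 = C1 False False (cst (par0 A0)) (cst (par A0 A3))"
  "Z2_P2 A0 A1 A2 A3 = C2 False False (cst (par0 A0)) (cst (par A0 A1)) (cst (par A0 A2))"
  by (rule diffop_eqI, auto simp: Z2_P1_def Z2_P2_def C1_def C2_def chart_data Let_def lookup_add lookup_minus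
      lookup_dop algebra_simps)+

section \<open>The Pfaffian system of rank six\<close>

text \<open>
  For a solution \<open>u\<close> put \<open>L\<^sub>1 = (1 - t\<^sub>1\<^sup>2) \<partial>\<^sub>1\<^sub>1 + a\<^sub>0 t\<^sub>1 \<partial>\<^sub>1 + a\<^sub>2\<close> and
  \<open>L\<^sub>2 = (1 - t\<^sub>2\<^sup>2) \<partial>\<^sub>2\<^sub>2 + a\<^sub>0 t\<^sub>2 \<partial>\<^sub>2 + a\<^sub>1\<close>.  The unknowns are
  \<open>u, \<partial>\<^sub>1 u, \<partial>\<^sub>2 u, \<partial>\<^sub>1\<^sub>2 u, L\<^sub>2 u - L\<^sub>1 u, \<partial>\<^sub>1 L\<^sub>2 u - \<partial>\<^sub>2 L\<^sub>1 u\<close>.  An entry \<open>(N, i, k)\<close> of the first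
  matrix stands for \<open>N / (4 (1 - t\<^sub>1\<^sup>2)\<^sup>i (t\<^sub>1 - t\<^sub>2)\<^sup>k)\<close>, one of the second matrix for
  \<open>N / (4 (1 - t\<^sub>2\<^sup>2)\<^sup>i (t\<^sub>1 - t\<^sub>2)\<^sup>k)\<close>.
\<close>

definition ent1 :: "poly2 \<times> nat \<times> nat \<Rightarrow> complex \<times> complex \<Rightarrow> complex" where
  "ent1 = (\<lambda>(N, i, k) q. eval2 N q / (4 * (1 - fst q ^ 2) ^ i * (fst q - snd q) ^ k))"

definition ent2 :: "poly2 \<times> nat \<times> nat \<Rightarrow> complex \<times> complex \<Rightarrow> complex" where
  "ent2 = (\<lambda>(N, i, k) q. eval2 N q / (4 * (1 - snd q ^ 2) ^ i * (fst q - snd q) ^ k))"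

text \<open>Row \<open>i\<close> gives the \<open>\<partial>\<^sub>1\<close>-derivative of the
  \<open>i\<close>-th unknown. The long last row results from eliminating a derivative of order
  four, as in \<open>pfaffian_elimination\<close>, over a common denominator.\<close>

definition mat1 :: "complex \<Rightarrow> complex \<Rightarrow> complex \<Rightarrow> complex \<Rightarrow> (poly2 \<times> nat \<times> nat) list list" where
  "mat1 b0 b1 b2 b3 =
    [
      [(0, 0, 0), (4, 0, 0), (0, 0, 0), (0, 0, 0), (0, 0, 0), (0, 0, 0)],
      [(2 * cst b1 - 2 * cst b2 - 2 * cst b3, 1, 0), (- (4 * t1 * cst b0), 1, 0), (0, 0, 0), (4 * t1 * t2 - 4, 1, 0),
        (- (2), 1, 0), (0, 0, 0)],
      [(0, 0, 0), (0, 0, 0), (0, 0, 0), (4, 0, 0), (0, 0, 0), (0, 0, 0)],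
      [(0, 0, 0), (0, 0, 0), (- (4 * cst b2), 1, 0), (- (4 * t1 * cst b0), 1, 0), (cst b0 + 2, 1, 1), (- (2), 1, 0)],
      [(0, 0, 0), (4 * cst b3 - 4 * cst b1 - 4 * cst b2, 0, 0), (8 * t1 * t2 * cst b2 - 8 * cst b2, 1, 0), (8 * t1^2 *
        t2 * cst b0 + 8 * t1^2 * t2 - 8 * t1 * cst b0 - 8 * t2, 1, 0), (4 * cst b0 - 2 * t1^2 * cst b0 - 4 * t1^2 - 2
        * t1 * t2 * cst b0 - 4 * t1 * t2 + 8, 1, 1), (4 * t1 * t2 - 4 * t1^2, 1, 0)],
      [(4 * t1^2 * cst b1^2 - 4 * t1^2 * cst b1 * cst b3 - 4 * t1^2 * cst b2^2 + 4 * t1^2 * cst b2 * cst b3 - 8 * t1 *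
        t2 * cst b1^2 + 8 * t1 * t2 * cst b1 * cst b2 + 8 * t1 * t2 * cst b1 * cst b3 + 4 * cst b1^2 - 8 * cst b1 *
        cst b2 - 4 * cst b1 * cst b3 + 4 * cst b2^2 - 4 * cst b2 * cst b3, 1, 2), (2 * t1^4 * cst b0 * cst b3 - 2 *
        t1^4 * cst b0 * cst b1 - 2 * t1^4 * cst b0 * cst b2 - 4 * t1^4 * cst b1 - 4 * t1^4 * cst b2 + 4 * t1^4 * cst
        b3 + 12 * t1^3 * t2 * cst b0 * cst b1 + 4 * t1^3 * t2 * cst b0 * cst b2 - 4 * t1^3 * t2 * cst b0 * cst b3 + 8
        * t1^3 * t2 * cst b1 + 8 * t1^3 * t2 * cst b2 - 8 * t1^3 * t2 * cst b3 - 14 * t1^2 * t2^2 * cst b0 * cst b1 +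
        2 * t1^2 * t2^2 * cst b0 * cst b2 - 2 * t1^2 * t2^2 * cst b0 * cst b3 - 12 * t1^2 * t2^2 * cst b1 + 4 * t1^2 *
        t2^2 * cst b2 - 4 * t1^2 * t2^2 * cst b3 - 10 * t1^2 * cst b0 * cst b1 - 2 * t1^2 * cst b0 * cst b2 + 2 * t1^2
        * cst b0 * cst b3 + 12 * t1^2 * cst b1 - 4 * t1^2 * cst b2 + 4 * t1^2 * cst b3 + 20 * t1 * t2 * cst b0 * cst
        b1 - 4 * t1 * t2 * cst b0 * cst b2 + 4 * t1 * t2 * cst b0 * cst b3 - 8 * t1 * t2 * cst b1 - 8 * t1 * t2 * cst
        b2 + 8 * t1 * t2 * cst b3 - 2 * t2^2 * cst b0 * cst b1 - 2 * t2^2 * cst b0 * cst b2 + 2 * t2^2 * cst b0 * cst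
        b3 + 12 * t2^2 * cst b1 - 4 * t2^2 * cst b2 + 4 * t2^2 * cst b3 - 4 * cst b0 * cst b1 + 4 * cst b0 * cst b2 -
        4 * cst b0 * cst b3 - 8 * cst b1 + 8 * cst b2 - 8 * cst b3, 1, 3), (20 * t1^2 * t2^2 * cst b0 * cst b2 - 4 *
        t1^3 * t2 * cst b0 * cst b2 - 8 * t1^3 * t2 * cst b2 - 4 * t1^2 * t2^2 * cst b0 * cst b1 + 4 * t1^2 * t2^2 *
        cst b0 * cst b3 - 8 * t1^2 * t2^2 * cst b1 + 24 * t1^2 * t2^2 * cst b2 + 8 * t1^2 * t2^2 * cst b3 + 4 * t1^2 *
        cst b0 * cst b1 + 8 * t1^2 * cst b0 * cst b2 - 4 * t1^2 * cst b0 * cst b3 + 8 * t1^2 * cst b1 - 8 * t1^2 * cst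
        b3 - 12 * t1 * t2^3 * cst b0 * cst b2 - 8 * t1 * t2^3 * cst b2 - 32 * t1 * t2 * cst b0 * cst b2 - 16 * t1 * t2
        * cst b2 + 4 * t2^2 * cst b0 * cst b1 + 16 * t2^2 * cst b0 * cst b2 - 4 * t2^2 * cst b0 * cst b3 + 8 * t2^2 *
        cst b1 - 8 * t2^2 * cst b3 - 4 * cst b0 * cst b1 + 4 * cst b0 * cst b2 + 4 * cst b0 * cst b3 - 8 * cst b1 + 8
        * cst b2 + 8 * cst b3, 1, 3), (8 * t1^3 * t2 * cst b1 - 4 * t1^3 * t2 * cst b0^2 - 12 * t1^3 * t2 * cst b0 - 8
        * t1^3 * t2 * cst b2 - 8 * t1^3 * t2 + 12 * t1^2 * t2^2 * cst b0^2 + 20 * t1^2 * t2^2 * cst b0 - 8 * t1^2 *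
        t2^2 * cst b1 + 8 * t1^2 * t2^2 * cst b2 - 8 * t1^2 * t2^2 * cst b3 + 8 * t1^2 * t2^2 + 4 * t1^2 * cst b0^2 -
        16 * t1^2 * cst b1 + 8 * t1^2 * cst b3 - 20 * t1 * t2 * cst b0^2 - 4 * t1 * t2 * cst b0 + 24 * t1 * t2 * cst
        b1 + 8 * t1 * t2 * cst b2 + 8 * t1 * t2 - 12 * t2^2 * cst b0 - 8 * t2^2 * cst b1 - 8 * t2^2 * cst b2 + 8 *
        t2^2 * cst b3 - 8 * t2^2 + 8 * cst b0^2 + 8 * cst b0 - 8 * cst b3, 1, 2), (3 * t1 * t2 * cst b0^2 - t1^2 * cst
        b0^2 - 2 * t1^2 * cst b0 - 4 * t1^2 * cst b1 - 4 * t1^2 * cst b2 + 8 * t1 * t2 * cst b0 + 8 * t1 * t2 * cst b1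
        + 4 * t1 * t2 - 2 * cst b0^2 - 6 * cst b0 - 4 * cst b1 + 4 * cst b2 - 4, 1, 2), (4 * t1^2 - 2 * t1^2 * cst b0
        - 6 * t1 * t2 * cst b0 - 4 * t1 * t2 + 8 * cst b0, 1, 1)]]"

definition mat2 :: "complex \<Rightarrow> complex \<Rightarrow> complex \<Rightarrow> complex \<Rightarrow> (poly2 \<times> nat \<times> nat) list list" where
  "mat2 b0 b1 b2 b3 =
    [
      [(0, 0, 0), (0, 0, 0), (4, 0, 0), (0, 0, 0), (0, 0, 0), (0, 0, 0)],
      [(0, 0, 0), (0, 0, 0), (0, 0, 0), (4, 0, 0), (0, 0, 0), (0, 0, 0)],
      [(2 * cst b2 - 2 * cst b1 - 2 * cst b3, 1, 0), (0, 0, 0), (- (4 * t2 * cst b0), 1, 0), (4 * t1 * t2 - 4, 1, 0), (2, 1, 0), (0, 0, 0)],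
      [(0, 0, 0), (- (4 * cst b1), 1, 0), (0, 0, 0), (- (4 * t2 * cst b0), 1, 0), (cst b0 + 2, 1, 1), (2, 1, 0)],
      [(0, 0, 0), (8 * cst b1 - 8 * t1 * t2 * cst b1, 1, 0), (4 * cst b1 + 4 * cst b2 - 4 * cst b3, 0, 0), (8 * t1 - 8
        * t1 * t2^2 * cst b0 - 8 * t1 * t2^2 + 8 * t2 * cst b0, 1, 0), (2 * t1 * t2 * cst b0 + 4 * t1 * t2 + 2 * t2^2
        * cst b0 + 4 * t2^2 - 4 * cst b0 - 8, 1, 1), (4 * t1 * t2 - 4 * t2^2, 1, 0)],
      [(8 * t1 * t2 * cst b2^2 - 8 * t1 * t2 * cst b1 * cst b2 - 8 * t1 * t2 * cst b2 * cst b3 + 4 * t2^2 * cst b1^2 -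
        4 * t2^2 * cst b1 * cst b3 - 4 * t2^2 * cst b2^2 + 4 * t2^2 * cst b2 * cst b3 - 4 * cst b1^2 + 8 * cst b1 *
        cst b2 + 4 * cst b1 * cst b3 - 4 * cst b2^2 + 4 * cst b2 * cst b3, 1, 2), (20 * t1^2 * t2^2 * cst b0 * cst b1
        - 12 * t1^3 * t2 * cst b0 * cst b1 - 8 * t1^3 * t2 * cst b1 - 4 * t1^2 * t2^2 * cst b0 * cst b2 + 4 * t1^2 *
        t2^2 * cst b0 * cst b3 + 24 * t1^2 * t2^2 * cst b1 - 8 * t1^2 * t2^2 * cst b2 + 8 * t1^2 * t2^2 * cst b3 + 16
        * t1^2 * cst b0 * cst b1 + 4 * t1^2 * cst b0 * cst b2 - 4 * t1^2 * cst b0 * cst b3 + 8 * t1^2 * cst b2 - 8 *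
        t1^2 * cst b3 - 4 * t1 * t2^3 * cst b0 * cst b1 - 8 * t1 * t2^3 * cst b1 - 32 * t1 * t2 * cst b0 * cst b1 - 16
        * t1 * t2 * cst b1 + 8 * t2^2 * cst b0 * cst b1 + 4 * t2^2 * cst b0 * cst b2 - 4 * t2^2 * cst b0 * cst b3 + 8
        * t2^2 * cst b2 - 8 * t2^2 * cst b3 + 4 * cst b0 * cst b1 - 4 * cst b0 * cst b2 + 4 * cst b0 * cst b3 + 8 *
        cst b1 - 8 * cst b2 + 8 * cst b3, 1, 3), (2 * t1^2 * t2^2 * cst b0 * cst b1 - 14 * t1^2 * t2^2 * cst b0 * cst
        b2 - 2 * t1^2 * t2^2 * cst b0 * cst b3 + 4 * t1^2 * t2^2 * cst b1 - 12 * t1^2 * t2^2 * cst b2 - 4 * t1^2 *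
        t2^2 * cst b3 - 2 * t1^2 * cst b0 * cst b1 - 2 * t1^2 * cst b0 * cst b2 + 2 * t1^2 * cst b0 * cst b3 - 4 *
        t1^2 * cst b1 + 12 * t1^2 * cst b2 + 4 * t1^2 * cst b3 + 4 * t1 * t2^3 * cst b0 * cst b1 + 12 * t1 * t2^3 *
        cst b0 * cst b2 - 4 * t1 * t2^3 * cst b0 * cst b3 + 8 * t1 * t2^3 * cst b1 + 8 * t1 * t2^3 * cst b2 - 8 * t1 *
        t2^3 * cst b3 - 4 * t1 * t2 * cst b0 * cst b1 + 20 * t1 * t2 * cst b0 * cst b2 + 4 * t1 * t2 * cst b0 * cst b3
        - 8 * t1 * t2 * cst b1 - 8 * t1 * t2 * cst b2 + 8 * t1 * t2 * cst b3 - 2 * t2^4 * cst b0 * cst b1 - 2 * t2^4 *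
        cst b0 * cst b2 + 2 * t2^4 * cst b0 * cst b3 - 4 * t2^4 * cst b1 - 4 * t2^4 * cst b2 + 4 * t2^4 * cst b3 - 2 *
        t2^2 * cst b0 * cst b1 - 10 * t2^2 * cst b0 * cst b2 + 2 * t2^2 * cst b0 * cst b3 - 4 * t2^2 * cst b1 + 12 *
        t2^2 * cst b2 + 4 * t2^2 * cst b3 + 4 * cst b0 * cst b1 - 4 * cst b0 * cst b2 - 4 * cst b0 * cst b3 + 8 * cst
        b1 - 8 * cst b2 - 8 * cst b3, 1, 3), (8 * t1^2 * t2^2 * cst b2 - 12 * t1^2 * t2^2 * cst b0^2 - 20 * t1^2 *
        t2^2 * cst b0 - 8 * t1^2 * t2^2 * cst b1 + 8 * t1^2 * t2^2 * cst b3 - 8 * t1^2 * t2^2 + 12 * t1^2 * cst b0 + 8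
        * t1^2 * cst b1 + 8 * t1^2 * cst b2 - 8 * t1^2 * cst b3 + 8 * t1^2 + 4 * t1 * t2^3 * cst b0^2 + 12 * t1 * t2^3
        * cst b0 + 8 * t1 * t2^3 * cst b1 - 8 * t1 * t2^3 * cst b2 + 8 * t1 * t2^3 + 20 * t1 * t2 * cst b0^2 + 4 * t1
        * t2 * cst b0 - 8 * t1 * t2 * cst b1 - 24 * t1 * t2 * cst b2 - 8 * t1 * t2 - 4 * t2^2 * cst b0^2 + 16 * t2^2 *
        cst b2 - 8 * t2^2 * cst b3 - 8 * cst b0^2 - 8 * cst b0 + 8 * cst b3, 1, 2), (3 * t1 * t2 * cst b0^2 + 8 * t1 *
        t2 * cst b0 + 8 * t1 * t2 * cst b2 + 4 * t1 * t2 - t2^2 * cst b0^2 - 2 * t2^2 * cst b0 - 4 * t2^2 * cst b1 - 4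
        * t2^2 * cst b2 - 2 * cst b0^2 - 6 * cst b0 + 4 * cst b1 - 4 * cst b2 - 4, 1, 2), (6 * t1 * t2 * cst b0 + 4 *
        t1 * t2 + 2 * t2^2 * cst b0 - 4 * t2^2 - 8 * cst b0, 1, 1)]]"


section \<open>Flatness of the system off its poles\<close>

definition regular :: "(complex \<times> complex) set" where
  "regular = {q. fst q ^ 2 \<noteq> 1 \<and> snd q ^ 2 \<noteq> 1 \<and> fst q \<noteq> snd q}"

lemma open_regular: "open regular"
proof -
  have "regular = {q. fst q ^ 2 \<noteq> 1} \<inter> {q. snd q ^ 2 \<noteq> 1} \<inter> {q. fst q \<noteq> snd q}"
    by (auto simp: regular_def)
  also have "open \<dots>"
    by (intro open_Int open_Collect_neq continuous_intros)
  finally show ?thesis .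
qed

lemma holo2_ent: "holomorphic2_on (ent1 e) regular" "holomorphic2_on (ent2 e) regular"
  unfolding ent1_def ent2_def split_def
  by (rule holo2_arith(4); use open_regular in \<open>auto intro!: holo2_arith(2,3) holo2_power holo2_eval2 holo2_basic\<close>;
    auto simp: regular_def)+

text \<open>The quotient rule with the common power cancelled: the denominator grows by one factor
  only, so a derivative of an entry with third power stays within the fourth.\<close>

lemma DERIV_quotient_power:
  fixes f :: "complex \<Rightarrow> complex"
  assumes f: "(f has_field_derivative f') (at y)" and h: "(h has_field_derivative e) (at y)"
    and nz: "c \<noteq> 0" "h y \<noteq> 0"
  shows "((\<lambda>z. f z / (c * h z ^ k)) has_field_derivative (f' * h y - e * of_nat k * f y) / (c * h y ^ Suc k)) (at y)"
proof -
  have *: "(f' * (c * D ^ k) - F * (c * (of_nat k * e * D ^ (k - 1)))) / ((c * D ^ k) * (c * D ^ k))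
      = (f' * D - e * of_nat k * F) / (c * D ^ Suc k)" if "D \<noteq> 0" for F D
    using nz that by (cases k) (simp_all add: frac_eq_eq algebra_simps)
  have "((\<lambda>z. h z ^ k) has_field_derivative of_nat k * e * h y ^ (k - 1)) (at y)"
    using h by (auto intro!: derivative_eq_intros)
  from DERIV_divide[OF f DERIV_cmult[OF this, of c]] nz show ?thesis
    unfolding *[OF nz(2)] by simp
qed

lemma D2_ent1:
  assumes "(x, y) \<in> regular"
  shows "D2 (ent1 (N, i, k)) (x, y) =
    (eval2 (pd2 N) (x, y) * (x - y) + of_nat k * eval2 N (x, y)) / (4 * (1 - x\<^sup>2) ^ i * (x - y) ^ Suc k)"
proof -
  have "((\<lambda>z. x - z) has_field_derivative - 1) (at y)" by (auto intro!: derivative_eq_intros)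
  from DERIV_quotient_power[OF eval2_derivs(2) this, of "4 * (1 - x\<^sup>2) ^ i"] assms show ?thesis
    by (intro D_eqI) (simp add: ent1_def regular_def)
qed

lemma D1_ent2:
  assumes "(x, y) \<in> regular"
  shows "D1 (ent2 (N, i, k)) (x, y) =
    (eval2 (pd1 N) (x, y) * (x - y) - of_nat k * eval2 N (x, y)) / (4 * (1 - y\<^sup>2) ^ i * (x - y) ^ Suc k)"
proof -
  have "((\<lambda>z. z - y) has_field_derivative 1) (at x)" by (auto intro!: derivative_eq_intros)
  from DERIV_quotient_power[OF eval2_derivs(1) this, of "4 * (1 - y\<^sup>2) ^ i"] assms show ?thesis
    by (intro D_eqI) (simp add: ent2_def regular_def)
qed

text \<open>All terms of the curvature are brought to the denominator \<open>16 (1 - x\<^sup>2) (1 - y\<^sup>2) (x - y)\<^sup>4\<close>.\<close>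

lemma clear_denominators:
  fixes A B D :: complex
  assumes nz: "A \<noteq> 0" "B \<noteq> 0" "D \<noteq> 0"
  shows "i \<le> 1 \<Longrightarrow> k \<le> 3 \<Longrightarrow> N / (4 * A ^ i * D ^ Suc k) * (16 * A * B * D ^ 4) = 4 * N * A ^ (1 - i) * B * D ^ (3 - k)"
    and "i \<le> 1 \<Longrightarrow> k \<le> 3 \<Longrightarrow> N / (4 * B ^ i * D ^ Suc k) * (16 * A * B * D ^ 4) = 4 * N * A * B ^ (1 - i) * D ^ (3 - k)"
    and "i \<le> 1 \<Longrightarrow> j \<le> 1 \<Longrightarrow> k + l \<le> 4 \<Longrightarrow>
      (N / (4 * A ^ i * D ^ k) * (N' / (4 * B ^ j * D ^ l))) * (16 * A * B * D ^ 4) = N * N' * A ^ (1 - i) * B ^ (1 - j) * D ^ (4 - k - l)"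
    and "i \<le> 1 \<Longrightarrow> j \<le> 1 \<Longrightarrow> k + l \<le> 4 \<Longrightarrow>
      (N' / (4 * B ^ j * D ^ l) * (N / (4 * A ^ i * D ^ k))) * (16 * A * B * D ^ 4) = N * N' * A ^ (1 - i) * B ^ (1 - j) * D ^ (4 - k - l)"
proof -
  have 1: "N / (4 * p * r) * (16 * A * B * D ^ 4) = 4 * N * p' * B * r'"
    if "A = p' * p" "D ^ 4 = r' * r" "p \<noteq> 0" "r \<noteq> 0" for p r p' r'
    unfolding that(1,2) using that(3,4) by simp
  show "N / (4 * A ^ i * D ^ Suc k) * (16 * A * B * D ^ 4) = 4 * N * A ^ (1 - i) * B * D ^ (3 - k)" if "i \<le> 1" "k \<le> 3"
    by (rule 1) (use nz that in \<open>simp_all flip: power_add power_Suc\<close>)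
  have 2: "N / (4 * p * r) * (16 * A * B * D ^ 4) = 4 * N * A * p' * r'"
    if "B = p' * p" "D ^ 4 = r' * r" "p \<noteq> 0" "r \<noteq> 0" for p r p' r'
    unfolding that(1,2) using that(3,4) by simp
  show "N / (4 * B ^ i * D ^ Suc k) * (16 * A * B * D ^ 4) = 4 * N * A * B ^ (1 - i) * D ^ (3 - k)" if "i \<le> 1" "k \<le> 3"
    by (rule 2) (use nz that in \<open>simp_all flip: power_add power_Suc\<close>)
  have 3: "(N / (4 * p * r) * (N' / (4 * p1 * r1))) * (16 * A * B * D ^ 4) = N * N' * p' * p1' * r'"
    if "A = p' * p" "B = p1' * p1" "D ^ 4 = r' * (r * r1)" "p \<noteq> 0" "p1 \<noteq> 0" "r \<noteq> 0" "r1 \<noteq> 0" for p r p' r' p1 p1' r1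
    unfolding that(1-3) using that(4-) by simp
  show 4: "(N / (4 * A ^ i * D ^ k) * (N' / (4 * B ^ j * D ^ l))) * (16 * A * B * D ^ 4) = N * N' * A ^ (1 - i) * B ^ (1 - j) * D ^ (4 - k - l)"
    if "i \<le> 1" "j \<le> 1" "k + l \<le> 4"
    by (rule 3) (use nz that in \<open>simp_all flip: power_add power_Suc\<close>)
  show "(N' / (4 * B ^ j * D ^ l) * (N / (4 * A ^ i * D ^ k))) * (16 * A * B * D ^ 4) = N * N' * A ^ (1 - i) * B ^ (1 - j) * D ^ (4 - k - l)"
    if "i \<le> 1" "j \<le> 1" "k + l \<le> 4"
    using 4[OF that] by (simp only: mult.commute)
qed

lemma pd_cst_power: "pd1 (cst c ^ n) = 0" "pd2 (cst c ^ n) = 0"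
  by (induction n) (simp_all add: pd_simps)

text \<open>Equality of \<open>D2 (D1 W)\<close> and \<open>D1 (D2 W)\<close> for the system: 36
  polynomial identities after clearing denominators. Elimination alone bounds the rank by six;
  flatness provides six independent solutions.\<close>

lemma flat:
  assumes q: "q \<in> regular" and ij: "i < 6" "j < 6"
  shows "D2 (ent1 (mat1 b0 b1 b2 b3 ! i ! j)) q + (\<Sum>k<6. ent1 (mat1 b0 b1 b2 b3 ! i ! k) q * ent2 (mat2 b0 b1 b2 b3 ! k ! j) q) =
    D1 (ent2 (mat2 b0 b1 b2 b3 ! i ! j)) q + (\<Sum>k<6. ent2 (mat2 b0 b1 b2 b3 ! i ! k) q * ent1 (mat1 b0 b1 b2 b3 ! k ! j) q)"
    (is "?R i j")
proof -
  obtain x y where xy: "q = (x, y)" by force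
  have nz: "1 - x\<^sup>2 \<noteq> 0" "1 - y\<^sup>2 \<noteq> 0" "x - y \<noteq> 0" using q by (auto simp: xy regular_def)
  have six: "{..<6} = {0, 1, 2, 3, 4, 5 :: nat}" by auto
  note clear = clear_denominators[OF nz]
  have e1: "ent1 (N, i, k) q = eval2 N q / (4 * (1 - x\<^sup>2) ^ i * (x - y) ^ k)"
    "ent2 (N, i, k) q = eval2 N q / (4 * (1 - y\<^sup>2) ^ i * (x - y) ^ k)" for N i k
    by (simp_all add: ent1_def ent2_def xy)
  have d: "D2 (ent1 (N, i, k)) q = (eval2 (pd2 N) q * (x - y) + of_nat k * eval2 N q) / (4 * (1 - x\<^sup>2) ^ i * (x - y) ^ Suc k)"
    "D1 (ent2 (N, i, k)) q = (eval2 (pd1 N) q * (x - y) - of_nat k * eval2 N q) / (4 * (1 - y\<^sup>2) ^ i * (x - y) ^ Suc k)" for N i k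
    using D2_ent1 D1_ent2 q by (simp_all add: xy)
  have z: "eval2 0 q = 0" "eval2 (pd1 0) q = 0" "eval2 (pd2 0) q = 0" by simp_all
  have cancel: "X = Y" if "X * (16 * (1 - x\<^sup>2) * (1 - y\<^sup>2) * (x - y) ^ 4) = Y * (16 * (1 - x\<^sup>2) * (1 - y\<^sup>2) * (x - y) ^ 4)" for X Y
    using that nz by simp
  have nths: "(as # l) ! 0 = as" "(as # l) ! 1 = l ! 0" "(as # l) ! 2 = l ! 1" "(as # l) ! 3 = l ! 2" "(as # l) ! 4 = l ! 3" "(as # l) ! 5 = l ! 4" for as :: 'z and l
    by (simp_all add: numeral_eq_Suc)
  have sum6: "(\<Sum>k<6. f k) = f 0 + f 1 + f 2 + f 3 + f 4 + f (5 :: nat)" for f :: "nat \<Rightarrow> complex"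
    by (simp add: eval_nat_numeral)
  \<comment> \<open>Exponents of \<open>x - y\<close> meeting in a product of the two matrices add
    up to at most 4, since the entries with high powers lie in the last row. This is why the fourth
    power suffices as common denominator.\<close>
  have nat: "0 + 0 \<le> (4 :: nat)" "0 + 1 \<le> (4 :: nat)" "0 + 2 \<le> (4 :: nat)" "0 + 3 \<le> (4 :: nat)" "1 + 0 \<le> (4 :: nat)" "1 + 1 \<le> (4 :: nat)" "1 + 2 \<le> (4 :: nat)" "1 + 3 \<le> (4 :: nat)" "2 + 0 \<le> (4 :: nat)" "2 + 1 \<le> (4 :: nat)" "2 + 2 \<le> (4 :: nat)" "3 + 0 \<le> (4 :: nat)" "3 + 1 \<le> (4 :: nat)"
    "4 - 0 - 0 = (4 :: nat)" "4 - 0 - 1 = (3 :: nat)" "4 - 0 - 2 = (2 :: nat)" "4 - 0 - 3 = (1 :: nat)" "4 - 1 - 0 = (3 :: nat)" "4 - 1 - 1 = (2 :: nat)" "4 - 1 - 2 = (1 :: nat)" "4 - 1 - 3 = (0 :: nat)" "4 - 2 - 0 = (2 :: nat)" "4 - 2 - 1 = (1 :: nat)" "4 - 2 - 2 = (0 :: nat)" "4 - 3 - 0 = (1 :: nat)" "4 - 3 - 1 = (0 :: nat)"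
    "3 - 0 = (3 :: nat)" "0 \<le> (3 :: nat)" "3 - 1 = (2 :: nat)" "1 \<le> (3 :: nat)" "3 - 2 = (1 :: nat)" "2 \<le> (3 :: nat)" "3 - 3 = (0 :: nat)" "3 \<le> (3 :: nat)"
    "1 - 0 = (1 :: nat)" "1 - 1 = (0 :: nat)" "0 \<le> (1 :: nat)" "1 \<le> (1 :: nat)"
    by simp_all
  have R0: "?R 0 0" "?R 0 1" "?R 0 2" "?R 0 3" "?R 0 4" "?R 0 5"
    by ((simp only: mat1_def mat2_def nths sum6 e1 d z pd1_0 pd2_0)?;
      (simp only: mult_zero_left mult_zero_right div_0 add_0_left add_0_right diff_0_right)?;
      (rule cancel)?; (simp only: distrib_right clear nat)?;
      (simp only: pd_simps pd_t_powers pd_t_power pd_cst_power pd_t pd_numeral pd_1 pd1_0 pd2_0 eval2_simps xy fst_conv snd_conv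
        power_0 power_one_right one_clean of_nat_0 of_nat_1 of_nat_numeral)?; algebra?)+
  have R1: "?R 1 0" "?R 1 1" "?R 1 2" "?R 1 3" "?R 1 4" "?R 1 5"
    by ((simp only: mat1_def mat2_def nths sum6 e1 d z pd1_0 pd2_0)?;
      (simp only: mult_zero_left mult_zero_right div_0 add_0_left add_0_right diff_0_right)?;
      (rule cancel)?; (simp only: distrib_right clear nat)?;
      (simp only: pd_simps pd_t_powers pd_t_power pd_cst_power pd_t pd_numeral pd_1 pd1_0 pd2_0 eval2_simps xy fst_conv snd_conv
        power_0 power_one_right one_clean of_nat_0 of_nat_1 of_nat_numeral)?; algebra?)+
  have R2: "?R 2 0" "?R 2 1" "?R 2 2" "?R 2 3" "?R 2 4" "?R 2 5"
    by ((simp only: mat1_def mat2_def nths sum6 e1 d z pd1_0 pd2_0)?;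
      (simp only: mult_zero_left mult_zero_right div_0 add_0_left add_0_right diff_0_right)?;
      (rule cancel)?; (simp only: distrib_right clear nat)?;
      (simp only: pd_simps pd_t_powers pd_t_power pd_cst_power pd_t pd_numeral pd_1 pd1_0 pd2_0 eval2_simps xy fst_conv snd_conv
        power_0 power_one_right one_clean of_nat_0 of_nat_1 of_nat_numeral)?; algebra?)+
  have R3: "?R 3 0" "?R 3 1" "?R 3 2" "?R 3 3" "?R 3 4" "?R 3 5"
    by ((simp only: mat1_def mat2_def nths sum6 e1 d z pd1_0 pd2_0)?;
      (simp only: mult_zero_left mult_zero_right div_0 add_0_left add_0_right diff_0_right)?;
      (rule cancel)?; (simp only: distrib_right clear nat)?;
      (simp only: pd_simps pd_t_powers pd_t_power pd_cst_power pd_t pd_numeral pd_1 pd1_0 pd2_0 eval2_simps xy fst_conv snd_conv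
        power_0 power_one_right one_clean of_nat_0 of_nat_1 of_nat_numeral)?; algebra?)+
  have R4: "?R 4 0" "?R 4 1" "?R 4 2" "?R 4 3" "?R 4 4" "?R 4 5"
    by ((simp only: mat1_def mat2_def nths sum6 e1 d z pd1_0 pd2_0)?;
      (simp only: mult_zero_left mult_zero_right div_0 add_0_left add_0_right diff_0_right)?;
      (rule cancel)?; (simp only: distrib_right clear nat)?;
      (simp only: pd_simps pd_t_powers pd_t_power pd_cst_power pd_t pd_numeral pd_1 pd1_0 pd2_0 eval2_simps xy fst_conv snd_conv
        power_0 power_one_right one_clean of_nat_0 of_nat_1 of_nat_numeral)?; algebra?)+
  have R5: "?R 5 0" "?R 5 1" "?R 5 2" "?R 5 3" "?R 5 4" "?R 5 5"
    by ((simp only: mat1_def mat2_def nths sum6 e1 d z pd1_0 pd2_0)?;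
      (simp only: mult_zero_left mult_zero_right div_0 add_0_left add_0_right diff_0_right)?;
      (rule cancel)?; (simp only: distrib_right clear nat)?;
      (simp only: pd_simps pd_t_powers pd_t_power pd_cst_power pd_t pd_numeral pd_1 pd1_0 pd2_0 eval2_simps xy fst_conv snd_conv
        power_0 power_one_right one_clean of_nat_0 of_nat_1 of_nat_numeral)?; algebra?)+
  have "i = 0 \<or> i = 1 \<or> i = 2 \<or> i = 3 \<or> i = 4 \<or> i = 5" "j = 0 \<or> j = 1 \<or> j = 2 \<or> j = 3 \<or> j = 4 \<or> j = 5"
    using ij by linarith+
  then show ?thesis by (elim disjE) (simp_all only: R0 R1 R2 R3 R4 R5)
qed

text \<open>Rows 0 to 4 in the form in which the elimination produces them, row 4 being expressed by
  means of row 3. This form serves both directions: from solutions to the Pfaffian system and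
  back.\<close>

lemma mat_rows:
  fixes x y b0 b1 b2 b3 :: complex and W :: "nat \<Rightarrow> complex"
  defines "h \<equiv> 1 - x * y" and "c \<equiv> b3 - b1 - b2"
  assumes q: "(x, y) \<in> regular"
  shows "(\<Sum>j<6. ent1 (mat1 b0 b1 b2 b3 ! 0 ! j) (x, y) * W j) = W 1"
    and "(\<Sum>j<6. ent1 (mat1 b0 b1 b2 b3 ! 1 ! j) (x, y) * W j) =
      (- h * W 3 - c * W 0 / 2 - W 4 / 2 - b0 * x * W 1 - b2 * W 0) / (1 - x\<^sup>2)"
    and "(\<Sum>j<6. ent1 (mat1 b0 b1 b2 b3 ! 2 ! j) (x, y) * W j) = W 3"
    and "(\<Sum>j<6. ent1 (mat1 b0 b1 b2 b3 ! 3 ! j) (x, y) * W j) =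
      ((2 + b0) * W 4 / (4 * (x - y)) - W 5 / 2 - b0 * x * W 3 - b2 * W 2) / (1 - x\<^sup>2)"
    and "(\<Sum>j<6. ent1 (mat1 b0 b1 b2 b3 ! 4 ! j) (x, y) * W j) =
      2 * ((2 + b0) * W 4 / (4 * (x - y)) + W 5 / 2)
      + 2 * (h * (\<Sum>j<6. ent1 (mat1 b0 b1 b2 b3 ! 3 ! j) (x, y) * W j) - y * W 3) + c * W 1"
    and "(\<Sum>j<6. ent2 (mat2 b0 b1 b2 b3 ! 0 ! j) (x, y) * W j) = W 2"
    and "(\<Sum>j<6. ent2 (mat2 b0 b1 b2 b3 ! 1 ! j) (x, y) * W j) = W 3"
    and "(\<Sum>j<6. ent2 (mat2 b0 b1 b2 b3 ! 2 ! j) (x, y) * W j) =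
      (- h * W 3 - c * W 0 / 2 + W 4 / 2 - b0 * y * W 2 - b1 * W 0) / (1 - y\<^sup>2)"
    and "(\<Sum>j<6. ent2 (mat2 b0 b1 b2 b3 ! 3 ! j) (x, y) * W j) =
      ((2 + b0) * W 4 / (4 * (x - y)) + W 5 / 2 - b0 * y * W 3 - b1 * W 1) / (1 - y\<^sup>2)"
    and "(\<Sum>j<6. ent2 (mat2 b0 b1 b2 b3 ! 4 ! j) (x, y) * W j) =
      - 2 * ((2 + b0) * W 4 / (4 * (x - y)) - W 5 / 2)
      - 2 * (h * (\<Sum>j<6. ent2 (mat2 b0 b1 b2 b3 ! 3 ! j) (x, y) * W j) - x * W 3) - c * W 2"
proof -
  define A B D where ABD: "A = 1 - x\<^sup>2" "B = 1 - y\<^sup>2" "D = x - y"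
  have nz: "A \<noteq> 0" "B \<noteq> 0" "D \<noteq> 0" using q by (auto simp: regular_def ABD)
  have sum6: "(\<Sum>k<6. f k) = f 0 + f 1 + f 2 + f 3 + f 4 + f (5 :: nat)" for f :: "nat \<Rightarrow> complex"
    by (simp add: eval_nat_numeral)
  have nths: "(as # l) ! 0 = as" "(as # l) ! 1 = l ! 0" "(as # l) ! 2 = l ! 1" "(as # l) ! 3 = l ! 2"
    "(as # l) ! 4 = l ! 3" "(as # l) ! 5 = l ! 4" for as :: 'z and l
    by (simp_all add: numeral_eq_Suc)
  have ent: "ent1 (N, i, k) (x, y) = eval2 N (x, y) / (4 * A ^ i * D ^ k)"
    "ent2 (N, i, k) (x, y) = eval2 N (x, y) / (4 * B ^ i * D ^ k)" for N i k
    by (simp_all add: ent1_def ent2_def ABD)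
  note expand = mat1_def mat2_def nths sum6 ent eval2_simps fst_conv snd_conv power_0 power_one_right
    mult_zero_left mult_zero_right div_0 add_0_left add_0_right diff_0_right mult_1_left mult_1_right
  show "(\<Sum>j<6. ent1 (mat1 b0 b1 b2 b3 ! 0 ! j) (x, y) * W j) = W 1"
    "(\<Sum>j<6. ent1 (mat1 b0 b1 b2 b3 ! 2 ! j) (x, y) * W j) = W 3"
    "(\<Sum>j<6. ent2 (mat2 b0 b1 b2 b3 ! 0 ! j) (x, y) * W j) = W 2"
    "(\<Sum>j<6. ent2 (mat2 b0 b1 b2 b3 ! 1 ! j) (x, y) * W j) = W 3"
    unfolding expand by simp_all
  show "(\<Sum>j<6. ent1 (mat1 b0 b1 b2 b3 ! 1 ! j) (x, y) * W j) =
      (- h * W 3 - c * W 0 / 2 - W 4 / 2 - b0 * x * W 1 - b2 * W 0) / (1 - x\<^sup>2)"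
    unfolding expand ABD(1)[symmetric] using nz(1) by (simp add: field_simps) (simp add: h_def c_def algebra_simps)
  show "(\<Sum>j<6. ent2 (mat2 b0 b1 b2 b3 ! 2 ! j) (x, y) * W j) =
      (- h * W 3 - c * W 0 / 2 + W 4 / 2 - b0 * y * W 2 - b1 * W 0) / (1 - y\<^sup>2)"
    unfolding expand ABD(2)[symmetric] using nz(2) by (simp add: field_simps) (simp add: h_def c_def algebra_simps)
  show wx: "(\<Sum>j<6. ent1 (mat1 b0 b1 b2 b3 ! 3 ! j) (x, y) * W j) =
      ((2 + b0) * W 4 / (4 * (x - y)) - W 5 / 2 - b0 * x * W 3 - b2 * W 2) / (1 - x\<^sup>2)"
    unfolding expand ABD[symmetric] using nz by (simp add: field_simps)
  show wy: "(\<Sum>j<6. ent2 (mat2 b0 b1 b2 b3 ! 3 ! j) (x, y) * W j) =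
      ((2 + b0) * W 4 / (4 * (x - y)) + W 5 / 2 - b0 * y * W 3 - b1 * W 1) / (1 - y\<^sup>2)"
    unfolding expand ABD[symmetric] using nz by (simp add: field_simps)
  show "(\<Sum>j<6. ent1 (mat1 b0 b1 b2 b3 ! 4 ! j) (x, y) * W j) =
      2 * ((2 + b0) * W 4 / (4 * (x - y)) + W 5 / 2)
      + 2 * (h * (\<Sum>j<6. ent1 (mat1 b0 b1 b2 b3 ! 3 ! j) (x, y) * W j) - y * W 3) + c * W 1"
    unfolding wx unfolding expand ABD[symmetric] using nz(1,3)
    by (simp add: divide_simps) (simp only: ABD h_def c_def; algebra)
  show "(\<Sum>j<6. ent2 (mat2 b0 b1 b2 b3 ! 4 ! j) (x, y) * W j) =
      - 2 * ((2 + b0) * W 4 / (4 * (x - y)) - W 5 / 2)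
      - 2 * (h * (\<Sum>j<6. ent2 (mat2 b0 b1 b2 b3 ! 3 ! j) (x, y) * W j) - x * W 3) - c * W 2"
    unfolding wy unfolding expand ABD[symmetric] using nz(2,3)
    by (simp add: divide_simps) (simp only: ABD h_def c_def; algebra)
qed

text \<open>
  Pointwise elimination: \<open>P, Q\<close> stand for \<open>L\<^sub>1 u, L\<^sub>2 u\<close>, and \<open>z\<close> for \<open>\<partial>\<^sub>1\<^sub>1\<^sub>2\<^sub>2 u\<close>; the coefficient of \<open>z\<close>
  comes out as \<open>(1 - x\<^sup>2) + (1 - y\<^sup>2) - 2 (1 - x y) = - (x - y)\<^sup>2\<close>.
\<close>

lemma pfaffian_elimination:
  fixes x y b0 b1 b2 b3 :: complex
  defines "A \<equiv> 1 - x\<^sup>2" and "B \<equiv> 1 - y\<^sup>2" and "D \<equiv> x - y" and "h \<equiv> 1 - x * y" and "c \<equiv> b3 - b1 - b2"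
  assumes nz: "A \<noteq> 0" "B \<noteq> 0" "D \<noteq> 0"
    and PQ: "P + Q + 2 * h * w + c * u = 0" "s = Q - P"
    and P: "P = A * u11 + b0 * x * u1 + b2 * u" and Q: "Q = B * u22 + b0 * y * u2 + b1 * u"
    and QP: "2 * D * (Qx + Py) = (2 + b0) * s" "r = Qx - Py"
    and Py: "Py = A * wx + b0 * x * w + b2 * u2" and Qx: "Qx = B * wy + b0 * y * w + b1 * u1"
    and s: "sx = Qx - Px" "sy = Qy - Py"
    and PQx: "Px + Qx + 2 * (h * wx - y * w) + c * u1 = 0" and PQy: "Py + Qy + 2 * (h * wy - x * w) + c * u2 = 0"
    and QPx: "2 * D * (Qxx + Pxy) + 2 * (Qx + Py) = (2 + b0) * sx"
    and QPy: "2 * D * (Qxy + Pyy) - 2 * (Qx + Py) = (2 + b0) * sy"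
    and PQxy: "Pxy + Qxy + 2 * (h * z - x * wx - y * wy - w) + c * w = 0"
    and Pyy: "Pyy = A * z + b0 * x * wy + b2 * u22" and Qxx: "Qxx = B * z + b0 * y * wx + b1 * u11"
    and r: "rx = Qxx - Pxy" "ry = Qxy - Pyy"
    and W: "\<And>i. W i = [u, u1, u2, w, s, r] ! i"
  shows "i < 6 \<Longrightarrow> [u1, u11, w, wx, sx, rx] ! i = (\<Sum>j<6. ent1 (mat1 b0 b1 b2 b3 ! i ! j) (x, y) * W j)"
    and "i < 6 \<Longrightarrow> [u2, w, u22, wy, sy, ry] ! i = (\<Sum>j<6. ent2 (mat2 b0 b1 b2 b3 ! i ! j) (x, y) * W j)"
proof -
  have sum6: "(\<Sum>k<6. f k) = f 0 + f 1 + f 2 + f 3 + f 4 + f (5 :: nat)" for f :: "nat \<Rightarrow> complex"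
    by (simp add: eval_nat_numeral)
  have six: "i = 0 \<or> i = 1 \<or> i = 2 \<or> i = 3 \<or> i = 4 \<or> i = 5" if "i < 6" for i :: nat
    using that by linarith
  have nths: "(as # l) ! 0 = as" "(as # l) ! 1 = l ! 0" "(as # l) ! 2 = l ! 1" "(as # l) ! 3 = l ! 2"
    "(as # l) ! 4 = l ! 3" "(as # l) ! 5 = l ! 4" for as :: 'z and l
    by (simp_all add: numeral_eq_Suc)
  have ent: "ent1 (N, i, k) (x, y) = eval2 N (x, y) / (4 * A ^ i * D ^ k)"
    "ent2 (N, i, k) (x, y) = eval2 N (x, y) / (4 * B ^ i * D ^ k)" for N i k
    by (simp_all add: ent1_def ent2_def A_def B_def D_def)
  note expand = mat1_def mat2_def nths sum6 ent eval2_simps fst_conv snd_conv W power_0 power_one_right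
    mult_zero_left mult_zero_right div_0 add_0_left add_0_right diff_0_right mult_1_left mult_1_right
  \<comment> \<open>The second equation gives the sum of \<open>Qx\<close> and \<open>Py\<close>,
    and \<open>r\<close> is their difference, so both become known; in the same way
    \<open>P1\<close> and \<open>s\<close> give \<open>P\<close> and \<open>Q\<close>.\<close>
  have T: "Qx + Py = (2 + b0) * s / (2 * D)" using QP(1) nz(3) by (simp add: field_simps)
  have Qx': "Qx = (2 + b0) * s / (4 * D) + r / 2" and Py': "Py = (2 + b0) * s / (4 * D) - r / 2"
  proof -
    define t where "t = (2 + b0) * s / (2 * D)"
    have t: "(2 + b0) * s / (4 * D) = t / 2" and tt: "t = Qx + Py" by (simp_all add: t_def T)
    show "Qx = (2 + b0) * s / (4 * D) + r / 2" "Py = (2 + b0) * s / (4 * D) - r / 2"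
      unfolding t tt QP(2) by (simp_all add: field_simps)
  qed
  have u11: "u11 = (- h * w - c * u / 2 - s / 2 - b0 * x * u1 - b2 * u) / A"
  proof -
    have "A * u11 = - h * w - c * u / 2 - s / 2 - b0 * x * u1 - b2 * u"
      using P PQ by (simp add: field_simps) algebra
    then show ?thesis using nz(1) by (simp add: field_simps)
  qed
  have u22: "u22 = (- h * w - c * u / 2 + s / 2 - b0 * y * u2 - b1 * u) / B"
  proof -
    have "B * u22 = - h * w - c * u / 2 + s / 2 - b0 * y * u2 - b1 * u"
      using Q PQ by (simp add: field_simps) algebra
    then show ?thesis using nz(2) by (simp add: field_simps)
  qed
  have wx: "wx = ((2 + b0) * s / (4 * D) - r / 2 - b0 * x * w - b2 * u2) / A"
    using Py nz(1) unfolding Py' by (simp add: field_simps)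
  have wy: "wy = ((2 + b0) * s / (4 * D) + r / 2 - b0 * y * w - b1 * u1) / B"
    using Qx nz(2) unfolding Qx' by (simp add: field_simps)
  have sx: "sx = 2 * Qx + 2 * (h * wx - y * w) + c * u1"
    using s(1) PQx by algebra
  have sy: "sy = - 2 * Py - 2 * (h * wy - x * w) - c * u2"
    using s(2) PQy by algebra
  \<comment> \<open>The part free of \<open>z\<close> in
    \<open>Qxx + Pxy + Qxy + Pyy\<close>.\<close>
  define g where "g = b0 * y * wx + b1 * u11 + b0 * x * wy + b2 * u22 + 2 * (x * wx + y * wy + w) - c * w"
  have AB: "A + B - 2 * h = - D\<^sup>2" by (simp add: A_def B_def D_def h_def power2_eq_square algebra_simps)
  have z: "2 * D ^ 3 * z = 2 * D * g - (2 + b0) * (sx + sy)"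
  proof -
    \<comment> \<open>In the sum of the two derivatives of the second equation the terms
      \<open>2 (Qx + Py)\<close> cancel, and \<open>Pxy + Qxy\<close> is supplied by the mixed
      derivative of the first equation. This leaves a linear equation for \<open>z\<close>.\<close>
    have "2 * D * (Qxx + Pxy + Qxy + Pyy) = (2 + b0) * (sx + sy)" using QPx QPy by algebra
    moreover have "Qxx + Pxy + Qxy + Pyy = (A + B - 2 * h) * z + g"
      using PQxy unfolding Pyy Qxx g_def by algebra
    ultimately have "2 * D * (- D\<^sup>2 * z + g) = (2 + b0) * (sx + sy)" by (simp only: AB)
    then show ?thesis by algebra
  qed
  have rx: "2 * D ^ 3 * rx = 2 * B * (2 * D * g - (2 + b0) * (sx + sy)) + 4 * D ^ 3 * (b0 * y * wx + b1 * u11)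
      - D\<^sup>2 * ((2 + b0) * sx) + D * ((2 + b0) * s)"
  proof -
    \<comment> \<open>Here \<open>rx = 2 Qxx - (Qxx + Pxy)\<close>: the bracket is known from
      \<open>QPx\<close>, and \<open>Qxx\<close> involves \<open>z\<close> with coefficient
      \<open>B\<close>. For \<open>ry\<close> the roles of \<open>Qxx\<close> and \<open>Pyy\<close>
      are exchanged, with the opposite sign.\<close>
    have "2 * D ^ 3 * rx = 4 * D ^ 3 * Qxx - D\<^sup>2 * (2 * D * (Qxx + Pxy) + 2 * (Qx + Py)) + D * (2 * D * (Qx + Py))"
      unfolding r by algebra
    also have "4 * D ^ 3 * Qxx = 2 * B * (2 * D ^ 3 * z) + 4 * D ^ 3 * (b0 * y * wx + b1 * u11)"
      unfolding Qxx by algebra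
    finally show ?thesis by (simp only: QPx QP(1) z)
  qed
  have ry: "2 * D ^ 3 * ry = - 2 * A * (2 * D * g - (2 + b0) * (sx + sy)) - 4 * D ^ 3 * (b0 * x * wy + b2 * u22)
      + D\<^sup>2 * ((2 + b0) * sy) + D * ((2 + b0) * s)"
  proof -
    have "2 * D ^ 3 * ry = D\<^sup>2 * (2 * D * (Qxy + Pyy) - 2 * (Qx + Py)) + D * (2 * D * (Qx + Py)) - 4 * D ^ 3 * Pyy"
      unfolding r by algebra
    also have "4 * D ^ 3 * Pyy = 2 * A * (2 * D ^ 3 * z) + 4 * D ^ 3 * (b0 * x * wy + b2 * u22)"
      unfolding Pyy by algebra
    finally show ?thesis unfolding QPy QP(1) z by (simp add: algebra_simps)
  qed
  have q: "(x, y) \<in> regular" using nz by (auto simp: regular_def A_def B_def D_def)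
  have W': "W 0 = u" "W 1 = u1" "W 2 = u2" "W 3 = w" "W 4 = s" "W 5 = r"
    unfolding W nths by simp_all
  note rows = mat_rows[OF q, of b0 b1 b2 b3 W, unfolded W', folded A_def B_def D_def h_def c_def]
  have rx': "rx = (\<Sum>j<6. ent1 (mat1 b0 b1 b2 b3 ! 5 ! j) (x, y) * W j)"
  proof -
    have "rx = (2 * B * (2 * D * g - (2 + b0) * (sx + sy)) + 4 * D ^ 3 * (b0 * y * wx + b1 * u11)
      - D\<^sup>2 * ((2 + b0) * sx) + D * ((2 + b0) * s)) / (2 * D ^ 3)"
      using rx nz(3) by (simp add: field_simps)
    then show ?thesis
      unfolding g_def sx sy u11 u22 wx wy Qx' Py' expand using nz
      by (simp add: divide_simps) (simp only: A_def B_def D_def h_def c_def; algebra)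
  qed
  have ry': "ry = (\<Sum>j<6. ent2 (mat2 b0 b1 b2 b3 ! 5 ! j) (x, y) * W j)"
  proof -
    have "ry = (- 2 * A * (2 * D * g - (2 + b0) * (sx + sy)) - 4 * D ^ 3 * (b0 * x * wy + b2 * u22)
      + D\<^sup>2 * ((2 + b0) * sy) + D * ((2 + b0) * s)) / (2 * D ^ 3)"
      using ry nz(3) by (simp add: field_simps)
    then show ?thesis
      unfolding g_def sx sy u11 u22 wx wy Qx' Py' expand using nz
      by (simp add: divide_simps) (simp only: A_def B_def D_def h_def c_def; algebra)
  qed
  show "i < 6 \<Longrightarrow> [u1, u11, w, wx, sx, rx] ! i = (\<Sum>j<6. ent1 (mat1 b0 b1 b2 b3 ! i ! j) (x, y) * W j)"
    by (drule six) (elim disjE; hypsubst; simp only: nths rx' rows(1-5); simp only: u11 sx wx Qx')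
  show "i < 6 \<Longrightarrow> [u2, w, u22, wy, sy, ry] ! i = (\<Sum>j<6. ent2 (mat2 b0 b1 b2 b3 ! i ! j) (x, y) * W j)"
    by (drule six) (elim disjE; hypsubst; simp only: nths ry' rows(6-10); simp only: u22 sy wy Py')
qed

section \<open>The rank\<close>

definition L1f :: "complex \<Rightarrow> complex \<Rightarrow> (complex \<times> complex \<Rightarrow> complex) \<Rightarrow> complex \<times> complex \<Rightarrow> complex" where
  "L1f b0 b2 u q = (1 - fst q * fst q) * D1 (D1 u) q + b0 * fst q * D1 u q + b2 * u q"

definition L2f :: "complex \<Rightarrow> complex \<Rightarrow> (complex \<times> complex \<Rightarrow> complex) \<Rightarrow> complex \<times> complex \<Rightarrow> complex" where
  "L2f b0 b1 u q = (1 - snd q * snd q) * D2 (D2 u) q + b0 * snd q * D2 u q + b1 * u q"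

definition jet :: "complex \<Rightarrow> complex \<Rightarrow> complex \<Rightarrow> (complex \<times> complex \<Rightarrow> complex) \<Rightarrow> nat \<Rightarrow> complex \<times> complex \<Rightarrow> complex" where
  "jet b0 b1 b2 u i = [u, D1 u, D2 u, D1 (D2 u), \<lambda>q. L2f b0 b1 u q - L1f b0 b2 u q,
     \<lambda>q. D1 (L2f b0 b1 u) q - D2 (L1f b0 b2 u) q] ! i"

lemma holo2_L:
  assumes "holomorphic2_on u U"
  shows "holomorphic2_on (L1f b0 b2 u) U" "holomorphic2_on (L2f b0 b1 u) U"
  unfolding L1f_def[abs_def] L2f_def[abs_def] using holo2_open[OF assms] assms
  by (auto intro!: holo2_arith holo2_basic holo2_D1 holo2_D2)

lemma D_L:
  assumes u: "holomorphic2_on u U" and q: "(x, y) \<in> U"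
  shows "D1 (L1f b0 b2 u) (x, y) = (1 - x * x) * D1 (D1 (D1 u)) (x, y) - 2 * x * D1 (D1 u) (x, y)
      + b0 * x * D1 (D1 u) (x, y) + b0 * D1 u (x, y) + b2 * D1 u (x, y)"
    and "D2 (L1f b0 b2 u) (x, y) = (1 - x * x) * D1 (D1 (D2 u)) (x, y) + b0 * x * D1 (D2 u) (x, y) + b2 * D2 u (x, y)"
    and "D1 (L2f b0 b1 u) (x, y) = (1 - y * y) * D1 (D2 (D2 u)) (x, y) + b0 * y * D1 (D2 u) (x, y) + b1 * D1 u (x, y)"
proof -
  note d = holo2_derivs[OF u q] holo2_derivs[OF holo2_D1[OF u] q] holo2_derivs[OF holo2_D2[OF u] q]
    holo2_derivs[OF holo2_D1[OF holo2_D1[OF u]] q] holo2_derivs[OF holo2_D2[OF holo2_D2[OF u]] q]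
  have "D2 (D1 (D1 u)) (x, y) = D1 (D2 (D1 u)) (x, y)" using D2_D1[OF holo2_D1[OF u] q] .
  also have "\<dots> = D1 (D1 (D2 u)) (x, y)"
    using D2_D1[OF u] by (intro D_cong(1)[OF holo2_open[OF u] q])
  finally have c: "D2 (D1 (D1 u)) (x, y) = D1 (D1 (D2 u)) (x, y)" .
  show "D1 (L1f b0 b2 u) (x, y) = (1 - x * x) * D1 (D1 (D1 u)) (x, y) - 2 * x * D1 (D1 u) (x, y)
      + b0 * x * D1 (D1 u) (x, y) + b0 * D1 u (x, y) + b2 * D1 u (x, y)"
    unfolding L1f_def[abs_def]
    by (intro D_eqI) (auto intro!: derivative_eq_intros d simp: algebra_simps)
  have "D2 (L1f b0 b2 u) (x, y) = (1 - x * x) * D2 (D1 (D1 u)) (x, y) + b0 * x * D2 (D1 u) (x, y) + b2 * D2 u (x, y)"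
    unfolding L1f_def[abs_def]
    by (intro D_eqI) (auto intro!: derivative_eq_intros d simp: algebra_simps)
  then show "D2 (L1f b0 b2 u) (x, y) = (1 - x * x) * D1 (D1 (D2 u)) (x, y) + b0 * x * D1 (D2 u) (x, y) + b2 * D2 u (x, y)"
    using c D2_D1[OF u q] by simp
  show "D1 (L2f b0 b1 u) (x, y) = (1 - y * y) * D1 (D2 (D2 u)) (x, y) + b0 * y * D1 (D2 u) (x, y) + b1 * D1 u (x, y)"
    unfolding L2f_def[abs_def]
    by (intro D_eqI) (auto intro!: derivative_eq_intros d simp: algebra_simps)
qed

lemma Z2_apply:
  assumes u: "holomorphic2_on u U" and q: "(x, y) \<in> U"
  shows "dop_apply (C1 False False (cst b0) (cst b3)) u (x, y) =
      L1f b0 b2 u (x, y) + L2f b0 b1 u (x, y) + 2 * (1 - x * y) * D1 (D2 u) (x, y) + (b3 - b1 - b2) * u (x, y)"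
    and "dop_apply (C2 False False (cst b0) (cst b1) (cst b2)) u (x, y) =
      2 * (x - y) * (D1 (L2f b0 b1 u) (x, y) + D2 (L1f b0 b2 u) (x, y))
      - (2 + b0) * (L2f b0 b1 u (x, y) - L1f b0 b2 u (x, y))"
  unfolding dop_apply_C1 dop_apply_C2 D_L[OF u q]
  by (simp_all add: L1f_def L2f_def chart_data power2_eq_square algebra_simps)

section \<open>Correspondence between solutions of the Pfaffian system and of the operators\<close>

definition pfaff :: "complex \<Rightarrow> complex \<Rightarrow> complex \<Rightarrow> complex \<Rightarrow> (complex \<times> complex) set \<Rightarrow> (nat \<Rightarrow> complex \<times> complex \<Rightarrow> complex) \<Rightarrow> bool" where
  "pfaff b0 b1 b2 b3 V W \<longleftrightarrow> (\<forall>i<6. holomorphic2_on (W i) V \<and> (\<forall>q\<in>V.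
     D1 (W i) q = (\<Sum>j<6. ent1 (mat1 b0 b1 b2 b3 ! i ! j) q * W j q) \<and>
     D2 (W i) q = (\<Sum>j<6. ent2 (mat2 b0 b1 b2 b3 ! i ! j) q * W j q)))"

lemma pfaff_subset: "pfaff b0 b1 b2 b3 U W \<Longrightarrow> open V \<Longrightarrow> V \<subseteq> U \<Longrightarrow> pfaff b0 b1 b2 b3 V W"
  unfolding pfaff_def using holo2_subset by blast

lemma pfaff_diff:
  assumes W: "pfaff b0 b1 b2 b3 V W" and Z: "pfaff b0 b1 b2 b3 V Z"
  shows "pfaff b0 b1 b2 b3 V (\<lambda>i q. W i q - Z i q)"
  unfolding pfaff_def
proof (intro allI impI conjI ballI)
  fix i :: nat assume i: "i < 6"
  have h: "holomorphic2_on (W i) V" "holomorphic2_on (Z i) V" using W Z i by (auto simp: pfaff_def)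
  then show "holomorphic2_on (\<lambda>q. W i q - Z i q) V" by (rule holo2_arith)
  fix q assume q: "q \<in> V"
  show "D1 (\<lambda>q. W i q - Z i q) q = (\<Sum>j<6. ent1 (mat1 b0 b1 b2 b3 ! i ! j) q * (W j q - Z j q))"
    "D2 (\<lambda>q. W i q - Z i q) q = (\<Sum>j<6. ent2 (mat2 b0 b1 b2 b3 ! i ! j) q * (W j q - Z j q))"
    using W Z i q by (simp_all add: D_arith[OF h q] pfaff_def sum_subtractf right_diff_distrib)
qed

lemma pfaff_lincomb:
  fixes c :: "nat \<Rightarrow> complex"
  assumes V: "open V" and W: "\<And>k. k < n \<Longrightarrow> pfaff b0 b1 b2 b3 V (W k)"
  shows "pfaff b0 b1 b2 b3 V (\<lambda>i q. \<Sum>k<n. c k * W k i q)"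
  unfolding pfaff_def
proof (intro allI impI conjI ballI)
  fix i :: nat assume i: "i < 6"
  have h: "holomorphic2_on (W k i) V" if "k < n" for k using W[OF that] i by (auto simp: pfaff_def)
  have hc: "holomorphic2_on (\<lambda>q. c k) V" for k using V by (rule holo2_basic)
  show "holomorphic2_on (\<lambda>q. \<Sum>k<n. c k * W k i q) V"
    using h hc V by (intro holo2_sum holo2_arith) auto
  fix q assume q: "q \<in> V"
  have "D1 (\<lambda>q. \<Sum>k<n. c k * W k i q) q = (\<Sum>k<n. c k * D1 (W k i) q)"
    "D2 (\<lambda>q. \<Sum>k<n. c k * W k i q) q = (\<Sum>k<n. c k * D2 (W k i) q)"
    using D_sum_mult[of "{..<n}" "\<lambda>k q. c k" V "\<lambda>k. W k i" q] h hc q by (simp_all add: D_basic)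
  moreover have "(\<Sum>k<n. c k * (\<Sum>j<6. m j * W k j q)) = (\<Sum>j<6. m j * (\<Sum>k<n. c k * W k j q))" for m
    unfolding sum_distrib_left by (subst sum.swap) (simp add: mult.left_commute)
  ultimately show "D1 (\<lambda>q. \<Sum>k<n. c k * W k i q) q = (\<Sum>j<6. ent1 (mat1 b0 b1 b2 b3 ! i ! j) q * (\<Sum>k<n. c k * W k j q))"
    "D2 (\<lambda>q. \<Sum>k<n. c k * W k i q) q = (\<Sum>j<6. ent2 (mat2 b0 b1 b2 b3 ! i ! j) q * (\<Sum>k<n. c k * W k j q))"
    using W i q by (simp_all add: pfaff_def)
qed

lemma pfaff_D:
  assumes "pfaff b0 b1 b2 b3 V W" "V \<subseteq> regular" "(x, y) \<in> V"
  defines "h \<equiv> 1 - x * y" and "c \<equiv> b3 - b1 - b2"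
    and "Qx \<equiv> (2 + b0) * W 4 (x, y) / (4 * (x - y)) + W 5 (x, y) / 2"
    and "Py \<equiv> (2 + b0) * W 4 (x, y) / (4 * (x - y)) - W 5 (x, y) / 2"
  shows "D1 (W 0) (x, y) = W 1 (x, y)" "D2 (W 0) (x, y) = W 2 (x, y)"
    "D1 (W 2) (x, y) = W 3 (x, y)" "D2 (W 1) (x, y) = W 3 (x, y)"
    "(1 - x\<^sup>2) * D1 (W 1) (x, y) = - h * W 3 (x, y) - c * W 0 (x, y) / 2 - W 4 (x, y) / 2 - b0 * x * W 1 (x, y) - b2 * W 0 (x, y)"
    "(1 - y\<^sup>2) * D2 (W 2) (x, y) = - h * W 3 (x, y) - c * W 0 (x, y) / 2 + W 4 (x, y) / 2 - b0 * y * W 2 (x, y) - b1 * W 0 (x, y)"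
    "(1 - x\<^sup>2) * D1 (W 3) (x, y) = Py - b0 * x * W 3 (x, y) - b2 * W 2 (x, y)"
    "D1 (W 4) (x, y) = 2 * Qx + 2 * (h * D1 (W 3) (x, y) - y * W 3 (x, y)) + c * W 1 (x, y)"
    "D2 (W 4) (x, y) = - 2 * Py - 2 * (h * D2 (W 3) (x, y) - x * W 3 (x, y)) - c * W 2 (x, y)"
proof -
  have q: "(x, y) \<in> regular" using assms by auto
  then have nz: "1 - x\<^sup>2 \<noteq> 0" "1 - y\<^sup>2 \<noteq> 0" by (auto simp: regular_def)
  have e: "D1 (W i) (x, y) = (\<Sum>j<6. ent1 (mat1 b0 b1 b2 b3 ! i ! j) (x, y) * W j (x, y))"
    "D2 (W i) (x, y) = (\<Sum>j<6. ent2 (mat2 b0 b1 b2 b3 ! i ! j) (x, y) * W j (x, y))" if "i < 6" for i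
    using assms(1,3) that by (auto simp: pfaff_def)
  note rows = mat_rows[OF q, of b0 b1 b2 b3 "\<lambda>i. W i (x, y)", folded h_def c_def Qx_def Py_def]
  show "D1 (W 0) (x, y) = W 1 (x, y)" "D2 (W 0) (x, y) = W 2 (x, y)"
    "D1 (W 2) (x, y) = W 3 (x, y)" "D2 (W 1) (x, y) = W 3 (x, y)"
    using e rows(1,3,6,7) by simp_all
  show "(1 - x\<^sup>2) * D1 (W 1) (x, y) = - h * W 3 (x, y) - c * W 0 (x, y) / 2 - W 4 (x, y) / 2 - b0 * x * W 1 (x, y) - b2 * W 0 (x, y)"
    using e(1)[of 1] rows(2) nz by simp
  show "(1 - y\<^sup>2) * D2 (W 2) (x, y) = - h * W 3 (x, y) - c * W 0 (x, y) / 2 + W 4 (x, y) / 2 - b0 * y * W 2 (x, y) - b1 * W 0 (x, y)"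
    using e(2)[of 2] rows(8) nz by simp
  show "(1 - x\<^sup>2) * D1 (W 3) (x, y) = Py - b0 * x * W 3 (x, y) - b2 * W 2 (x, y)"
    using e(1)[of 3] rows(4) nz by (simp add: Py_def)
  show "D1 (W 4) (x, y) = 2 * Qx + 2 * (h * D1 (W 3) (x, y) - y * W 3 (x, y)) + c * W 1 (x, y)"
    using e(1)[of 3] e(1)[of 4] rows(5) by simp
  show "D2 (W 4) (x, y) = - 2 * Py - 2 * (h * D2 (W 3) (x, y) - x * W 3 (x, y)) - c * W 2 (x, y)"
    using e(2)[of 3] e(2)[of 4] rows(10) by simp
qed

text \<open>All components are recovered from \<open>W 0\<close> by differentiation:
  \<open>W 1\<close>, \<open>W 2\<close> first, then \<open>W 3\<close>, then \<open>W 4\<close>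
  from the derivative of \<open>W 1\<close> and \<open>W 5\<close> from that of \<open>W 3\<close>.
  Thus the passage to the first component is injective, which yields linear independence.\<close>

lemma pfaff_zero:
  assumes W: "pfaff b0 b1 b2 b3 V W" "V \<subseteq> regular" "open V" and z: "\<And>q. q \<in> V \<Longrightarrow> W 0 q = 0"
    and i: "i < 6" and q: "q \<in> V"
  shows "W i q = 0"
proof -
  have D0: "D1 (W j) p = 0 \<and> D2 (W j) p = 0" if "\<And>q. q \<in> V \<Longrightarrow> W j q = 0" "p \<in> V" for j p
    using D_cong[OF W(3) that(2), of "W j" "\<lambda>_. 0"] that(1) by (simp add: D_basic)
  have 1: "W 1 q = 0" and 2: "W 2 q = 0" if "q \<in> V" for q
    using pfaff_D(1,2)[OF W(1,2), of "fst q" "snd q"] D0[OF z that] that by auto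
  have 3: "W 3 q = 0" if "q \<in> V" for q
    using pfaff_D(3)[OF W(1,2), of "fst q" "snd q"] D0[OF 2 that] that by auto
  have 4: "W 4 q = 0" if "q \<in> V" for q
    using pfaff_D(5)[OF W(1,2), of "fst q" "snd q"] D0[OF 1 that] z[OF that] 1[OF that] 3[OF that] that by auto
  have 5: "W 5 q = 0" if "q \<in> V" for q
    using pfaff_D(7)[OF W(1,2), of "fst q" "snd q"] D0[OF 3 that] 2[OF that] 3[OF that] 4[OF that] that by auto
  have "i = 0 \<or> i = 1 \<or> i = 2 \<or> i = 3 \<or> i = 4 \<or> i = 5" using i by linarith
  then show ?thesis using z 1 2 3 4 5 q by (elim disjE) simp_all
qed

text \<open>The derivatives of \<open>W 1\<close> and \<open>W 2\<close> yield \<open>L1f\<close>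
  and \<open>L2f\<close> of \<open>W 0\<close>, whose sum is the first equation and whose difference
  is \<open>W 4\<close>. The two systems for \<open>W 4\<close> then yield \<open>D1\<close> of the
  one and \<open>D2\<close> of the other; their sum is \<open>(2 + b0) W 4 / (2 (x - y))\<close>,
  the second equation.\<close>

lemma pfaff_solution:
  assumes W: "pfaff b0 b1 b2 b3 V W" and V: "V \<subseteq> regular" "open V" and q: "q \<in> V"
  shows "dop_apply (C1 False False (cst b0) (cst b3)) (W 0) q = 0"
    and "dop_apply (C2 False False (cst b0) (cst b1) (cst b2)) (W 0) q = 0"
proof -
  define c where "c = b3 - b1 - b2"
  have h: "holomorphic2_on (W i) V" if "i < 6" for i using W that by (simp add: pfaff_def)
  have h0: "holomorphic2_on (W 0) V" by (rule h) simp
  note D = pfaff_D[OF W V(1)]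
  have DD: "D1 (D1 (W 0)) (x, y) = D1 (W 1) (x, y)" "D2 (D2 (W 0)) (x, y) = D2 (W 2) (x, y)"
    "D1 (D2 (W 0)) (x, y) = W 3 (x, y)" if "(x, y) \<in> V" for x y
    using D_cong[OF V(2) that, of "D1 (W 0)" "W 1"] D_cong[OF V(2) that, of "D2 (W 0)" "W 2"] D(1,2,3) that
    by auto
  let ?P = "\<lambda>q. (- 2 * (1 - fst q * snd q) * W 3 q - c * W 0 q - W 4 q) / 2"
  let ?Q = "\<lambda>q. (- 2 * (1 - fst q * snd q) * W 3 q - c * W 0 q + W 4 q) / 2"
  have P: "L1f b0 b2 (W 0) p = ?P p" and Q: "L2f b0 b1 (W 0) p = ?Q p" if p: "p \<in> V" for p
  proof -
    have v: "(fst p, snd p) \<in> V" using p by simp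
    show "L1f b0 b2 (W 0) p = ?P p"
      using D(5)[OF v] unfolding L1f_def power2_eq_square[symmetric] using D(1)[OF v] DD(1)[OF v]
      by (simp add: c_def diff_divide_distrib add_divide_distrib)
    show "L2f b0 b1 (W 0) p = ?Q p"
      using D(6)[OF v] unfolding L2f_def power2_eq_square[symmetric] using D(2)[OF v] DD(2)[OF v]
      by (simp add: c_def diff_divide_distrib add_divide_distrib)
  qed
  obtain x y where xy: "q = (x, y)" by force
  have xyV: "(x, y) \<in> V" using q xy by simp
  have d: "((\<lambda>z. W i (z, y)) has_field_derivative D1 (W i) (x, y)) (at x)"
    "((\<lambda>z. W i (x, z)) has_field_derivative D2 (W i) (x, y)) (at y)" if "i < 6" for i
    using holo2_derivs[OF h[OF that] xyV] .
  have "D1 (L2f b0 b1 (W 0)) (x, y) = D1 ?Q (x, y)" "D2 (L1f b0 b2 (W 0)) (x, y) = D2 ?P (x, y)"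
    using D_cong[OF V(2) xyV, of "L2f b0 b1 (W 0)" ?Q] D_cong[OF V(2) xyV, of "L1f b0 b2 (W 0)" ?P] P Q by auto
  moreover have "D1 ?Q (x, y) = (- 2 * ((1 - x * y) * D1 (W 3) (x, y) - y * W 3 (x, y)) - c * D1 (W 0) (x, y) + D1 (W 4) (x, y)) / 2"
    by (rule D_eqI) (auto intro!: derivative_eq_intros d simp: field_simps)
  moreover have "D2 ?P (x, y) = (- 2 * ((1 - x * y) * D2 (W 3) (x, y) - x * W 3 (x, y)) - c * D2 (W 0) (x, y) - D2 (W 4) (x, y)) / 2"
    by (rule D_eqI) (auto intro!: derivative_eq_intros d simp: field_simps)
  ultimately have PQ: "D1 (L2f b0 b1 (W 0)) (x, y) = (2 + b0) * W 4 (x, y) / (4 * (x - y)) + W 5 (x, y) / 2"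
    "D2 (L1f b0 b2 (W 0)) (x, y) = (2 + b0) * W 4 (x, y) / (4 * (x - y)) - W 5 (x, y) / 2"
  proof -
    define t where "t = (2 + b0) * W 4 (x, y) / (4 * (x - y))"
    note D' = D(1,2,8,9)[OF xyV, folded c_def t_def]
    assume *: "D1 (L2f b0 b1 (W 0)) (x, y) = D1 ?Q (x, y)" "D2 (L1f b0 b2 (W 0)) (x, y) = D2 ?P (x, y)"
      "D1 ?Q (x, y) = (- 2 * ((1 - x * y) * D1 (W 3) (x, y) - y * W 3 (x, y)) - c * D1 (W 0) (x, y) + D1 (W 4) (x, y)) / 2"
      "D2 ?P (x, y) = (- 2 * ((1 - x * y) * D2 (W 3) (x, y) - x * W 3 (x, y)) - c * D2 (W 0) (x, y) - D2 (W 4) (x, y)) / 2"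
    show "D1 (L2f b0 b1 (W 0)) (x, y) = (2 + b0) * W 4 (x, y) / (4 * (x - y)) + W 5 (x, y) / 2"
      "D2 (L1f b0 b2 (W 0)) (x, y) = (2 + b0) * W 4 (x, y) / (4 * (x - y)) - W 5 (x, y) / 2"
      unfolding * D' t_def[symmetric] by (simp_all add: field_simps)
  qed
  have "x - y \<noteq> 0" using xyV V(1) by (auto simp: regular_def)
  then have t: "2 * (x - y) * ((2 + b0) * W 4 (x, y) / (4 * (x - y)) + W 5 (x, y) / 2
      + ((2 + b0) * W 4 (x, y) / (4 * (x - y)) - W 5 (x, y) / 2)) = (2 + b0) * W 4 (x, y)"
    by (simp add: divide_simps)
  have "L2f b0 b1 (W 0) (x, y) - L1f b0 b2 (W 0) (x, y) = W 4 (x, y)"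
    unfolding P[OF xyV] Q[OF xyV] by (simp add: field_simps)
  then show "dop_apply (C2 False False (cst b0) (cst b1) (cst b2)) (W 0) q = 0"
    unfolding xy Z2_apply(2)[OF h0 xyV, of b0 b1 b2] PQ t by simp
  show "dop_apply (C1 False False (cst b0) (cst b3)) (W 0) q = 0"
    unfolding xy Z2_apply(1)[OF h0 xyV, of b0 b3 b2 b1] DD(3)[OF xyV] P[OF xyV] Q[OF xyV]
    by (simp add: c_def field_simps)
qed

text \<open>The equations hold on an open set, so they may be differentiated: the first one in
  \<open>x\<close>, in \<open>y\<close> and in both, the second one in \<open>x\<close> and in
  \<open>y\<close>. With the symmetry of mixed derivatives these are the relations that the
  elimination consumes.\<close>

lemma jet_pfaff:
  assumes u: "holomorphic2_on u V" and V: "V \<subseteq> regular"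
    and sol: "\<And>q. q \<in> V \<Longrightarrow> dop_apply (C1 False False (cst b0) (cst b3)) u q = 0"
      "\<And>q. q \<in> V \<Longrightarrow> dop_apply (C2 False False (cst b0) (cst b1) (cst b2)) u q = 0"
  shows "pfaff b0 b1 b2 b3 V (jet b0 b1 b2 u)"
proof -
  have Vo: "open V" using holo2_open[OF u] .
  let ?P = "L1f b0 b2 u" and ?Q = "L2f b0 b1 u" and ?w = "D1 (D2 u)" and ?c = "b3 - b1 - b2"
  let ?s = "\<lambda>q. ?Q q - ?P q" and ?r = "\<lambda>q. D1 ?Q q - D2 ?P q"
  note hP = holo2_L(1)[OF u, of b0 b2] and hQ = holo2_L(2)[OF u, of b0 b1]
  note hw = holo2_D1[OF holo2_D2[OF u]]
  have hs: "holomorphic2_on ?s V" by (rule holo2_arith[OF hQ hP])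
  have hr: "holomorphic2_on ?r V" by (rule holo2_arith[OF holo2_D1[OF hQ] holo2_D2[OF hP]])
  have zero: "D1 f q = 0" "D2 f q = 0" if "\<And>p. p \<in> V \<Longrightarrow> f p = 0" "q \<in> V" for f q
    using D_cong[OF Vo that(2), of f "\<lambda>_. 0"] that(1) by (simp_all add: D_basic)
  \<comment> \<open>Any expression computed as a partial derivative of a function vanishing on
    \<open>V\<close> must be zero; this turns the derivative rules into identities.\<close>
  have zeroD: "((\<lambda>z. f (z, y)) has_field_derivative e) (at x) \<Longrightarrow> e = 0"
    "((\<lambda>z. f (x, z)) has_field_derivative e) (at y) \<Longrightarrow> e = 0"
    if "\<And>p. p \<in> V \<Longrightarrow> f p = 0" "(x, y) \<in> V" for f x y e
    using zero[OF that] D_eqI(1)[of f y e x] D_eqI(2)[of f x e y] by simp_all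
  have I1: "?P q + ?Q q + 2 * (1 - fst q * snd q) * ?w q + ?c * u q = 0" if "q \<in> V" for q
    using sol(1)[OF that] Z2_apply(1)[OF u, of "fst q" "snd q"] that by simp
  have I2: "2 * (fst q - snd q) * (D1 ?Q q + D2 ?P q) - (2 + b0) * (?Q q - ?P q) = 0" if "q \<in> V" for q
    using sol(2)[OF that] Z2_apply(2)[OF u, of "fst q" "snd q"] that by simp
  have d: "((\<lambda>z. f (z, y)) has_field_derivative D1 f (x, y)) (at x)"
    "((\<lambda>z. f (x, z)) has_field_derivative D2 f (x, y)) (at y)" if "holomorphic2_on f V" "(x, y) \<in> V" for f x y
    using holo2_derivs[OF that] .
  note dd = d[OF u] d[OF hP] d[OF hQ] d[OF hw] d[OF holo2_D1[OF u]] d[OF holo2_D2[OF u]] d[OF hs] d[OF hr]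
    d[OF holo2_D1[OF hP]] d[OF holo2_D1[OF hQ]] d[OF holo2_D2[OF hP]] d[OF holo2_D2[OF hQ]]
    d[OF holo2_D1[OF hw]] d[OF holo2_D2[OF hw]]
  have I1x: "D1 ?P (x, y) + D1 ?Q (x, y) + 2 * ((1 - x * y) * D1 ?w (x, y) - y * ?w (x, y)) + ?c * D1 u (x, y) = 0"
    if "(x, y) \<in> V" for x y
    by (rule zeroD(1)[OF I1 that]) (auto intro!: derivative_eq_intros dd that simp: algebra_simps)
  have I1y: "D2 ?P (x, y) + D2 ?Q (x, y) + 2 * ((1 - x * y) * D2 ?w (x, y) - x * ?w (x, y)) + ?c * D2 u (x, y) = 0"
    if "(x, y) \<in> V" for x y
    by (rule zeroD(2)[OF I1 that]) (auto intro!: derivative_eq_intros dd that simp: algebra_simps)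
  have I1x': "D1 ?P q + D1 ?Q q + 2 * ((1 - fst q * snd q) * D1 ?w q - snd q * ?w q) + ?c * D1 u q = 0" if "q \<in> V" for q
    using I1x[of "fst q" "snd q"] that by simp
  have c21: "D2 (D1 f) (x, y) = D1 (D2 f) (x, y)" if "holomorphic2_on f V" "(x, y) \<in> V" for f x y
    using D2_D1[OF that] .
  have Py: "D2 ?P q = (1 - fst q * fst q) * D1 ?w q + b0 * fst q * ?w q + b2 * D2 u q" if "q \<in> V" for q
    using D_L(2)[OF u, of "fst q" "snd q"] that by simp
  have Qx: "D1 ?Q q = (1 - snd q * snd q) * D2 ?w q + b0 * snd q * ?w q + b1 * D1 u q" if "q \<in> V" for q
    using D_L(3)[OF u, of "fst q" "snd q"] c21[OF holo2_D2[OF u], of "fst q" "snd q"] that by simp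
  have main: "D1 (jet b0 b1 b2 u i) q = (\<Sum>j<6. ent1 (mat1 b0 b1 b2 b3 ! i ! j) q * jet b0 b1 b2 u j q) \<and>
     D2 (jet b0 b1 b2 u i) q = (\<Sum>j<6. ent2 (mat2 b0 b1 b2 b3 ! i ! j) q * jet b0 b1 b2 u j q)"
    if i: "i < 6" and q: "q \<in> V" for i q
  proof -
    obtain x y where xy: "q = (x, y)" by force
    have v: "(x, y) \<in> V" using q xy by simp
    have nz: "1 - x\<^sup>2 \<noteq> 0" "1 - y\<^sup>2 \<noteq> 0" "x - y \<noteq> 0" using v V by (auto simp: regular_def)
    have six: "i = 0 \<or> i = 1 \<or> i = 2 \<or> i = 3 \<or> i = 4 \<or> i = 5" using i by linarith
    have nths: "(as # l) ! 0 = as" "(as # l) ! 1 = l ! 0" "(as # l) ! 2 = l ! 1" "(as # l) ! 3 = l ! 2"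
      "(as # l) ! 4 = l ! 3" "(as # l) ! 5 = l ! 4" for as :: 'z and l
      by (simp_all add: numeral_eq_Suc)
    have jetq: "jet b0 b1 b2 u j q = [u q, D1 u q, D2 u q, ?w q, ?s q, ?r q] ! j" if "j < 6" for j
    proof -
      have "j = 0 \<or> j = 1 \<or> j = 2 \<or> j = 3 \<or> j = 4 \<or> j = 5" using that by linarith
      then show ?thesis by (elim disjE; hypsubst; simp only: jet_def nths)
    qed
    have Pyy: "D2 (D2 ?P) (x, y) = (1 - x * x) * D2 (D1 ?w) (x, y) + b0 * x * D2 ?w (x, y) + b2 * D2 (D2 u) (x, y)"
    proof -
      have "D2 (D2 ?P) (x, y) = D2 (\<lambda>q. (1 - fst q * fst q) * D1 ?w q + b0 * fst q * ?w q + b2 * D2 u q) (x, y)"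
        by (rule D_cong(2)[OF Vo v Py])
      also have "\<dots> = (1 - x * x) * D2 (D1 ?w) (x, y) + b0 * x * D2 ?w (x, y) + b2 * D2 (D2 u) (x, y)"
        by (rule D_eqI) (auto intro!: derivative_eq_intros dd v simp: algebra_simps)
      finally show ?thesis .
    qed
    have Qxx: "D1 (D1 ?Q) (x, y) = (1 - y * y) * D1 (D2 ?w) (x, y) + b0 * y * D1 ?w (x, y) + b1 * D1 (D1 u) (x, y)"
    proof -
      have "D1 (D1 ?Q) (x, y) = D1 (\<lambda>q. (1 - snd q * snd q) * D2 ?w q + b0 * snd q * ?w q + b1 * D1 u q) (x, y)"
        by (rule D_cong(1)[OF Vo v Qx])
      also have "\<dots> = (1 - y * y) * D1 (D2 ?w) (x, y) + b0 * y * D1 ?w (x, y) + b1 * D1 (D1 u) (x, y)"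
        by (rule D_eqI) (auto intro!: derivative_eq_intros dd v simp: algebra_simps)
      finally show ?thesis .
    qed
    have QPx: "2 * (x - y) * (D1 (D1 ?Q) (x, y) + D1 (D2 ?P) (x, y)) + 2 * (D1 ?Q (x, y) + D2 ?P (x, y)) - (2 + b0) * D1 ?s (x, y) = 0"
      by (rule zeroD(1)[OF I2 v]) (auto intro!: derivative_eq_intros dd v simp: algebra_simps D_arith(3,4)[OF hQ hP v])
    have QPy: "2 * (x - y) * (D2 (D1 ?Q) (x, y) + D2 (D2 ?P) (x, y)) - 2 * (D1 ?Q (x, y) + D2 ?P (x, y)) - (2 + b0) * D2 ?s (x, y) = 0"
      by (rule zeroD(2)[OF I2 v]) (auto intro!: derivative_eq_intros dd v simp: algebra_simps D_arith(3,4)[OF hQ hP v])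
    have PQxy: "D2 (D1 ?P) (x, y) + D2 (D1 ?Q) (x, y) + 2 * ((1 - x * y) * D2 (D1 ?w) (x, y) - x * D1 ?w (x, y) - y * D2 ?w (x, y) - ?w (x, y)) + ?c * D2 (D1 u) (x, y) = 0"
      by (rule zeroD(2)[OF I1x' v]) (auto intro!: derivative_eq_intros dd v simp: algebra_simps)
    have p1: "?P (x, y) + ?Q (x, y) + 2 * (1 - x * y) * ?w (x, y) + ?c * u (x, y) = 0" using I1[OF v] by simp
    have p2: "?s (x, y) = ?Q (x, y) - ?P (x, y)" ..
    have p3: "?P (x, y) = (1 - x\<^sup>2) * D1 (D1 u) (x, y) + b0 * x * D1 u (x, y) + b2 * u (x, y)"
      and p4: "?Q (x, y) = (1 - y\<^sup>2) * D2 (D2 u) (x, y) + b0 * y * D2 u (x, y) + b1 * u (x, y)"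
      by (simp_all add: L1f_def L2f_def power2_eq_square)
    have p5: "2 * (x - y) * (D1 ?Q (x, y) + D2 ?P (x, y)) = (2 + b0) * ?s (x, y)" using I2[OF v] by simp
    have p6: "?r (x, y) = D1 ?Q (x, y) - D2 ?P (x, y)" ..
    have p7: "D2 ?P (x, y) = (1 - x\<^sup>2) * D1 ?w (x, y) + b0 * x * ?w (x, y) + b2 * D2 u (x, y)"
      and p8: "D1 ?Q (x, y) = (1 - y\<^sup>2) * D2 ?w (x, y) + b0 * y * ?w (x, y) + b1 * D1 u (x, y)"
      using Py[OF v] Qx[OF v] by (simp_all add: power2_eq_square)
    have p9: "D1 ?s (x, y) = D1 ?Q (x, y) - D1 ?P (x, y)" and p10: "D2 ?s (x, y) = D2 ?Q (x, y) - D2 ?P (x, y)"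
      using D_arith(3,4)[OF hQ hP v] .
    have p13: "2 * (x - y) * (D1 (D1 ?Q) (x, y) + D1 (D2 ?P) (x, y)) + 2 * (D1 ?Q (x, y) + D2 ?P (x, y)) = (2 + b0) * D1 ?s (x, y)"
      and p14: "2 * (x - y) * (D2 (D1 ?Q) (x, y) + D2 (D2 ?P) (x, y)) - 2 * (D1 ?Q (x, y) + D2 ?P (x, y)) = (2 + b0) * D2 ?s (x, y)"
      using QPx QPy by (simp_all only: right_minus_eq)
    have p15: "D1 (D2 ?P) (x, y) + D2 (D1 ?Q) (x, y)
      + 2 * ((1 - x * y) * D2 (D1 ?w) (x, y) - x * D1 ?w (x, y) - y * D2 ?w (x, y) - ?w (x, y)) + ?c * ?w (x, y) = 0"
      using PQxy unfolding c21[OF hP v] c21[OF u v] .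
    have p16: "D2 (D2 ?P) (x, y) = (1 - x\<^sup>2) * D2 (D1 ?w) (x, y) + b0 * x * D2 ?w (x, y) + b2 * D2 (D2 u) (x, y)"
      and p17: "D1 (D1 ?Q) (x, y) = (1 - y\<^sup>2) * D2 (D1 ?w) (x, y) + b0 * y * D1 ?w (x, y) + b1 * D1 (D1 u) (x, y)"
      unfolding Pyy Qxx c21[OF hw v] by (simp_all add: power2_eq_square)
    have p18: "D1 ?r (x, y) = D1 (D1 ?Q) (x, y) - D1 (D2 ?P) (x, y)" and p19: "D2 ?r (x, y) = D2 (D1 ?Q) (x, y) - D2 (D2 ?P) (x, y)"
      using D_arith(3,4)[OF holo2_D1[OF hQ] holo2_D2[OF hP] v] .
    note elim = pfaffian_elimination[OF nz p1 p2 p3 p4 p5 p6 p7 p8 p9 p10 I1x[OF v] I1y[OF v] p13 p14 p15 p16 p17 p18 p19 refl i]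
    have "D1 (jet b0 b1 b2 u i) q = [D1 u q, D1 (D1 u) q, ?w q, D1 ?w q, D1 ?s q, D1 ?r q] ! i"
      "D2 (jet b0 b1 b2 u i) q = [D2 u q, ?w q, D2 (D2 u) q, D2 ?w q, D2 ?s q, D2 ?r q] ! i"
      using six c21[OF u v] by (auto simp: jet_def xy numeral_eq_Suc)
    then show ?thesis using elim jetq by (simp add: xy)
  qed
  have "holomorphic2_on (jet b0 b1 b2 u i) V" if "i < 6" for i
  proof -
    have "i = 0 \<or> i = 1 \<or> i = 2 \<or> i = 3 \<or> i = 4 \<or> i = 5" using that by linarith
    then show ?thesis
      using u hw hs hr holo2_D1[OF u] holo2_D2[OF u] by (auto simp: jet_def numeral_eq_Suc)
  qed
  then show ?thesis using main by (auto simp: pfaff_def)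
qed

text \<open>The basis consists of the first components of the six fundamental solutions, those with
  unit initial vectors at \<open>p\<close>. Independence follows from \<open>pfaff_zero\<close>,
  spanning from uniqueness applied to the jet of a solution.\<close>

lemma solution_dim_Z2:
  assumes p: "p \<in> regular"
  shows "solution_dim (Z2 A0 A1 A2 A3) p 6"
proof -
  define b0 b1 b2 b3 where b: "b0 = par0 A0" "b1 = par A0 A1" "b2 = par A0 A2" "b3 = par A0 A3"
  let ?P1 = "C1 False False (cst b0) (cst b3)" and ?P2 = "C2 False False (cst b0) (cst b1) (cst b2)"
  have gens: "Z2 A0 A1 A2 A3 = left_ideal {?P1, ?P2}"
    by (simp add: Z2_def Z2_gens_def Z2_gens_chart b)
  have "\<exists>W V. open V \<and> p \<in> V \<and> V \<subseteq> regular \<and> pfaff b0 b1 b2 b3 V W \<and> (\<forall>i<6. W i p = (if i = k then 1 else 0))" for k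
    using pfaffian_exists[where n = 6 and ?M1.0 = "\<lambda>i j. ent1 (mat1 b0 b1 b2 b3 ! i ! j)"
        and ?M2.0 = "\<lambda>i j. ent2 (mat2 b0 b1 b2 b3 ! i ! j)" and c = "\<lambda>i. if i = k then 1 else 0",
        OF open_regular p holo2_ent(1) holo2_ent(2) flat]
    unfolding pfaff_def by blast
  then obtain W V where V: "\<And>k. open (V k)" "\<And>k. p \<in> V k" "\<And>k. V k \<subseteq> regular"
    and W: "\<And>k. pfaff b0 b1 b2 b3 (V k) (W k)" "\<And>k i. i < 6 \<Longrightarrow> W k i p = (if i = k then 1 else 0)"
    by metis
  define V0 where "V0 = (\<Inter>k\<in>{..<6::nat}. V k)"
  have V0: "open V0" "p \<in> V0" "V0 \<subseteq> regular" and W0: "pfaff b0 b1 b2 b3 V0 (W k)" if "k < 6" for k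
  proof -
    show "open V0" "p \<in> V0" using V by (auto simp: V0_def)
    show "V0 \<subseteq> regular" using V(3)[of 0] by (auto simp: V0_def)
    show "pfaff b0 b1 b2 b3 V0 (W k)"
      using V(1) that by (intro pfaff_subset[OF W(1)]) (auto simp: V0_def)
  qed
  have V0': "open V0" "p \<in> V0" "V0 \<subseteq> regular" using V0[of 0] by auto
  have comb: "(\<Sum>k<6. c k * W k i p) = c i" if "i < 6" for c i
    using that by (simp add: W(2)[OF that] if_distrib[of "(*) _"] cong: if_cong)
  show ?thesis
    unfolding solution_dim_def
  proof (intro exI[of _ "\<lambda>k. W k 0"] conjI allI impI)
    fix k :: nat assume "k < 6"
    have hW: "holomorphic2_on (W k 0) V0" using W0[OF \<open>k < 6\<close>] by (simp add: pfaff_def)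
    have "dop_apply P (W k 0) q = 0" if "P \<in> Z2 A0 A1 A2 A3" "q \<in> V0" for P q
    proof (rule left_ideal_annihilates[OF hW _ that(1)[unfolded gens] that(2)])
      fix P q assume "P \<in> {?P1, ?P2}" "q \<in> V0"
      then show "dop_apply P (W k 0) q = 0"
        using pfaff_solution[OF W0[OF \<open>k < 6\<close>] V0'(3) V0'(1)] by blast
    qed
    then show "local_solution (Z2 A0 A1 A2 A3) p (W k 0)"
      unfolding local_solution_def using hW V0' by blast
  next
    fix c :: "nat \<Rightarrow> complex" and i :: nat
    assume ev: "\<forall>\<^sub>F q in nhds p. (\<Sum>k<6. c k * W k 0 q) = 0" and i: "i < 6"
    obtain N where N: "open N" "p \<in> N" "\<And>q. q \<in> N \<Longrightarrow> (\<Sum>k<6. c k * W k 0 q) = 0"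
      using ev by (auto simp: eventually_nhds)
    have "pfaff b0 b1 b2 b3 (V0 \<inter> N) (\<lambda>i q. \<Sum>k<6. c k * W k i q)"
    proof (rule pfaff_lincomb)
      show "open (V0 \<inter> N)" using V0' N by auto
      then show "pfaff b0 b1 b2 b3 (V0 \<inter> N) (W k)" if "k < 6" for k
        by (rule pfaff_subset[OF W0[OF that]]) auto
    qed
    then have "(\<Sum>k<6. c k * W k i p) = 0"
      by (rule pfaff_zero) (use V0' N i in auto)
    then show "c i = 0" using comb[OF i] by simp
  next
    fix u assume "local_solution (Z2 A0 A1 A2 A3) p u"
    then obtain U where U: "p \<in> U" "holomorphic2_on u U" and sol: "\<forall>P\<in>Z2 A0 A1 A2 A3. \<forall>q\<in>U. dop_apply P u q = 0"
      by (auto simp: local_solution_def)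
    let ?N = "U \<inter> V0"
    have N: "open ?N" "p \<in> ?N" "?N \<subseteq> regular" using U V0' holo2_open by auto
    have "?P1 \<in> Z2 A0 A1 A2 A3" "?P2 \<in> Z2 A0 A1 A2 A3" by (auto simp: gens intro: left_ideal.gen)
    then have J: "pfaff b0 b1 b2 b3 ?N (jet b0 b1 b2 u)"
      using N sol by (intro jet_pfaff holo2_subset[OF U(2)]) auto
    \<comment> \<open>The coefficients are the components of the jet at \<open>p\<close>, because
      the fundamental solutions have unit vectors there.\<close>
    define c where "c k = jet b0 b1 b2 u k p" for k
    let ?Z = "\<lambda>i q. jet b0 b1 b2 u i q - (\<Sum>k<6. c k * W k i q)"
    have Z: "pfaff b0 b1 b2 b3 ?N ?Z"
    proof (rule pfaff_diff[OF J pfaff_lincomb[OF N(1)]])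
      show "pfaff b0 b1 b2 b3 ?N (W k)" if "k < 6" for k
        by (rule pfaff_subset[OF W0[OF that] N(1)]) auto
    qed
    have "\<forall>\<^sub>F q in nhds p. \<forall>i<6. ?Z i q = 0"
    proof (rule pfaffian_unique[where W = ?Z and n = 6 and ?M1.0 = "\<lambda>i j. ent1 (mat1 b0 b1 b2 b3 ! i ! j)" and ?M2.0 = "\<lambda>i j. ent2 (mat2 b0 b1 b2 b3 ! i ! j)", OF N(1,2)])
      show "?Z i p = 0" if "i < 6" for i using comb[OF that] by (simp add: c_def)
      show "holomorphic2_on (ent1 (mat1 b0 b1 b2 b3 ! i ! j)) ?N" "holomorphic2_on (ent2 (mat2 b0 b1 b2 b3 ! i ! j)) ?N" for i j
        by (rule holo2_subset[OF holo2_ent(1) N(1,3)] holo2_subset[OF holo2_ent(2) N(1,3)])+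
    qed (use Z in \<open>auto simp: pfaff_def\<close>)
    then have "\<forall>\<^sub>F q in nhds p. u q = (\<Sum>k<6. c k * W k 0 q)"
      by eventually_elim (auto simp: jet_def dest!: spec[of _ 0])
    then show "\<exists>c. \<forall>\<^sub>F q in nhds p. u q = (\<Sum>k<6. c k * W k 0 q)" by blast
  qed
qed

lemma has_rank_Z2: "has_rank (Z2 A0 A1 A2 A3) 6"
proof -
  let ?g = "(1 - t1\<^sup>2) * (1 - t2\<^sup>2) * (t1 - t2)"
  have "eval2 ?g (0, 2) \<noteq> 0" by simp
  then have "?g \<noteq> 0" by (metis eval2_simps(6))
  moreover have "solution_dim (Z2 A0 A1 A2 A3) p 6" if "eval2 ?g p \<noteq> 0" for p
    using that by (intro solution_dim_Z2) (auto simp: regular_def)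
  ultimately show ?thesis unfolding has_rank_def by blast
qed

section \<open>Regularity of the pair of symbols\<close>

text \<open>
  \<open>peel p s\<close>: \<open>s\<close> is a nonzerodivisor modulo \<open>p\<close>.  Since this is stable under products
  in \<open>p\<close>, the second symbol can be treated factor by factor.
\<close>

definition peel :: "'a :: comm_ring_1 \<Rightarrow> 'a \<Rightarrow> bool" where
  "peel p s \<longleftrightarrow> (\<forall>b c. s * c = p * b \<longrightarrow> p dvd c)"

lemma peel_unit: "p dvd 1 \<Longrightarrow> peel p s"
  unfolding peel_def by (metis dvd_trans one_dvd)

lemma peel_mult:
  fixes p q s :: "'a :: idom"
  assumes "peel p s" "peel q s" "p \<noteq> 0"
  shows "peel (p * q) s"
  unfolding peel_def
proof (intro allI impI)
  fix b c assume eq: "s * c = p * q * b"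
  then obtain c' where c: "c = p * c'" using assms(1) unfolding peel_def by (metis dvdE mult.assoc)
  then have "p * (s * c') = p * (q * b)" using eq by (simp add: mult_ac)
  then have "q dvd c'" using assms(2,3) by (auto simp: peel_def)
  then show "p * q dvd c" by (simp add: c)
qed

lemma peel_prime: "prime_elem p \<Longrightarrow> \<not> p dvd s \<Longrightarrow> peel p s"
  unfolding peel_def by (metis dvd_triv_left prime_elem_dvd_mult_iff)

lemma peel_const:
  fixes l :: "'a :: idom"
  assumes "prime_elem l" "\<not> l dvd coeff s j"
  shows "peel [:l:] s"
  using assms by (intro peel_prime) (auto simp: prime_elem_const_poly_iff const_poly_dvd_iff)

lemma eval2_dvd: "l dvd p \<Longrightarrow> eval2 l q = 0 \<Longrightarrow> eval2 p q = 0"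
  by (elim dvdE) simp

lemma prime_elem_minus: "prime_elem p \<Longrightarrow> prime_elem (- p)" for p :: "'a :: comm_ring_1"
  by (simp add: prime_elem_def)

text \<open>Divisibility by a monic linear polynomial is vanishing at its root, and evaluation is a
  homomorphism into a domain.\<close>

lemma prime_elem_monic_linear: "prime_elem [:a, 1:]" for a :: "'a :: idom"
proof -
  have "[:a, 1:] dvd p \<longleftrightarrow> poly p (- a) = 0" for p :: "'a poly"
    using poly_eq_0_iff_dvd[of p "- a"] by simp
  then show ?thesis by (simp add: prime_elem_def)
qed

text \<open>Modulo \<open>1 - c y\<close> the element \<open>c\<close> is invertible, hence every polynomial is a constant up to a power of \<open>c\<close>.\<close>

lemma prime_elem_hyperbola:
  fixes c :: "'a :: idom"
  assumes "c \<noteq> 0"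
  shows "prime_elem [:1, - c:]"
  unfolding prime_elem_def
proof (intro conjI allI impI)
  let ?h = "[:1, - c:]"
  show "?h \<noteq> 0" by simp
  have const: "d = 0" if "?h dvd [:d:]" for d
    using that assms dvd_imp_degree_le[of ?h "[:d:]"] by (cases "d = 0") auto
  then show "\<not> ?h dvd 1" by (metis one_neq_zero one_pCons)
  have unit: "?h dvd p" if "?h dvd smult (c ^ n) p" for n p
    using that
  proof (induction n)
    case (Suc n)
    have "smult (c ^ n) p = ?h * smult (c ^ n) p + [:0, 1:] * smult (c ^ Suc n) p"
      by (simp add: algebra_simps)
    then have "?h dvd smult (c ^ n) p" using Suc.prems by (metis dvd_add dvd_mult dvd_triv_left)
    then show ?case by (rule Suc.IH)
  qed simp
  have red: "\<exists>n d. ?h dvd smult (c ^ n) p - [:d:]" for p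
  proof (induction p)
    case 0
    show ?case by (rule exI[of _ 0], rule exI[of _ 0]) simp
  next
    case (pCons a p)
    then obtain n d where d: "?h dvd smult (c ^ n) p - [:d:]" by blast
    have "smult (c ^ Suc n) (pCons a p) - [:c ^ Suc n * a + d:] =
        (smult (c ^ n) p - [:d:]) - ?h * smult (c ^ n) p"
      by (simp add: algebra_simps)
    then have "?h dvd smult (c ^ Suc n) (pCons a p) - [:c ^ Suc n * a + d:]"
      using d by (metis dvd_diff dvd_triv_left)
    then show ?case by blast
  qed
  fix p q assume pq: "?h dvd p * q"
  obtain n d m e where d: "?h dvd smult (c ^ n) p - [:d:]" and e: "?h dvd smult (c ^ m) q - [:e:]"
    using red by metis
  have "[:d * e:] = smult (c ^ (n + m)) (p * q) - smult (c ^ n) p * (smult (c ^ m) q - [:e:])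
      - [:e:] * (smult (c ^ n) p - [:d:])"
    by (simp add: algebra_simps power_add)
  moreover have "?h dvd smult (c ^ (n + m)) (p * q)" using pq by (rule dvd_smult)
  ultimately have "?h dvd [:d * e:]" using d e by (metis dvd_diff dvd_mult)
  then have "d = 0 \<or> e = 0" using const[of "d * e"] by simp
  then show "?h dvd p \<or> ?h dvd q" using d e unit by auto
qed

text \<open>The gap is \<open>t1 - t2\<close>, \<open>t1 t2 - 1\<close>, \<open>1 - t1 t2\<close> or
  \<open>t2 - t1\<close>, depending on the chart; the other entries are coordinates and factors of
  the discriminant in \<open>t1\<close>.\<close>

lemma prime_elems:
  "prime_elem t1" "prime_elem t2" "prime_elem (t1 - 1)" "prime_elem (t1 + 1)"
  "prime_elem (t1 - t2)" "prime_elem (t2 - t1)" "prime_elem (1 - t1 * t2)" "prime_elem (t1 * t2 - 1)"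
proof -
  have "prime_elem [:[:a, 1:]:]" for a :: complex
    by (simp add: prime_elem_const_poly_iff prime_elem_monic_linear)
  from this[of 0] this[of "- 1"] this[of 1]
  show "prime_elem t1" "prime_elem (t1 - 1)" "prime_elem (t1 + 1)"
    by (simp_all add: t1_def one_pCons)
  show "prime_elem t2" and t: "prime_elem (t2 - t1)"
    using prime_elem_monic_linear[of 0] prime_elem_monic_linear[of "- [:0, 1 :: complex:]"] by (simp_all add: t1_def t2_def)
  show h: "prime_elem (1 - t1 * t2)"
    using prime_elem_hyperbola[of "[:0, 1 :: complex:]"] by (simp add: t1_def t2_def one_pCons)
  show "prime_elem (t1 - t2)" "prime_elem (t1 * t2 - 1)"
    using prime_elem_minus[OF t] prime_elem_minus[OF h] by simp_all
qed

abbreviation disc :: "bool \<Rightarrow> poly2 \<Rightarrow> poly2" where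
  "disc e t \<equiv> (cm e t)\<^sup>2 - (cn e t)\<^sup>2"

lemma psymb_C1: "psymb 2 (C1 e1 e2 b0 b3) = [:lead e1 t1, mixed e1 e2 * cm e1 t1 * cm e2 t2, lead e2 t2:]"
  by (intro poly_eqI) (auto simp: coeff_psymb coeff_pCons C1_def lookup_add lookup_dop numeral_2_eq_2 split: nat.splits)

text \<open>With the discriminants \<open>d\<^sub>i\<close>, the homogeneous symbol is \<open>2 gap
  m\<^sub>1\<^sup>2 m\<^sub>2\<^sup>2 \<xi>\<^sub>1 \<xi>\<^sub>2 (s\<^sub>2 d\<^sub>1 \<xi>\<^sub>1
  + s\<^sub>1 d\<^sub>2 \<xi>\<^sub>2)\<close>; setting \<open>\<xi>\<^sub>1 = 1\<close> hides the
  factor \<open>\<xi>\<^sub>1\<close>. The nesting lets \<open>peel_mult\<close> split off one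
  factor at a time.\<close>

lemma psymb_C2:
  "psymb 3 (C2 e1 e2 b0 b1 b2) = [:2:] * ([:gap e1 e2:] * ([:cm e1 t1:] * ([:cm e1 t1:] * ([:cm e2 t2:] * ([:cm e2 t2:] *
    ([:0, 1:] * [:cs e2 * disc e1 t1, cs e1 * disc e2 t2:]))))))"
  by (intro poly_eqI) (auto simp: coeff_psymb coeff_pCons C2_def lookup_add lookup_minus lookup_dop eval_nat_numeral lead_def
      algebra_simps split: nat.splits)

text \<open>
  That a prime factor of the second symbol does not divide the first symbol shows at a zero of
  that factor.  The linear factor \<open>L\<close> need not be prime; it is eliminated by the identity
  \<open>d\<^sub>2 s\<^sub>1 = L S - d\<^sub>1 g\<^sup>2\<close> with \<open>g\<close> the gap and \<open>d\<^sub>i\<close> the discriminants.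
\<close>

lemma regular_symbols:
  assumes "a * psymb 2 (C1 e1 e2 b0 b3) + b * psymb 3 (C2 e1 e2 b0 b1 b2) = 0"
  shows "\<exists>t. a = t * psymb 3 (C2 e1 e2 b0 b1 b2) \<and> b = - (t * psymb 2 (C1 e1 e2 b0 b3))"
proof -
  let ?s1 = "psymb 2 (C1 e1 e2 b0 b3)" and ?s2 = "psymb 3 (C2 e1 e2 b0 b1 b2)"
  let ?L = "[:cs e2 * disc e1 t1, cs e1 * disc e2 t2:]"
  have c2: "coeff ?s1 2 = lead e2 t2" and c0: "coeff ?s1 0 = lead e1 t1"
    unfolding psymb_C1 by (simp_all add: coeff_pCons numeral_2_eq_2)
  have unit: "[:2 :: poly2:] dvd 1"
    by (rule dvdI[of _ _ "[:cst (1 / 2):]"]) (simp add: cst_def numeral_poly one_pCons)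
  have ndvd: "\<not> l dvd p" if "eval2 l q = 0" "eval2 p q \<noteq> 0" for l p q
    using that eval2_dvd by blast
  have gap: "prime_elem (gap e1 e2)"
    using prime_elems by (cases e1; cases e2) (auto simp: chart_data mult.commute[of t2 t1])
  \<comment> \<open>The point \<open>(2, 2)\<close> lies on \<open>t1 = t2\<close> and
    \<open>(1 / 2, 2)\<close> on \<open>t1 t2 = 1\<close>, the two shapes of the gap, while the
    coefficients in \<open>t2\<close> do not vanish at 2.\<close>
  have gap_s1: "\<not> gap e1 e2 dvd lead e2 t2" and gap_L: "\<not> gap e1 e2 dvd cs e1 * disc e2 t2"
    using ndvd[of "gap e1 e2" "(if e1 = e2 then 2 else 1 / 2, 2)" "lead e2 t2"]
      ndvd[of "gap e1 e2" "(if e1 = e2 then 2 else 1 / 2, 2)" "cs e1 * disc e2 t2"]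
    by (cases e1; cases e2; simp add: chart_data)+
  have cm1: "peel [:cm e1 t1:] ?s1"
  proof (cases e1)
    case True
    have "peel [:t1:] ?s1"
      by (rule peel_const[OF prime_elems(1), of _ 2], unfold c2, rule ndvd[of _ "(0, 2)"]) (auto simp: chart_data)
    then show ?thesis using True by (simp add: cm_def)
  qed (simp add: cm_def peel_unit flip: one_pCons)
  have cm2: "peel [:cm e2 t2:] ?s1"
  proof (cases e2)
    case True
    have "peel [:t2:] ?s1"
      by (rule peel_const[OF prime_elems(2), of _ 0], unfold c0, rule ndvd[of _ "(2, 0)"]) (auto simp: chart_data)
    then show ?thesis using True by (simp add: cm_def)
  qed (simp add: cm_def peel_unit flip: one_pCons)
  have z: "peel [:0, 1:] ?s1"
  proof (rule peel_prime)
    show "prime_elem [:0, 1 :: poly2:]" by (rule prime_elem_monic_linear)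
    have "eval2 (lead e1 t1) (2, 0) \<noteq> 0" by (simp add: chart_data)
    then have "lead e1 t1 \<noteq> 0" by (metis eval2_simps(6))
    then show "\<not> [:0, 1:] dvd ?s1"
      using poly_eq_0_iff_dvd[of ?s1 0] by (simp add: psymb_C1)
  qed
  have L: "peel ?L ?s1"
    unfolding peel_def
  proof (intro allI impI)
    fix b c assume eq: "?s1 * c = ?L * b"
    let ?S = "[:mixed e1 e2 * cs e1 * cm e1 t1 * cm e2 t2 - cs e2 * (cm e2 t2)\<^sup>2 * disc e1 t1, cs e1 * (cm e2 t2)\<^sup>2 * disc e2 t2:]"
    let ?R = "[:disc e1 t1:] * ([:gap e1 e2:] * [:gap e1 e2:])"
    have id: "[:disc e2 t2:] * ?s1 = ?L * ?S - ?R"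
    proof -
      have m: "[:p:] * [:a, b, c:] = [:p * a, p * b, p * c:]" "[:a, b:] * [:c, d:] = [:a * c, a * d + b * c, b * d:]"
        "[:a:] * ([:b:] * [:c:]) = [:a * (b * c):]" "[:a, b, c:] - [:d:] = [:a - d, b, c:]" for p a b c d :: poly2
        by (simp_all add: algebra_simps)
      have "disc e2 t2 * lead e1 t1 = cs e2 * disc e1 t1 * (mixed e1 e2 * cs e1 * cm e1 t1 * cm e2 t2 - cs e2 * (cm e2 t2)\<^sup>2 * disc e1 t1)
          - disc e1 t1 * (gap e1 e2 * gap e1 e2)"
        "disc e2 t2 * (mixed e1 e2 * cm e1 t1 * cm e2 t2) = cs e2 * disc e1 t1 * (cs e1 * (cm e2 t2)\<^sup>2 * disc e2 t2)
          + cs e1 * disc e2 t2 * (mixed e1 e2 * cs e1 * cm e1 t1 * cm e2 t2 - cs e2 * (cm e2 t2)\<^sup>2 * disc e1 t1)"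
        "disc e2 t2 * lead e2 t2 = cs e1 * disc e2 t2 * (cs e1 * (cm e2 t2)\<^sup>2 * disc e2 t2)"
        by (cases e1 rule: bool.exhaust; cases e2 rule: bool.exhaust; hypsubst;
          simp only: chart_data if_True if_False one_clean; algebra)+
      then show ?thesis unfolding psymb_C1 m by simp
    qed
    \<comment> \<open>Divisibility by \<open>?L\<close> is traded for divisibility by
      \<open>?R\<close>, whose factors are primes or units: inserting the identity gives
      \<open>L (S c - d\<^sub>2 b) = R c\<close>. Once \<open>R\<close> is known to divide the
      bracket, cancelling it exhibits \<open>c\<close> as a multiple of \<open>L\<close>.\<close>
    have "?L * ([:disc e2 t2:] * b) = ([:disc e2 t2:] * ?s1) * c"
      by (simp only: mult.assoc eq) (simp only: mult_ac)
    then have "?L * (?S * c - [:disc e2 t2:] * b) = ?R * c"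
      unfolding id by (simp only: algebra_simps)
    moreover have "peel ?R ?L"
    proof -
      have g: "peel [:gap e1 e2:] ?L"
        by (rule peel_const[OF gap, of _ 1]) (use gap_L in simp)
      have t: "peel [:t1 - 1:] ?L" "peel [:t1 + 1:] ?L"
        using ndvd[of "t1 - 1" "(1, 0)" "cs e1 * disc e2 t2"] ndvd[of "t1 + 1" "(- 1, 0)" "cs e1 * disc e2 t2"]
        by (intro peel_const[of _ _ 1] prime_elems; simp add: chart_data)+
      have m: "peel [:- 1 :: poly2:] ?L" by (rule peel_unit, rule dvdI[of _ _ "[:- 1:]"]) (simp add: one_pCons)
      have n: "[:t1 - 1:] \<noteq> 0" "[:t1 + 1:] \<noteq> 0" "[:- 1 :: poly2:] \<noteq> 0"
        using prime_elems(3,4) by (auto simp: prime_elem_def)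
      have d: "[:disc e1 t1:] = (if e1 then [:t1 - 1:] * [:t1 + 1:] else [:- 1:] * ([:t1 - 1:] * [:t1 + 1:]))"
        by (simp add: chart_data power2_eq_square algebra_simps)
      have "peel [:disc e1 t1:] ?L"
        unfolding d by (simp only: split: if_split) (intro conjI impI peel_mult t m n)
      moreover have "[:disc e1 t1:] \<noteq> 0"
        unfolding d using n by (simp only: mult_eq_0_iff split: if_split) blast
      moreover have "[:gap e1 e2:] \<noteq> 0" using gap by (auto simp: prime_elem_def)
      ultimately show ?thesis by (intro peel_mult g)
    qed
    ultimately have "?R dvd ?S * c - [:disc e2 t2:] * b" by (simp only: peel_def)
    then obtain d where d: "?S * c - [:disc e2 t2:] * b = ?R * d" ..
    have "?R \<noteq> 0"
    proof -
      have "eval2 (disc e1 t1) (2, 0) \<noteq> 0" by (simp add: chart_data)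
      then have "disc e1 t1 \<noteq> 0" by (metis eval2_simps(6))
      then show ?thesis using gap by (auto simp: prime_elem_def)
    qed
    moreover have "?R * (?L * d) = ?R * c"
      using \<open>?L * (?S * c - [:disc e2 t2:] * b) = ?R * c\<close> unfolding d by (simp only: mult_ac)
    ultimately have "?L * d = c" by (simp only: mult_cancel_left) simp
    then show "?L dvd c" by (metis dvd_triv_left)
  qed
  have gs: "peel [:gap e1 e2:] ?s1"
    by (rule peel_const[OF gap, of _ 2]) (use gap_s1 c2 in simp)
  have nz: "[:2 :: poly2:] \<noteq> 0" "[:gap e1 e2:] \<noteq> 0" "[:cm e1 t1:] \<noteq> 0" "[:cm e2 t2:] \<noteq> 0" "[:0, 1 :: poly2:] \<noteq> 0"
    using gap prime_elems(1,2) by (auto simp: prime_elem_def cm_def)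
  have p: "peel ?s2 ?s1"
    unfolding psymb_C2 using unit gs cm1 cm2 z L nz by (intro peel_mult peel_unit[OF unit])
  have "?L \<noteq> 0"
  proof -
    have "eval2 (cs e1 * disc e2 t2) (0, 2) \<noteq> 0" by (simp add: chart_data)
    then have "cs e1 * disc e2 t2 \<noteq> 0" by (metis eval2_simps(6))
    then show ?thesis by simp
  qed
  then have s2: "?s2 \<noteq> 0" unfolding psymb_C2 using nz by (simp only: mult_eq_0_iff) simp
  have "?s1 * a = ?s2 * (- b)" using assms by (simp add: mult.commute eq_neg_iff_add_eq_0)
  then have "?s2 dvd a" using p unfolding peel_def by blast
  then obtain t where t: "a = ?s2 * t" ..
  then have "?s2 * (t * ?s1 + b) = 0" using assms by (simp add: algebra_simps)
  then have "b = - (t * ?s1)" using s2 by (simp add: eq_neg_iff_add_eq_0 add.commute)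
  then show ?thesis using t by (metis mult.commute)
qed

lemma degree_psymb_C1: "degree (psymb 2 (C1 e1 e2 b0 b3)) = 2"
proof -
  have "eval2 (lead e2 t2) (0, 2) \<noteq> 0" by (simp add: chart_data)
  then have "lead e2 t2 \<noteq> 0" by (metis eval2_simps(6))
  then show ?thesis by (simp add: psymb_C1)
qed

section \<open>Removing the common monomial factor of the second generator\<close>

lemma fmult_cancel:
  assumes "fmult f P = fmult f Q" "f \<noteq> 0"
  shows "P = Q"
proof (rule poly_mapping_eqI)
  fix k show "lookup P k = lookup Q k"
    using arg_cong[OF assms(1), of "\<lambda>P. lookup P k"] assms(2) by simp
qed

text \<open>From \<open>[P, f S] = [P, f] S + f [P, S]\<close> the new factor is formally
  \<open>f^{-1} (C f - [P, f])\<close>. The assumption on \<open>C'\<close> states this without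
  division, and \<open>f\<close> is cancelled on the left at the end.\<close>

lemma reduce_commutator:
  assumes Q: "Q = fmult f S" and comm: "act P Q - act Q P = act C Q"
    and f: "act C (dop f 0 0) - (act P (dop f 0 0) - fmult f P) = fmult f C'" "f \<noteq> 0"
  shows "act P S - act S P = act C' S"
proof (rule fmult_cancel[OF _ f(2)])
  have S: "act (dop f 0 0) S = Q" by (simp add: act_dop Q)
  have "fmult f (act C' S) = act (act C (dop f 0 0) - (act P (dop f 0 0) - fmult f P)) S"
    by (simp only: f(1) act_fmult)
  also have "\<dots> = act C Q - act P Q + fmult f (act P S)"
    by (simp only: act_diff(1) act_fmult act_assoc S) simp
  also have "\<dots> = fmult f (act P S) - act Q P"
    by (simp flip: comm)
  finally show "fmult f (act P S - act S P) = fmult f (act C' S)"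
    by (simp add: fmult_diff Q act_fmult)
qed

lemma dop_0 [simp]: "dop 0 i j = 0"
  by (simp add: dop_def)

text \<open>Dividing the second generator by a coordinate just switches off the exponent of that
  coordinate in \<open>CM\<close>, so the commutator keeps its shape and its order bound.\<close>

lemma monomial_commutator:
  assumes "\<alpha> \<longrightarrow> e1" "\<beta> \<longrightarrow> e2"
  defines "f \<equiv> (if \<alpha> then t1 else 1) * (if \<beta> then t2 else 1)"
  shows "act (CM e1 e2 b0 e1 e2) (dop f 0 0) - (act (C1 e1 e2 b0 b3) (dop f 0 0) - fmult f (C1 e1 e2 b0 b3))
    = fmult f (CM e1 e2 b0 (e1 \<and> \<not> \<alpha>) (e2 \<and> \<not> \<beta>))"
proof (rule diffop_eqI)
  fix i j
  have pd: "pd1 (pd1 f) = 0" "pd2 (pd2 f) = 0"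
    unfolding f_def by (cases \<alpha>; cases \<beta>; simp add: pd_simps)+
  have lk: "lookup (dop c a b) (i, j) = (if i = a \<and> j = b then c else 0)" for c a b
    by (simp add: lookup_dop)
  show "lookup (act (CM e1 e2 b0 e1 e2) (dop f 0 0) - (act (C1 e1 e2 b0 b3) (dop f 0 0) - fmult f (C1 e1 e2 b0 b3))) (i, j)
    = lookup (fmult f (CM e1 e2 b0 (e1 \<and> \<not> \<alpha>) (e2 \<and> \<not> \<beta>))) (i, j)"
    using assms(1,2) unfolding act_CM act_C1
    unfolding C1_def CM_def dmult_dop dmult1_add dmult2_add pd lookup_add lookup_minus lookup_fmult lk
    by (cases e1; cases e2; cases \<alpha>; cases \<beta>)
      (simp_all add: f_def chart_data pd_simps algebra_simps power2_eq_square flip: numeral_2_eq_2)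
qed

lemma diffop_divide:
  assumes "\<And>k. f dvd lookup P k" "f \<noteq> 0"
  shows "\<exists>S. P = fmult f S"
proof
  show "P = fmult f (Poly_Mapping.map (\<lambda>c. c div f) P)"
    using assms by (intro poly_mapping_eqI) (simp add: map.rep_eq when_def)
qed

text \<open>Only a single \<open>t\<close> has to be cancelled on the left. Either it divides all
  coefficients of \<open>R\<close> and is split off, or some coefficient is prime to it and then
  \<open>t ^ k\<close> must contain the factor. The cofactor \<open>h\<close> leaves room for the
  power of the other coordinate.\<close>

lemma remove_prime:
  assumes t: "prime_elem t"
  obtains \<alpha> R' where "\<alpha> \<longrightarrow> e" "R = fmult (if \<alpha> then t else 1) R'"
    "\<And>Q k h. \<not> t dvd h \<Longrightarrow> fmult (cm e t) Q = fmult (t ^ k * h) R \<Longrightarrow> \<exists>k'. Q = fmult (t ^ k' * h) R'"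
proof (cases "e \<and> (\<forall>k. t dvd lookup R k)")
  case True
  have t0: "t \<noteq> 0" using t by auto
  then obtain R' where R': "R = fmult t R'" using True diffop_divide by blast
  show ?thesis
  proof (rule that[of True R'])
    fix Q k h assume "fmult (cm e t) Q = fmult (t ^ k * h) R"
    then have "fmult t Q = fmult t (fmult (t ^ k * h) R')"
      using True by (simp add: cm_def R' fmult_fmult mult_ac)
    then show "\<exists>k'. Q = fmult (t ^ k' * h) R'" using fmult_cancel t0 by blast
  qed (use True R' in auto)
next
  case False
  show ?thesis
  proof (rule that[of False R])
    fix Q k h assume h: "\<not> t dvd h" and eq: "fmult (cm e t) Q = fmult (t ^ k * h) R"
    show "\<exists>k'. Q = fmult (t ^ k' * h) R"
    proof (cases e)
      case True
      then obtain m where m: "\<not> t dvd lookup R m" using False by blast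
      have "t * lookup Q m = t ^ k * h * lookup R m"
        using arg_cong[OF eq, of "\<lambda>P. lookup P m"] True by (simp add: cm_def)
      then have "t dvd t ^ k * h * lookup R m" by (metis dvd_triv_left)
      then have "k \<noteq> 0" using h m t by (cases k) (auto simp: prime_elem_dvd_mult_iff)
      then obtain k' where "k = Suc k'" using not0_implies_Suc by blast
      then have "fmult t Q = fmult t (fmult (t ^ k' * h) R)"
        using True eq by (simp add: cm_def fmult_fmult mult_ac)
      then show ?thesis using fmult_cancel t by (metis prime_elem_not_zeroI)
    next
      case False
      then show ?thesis using eq by (auto simp: cm_def)
    qed
  qed auto
qed

text \<open>
  In a chart at infinity the second generator with least exponents is \<open>C2\<close> divided by a monomial;
  which monomial that is depends on the parameters.
\<close>

lemma remove_monomial: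
  obtains \<alpha> \<beta> S where "\<alpha> \<longrightarrow> e1" "\<beta> \<longrightarrow> e2" "R = fmult ((if \<alpha> then t1 else 1) * (if \<beta> then t2 else 1)) S"
    "\<And>Q k l. fmult (cm e1 t1 * cm e2 t2) Q = fmult (t1 ^ k * t2 ^ l) R \<Longrightarrow> \<exists>g. Q = fmult g S"
proof -
  obtain \<alpha> R' where \<alpha>: "\<alpha> \<longrightarrow> e1" "R = fmult (if \<alpha> then t1 else 1) R'"
    "\<And>Q k h. \<not> t1 dvd h \<Longrightarrow> fmult (cm e1 t1) Q = fmult (t1 ^ k * h) R \<Longrightarrow> \<exists>k'. Q = fmult (t1 ^ k' * h) R'"
    using remove_prime[OF prime_elems(1), of e1 R] by blast
  obtain \<beta> S where \<beta>: "\<beta> \<longrightarrow> e2" "R' = fmult (if \<beta> then t2 else 1) S"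
    "\<And>Q k h. \<not> t2 dvd h \<Longrightarrow> fmult (cm e2 t2) Q = fmult (t2 ^ k * h) R' \<Longrightarrow> \<exists>k'. Q = fmult (t2 ^ k' * h) S"
    using remove_prime[OF prime_elems(2), of e2 R'] by blast
  have nd: "\<not> t1 dvd t2 ^ l" "\<not> t2 dvd t1 ^ l" for l
    using eval2_dvd[of t1 "t2 ^ l" "(0, 1)"] eval2_dvd[of t2 "t1 ^ l" "(1, 0)"] by auto
  show ?thesis
  proof (rule that[OF \<alpha>(1) \<beta>(1)])
    show "R = fmult ((if \<alpha> then t1 else 1) * (if \<beta> then t2 else 1)) S"
      using \<alpha>(2) \<beta>(2) by (simp only: fmult_fmult)
    fix Q k l assume "fmult (cm e1 t1 * cm e2 t2) Q = fmult (t1 ^ k * t2 ^ l) R"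
    then obtain k' where "fmult (cm e2 t2) Q = fmult (t2 ^ l * t1 ^ k') R'"
      using \<alpha>(3)[of "t2 ^ l" "fmult (cm e2 t2) Q" k] nd by (auto simp: fmult_fmult mult.commute)
    then show "\<exists>g. Q = fmult g S" using \<beta>(3) nd by blast
  qed
qed

section \<open>Faithfulness of the action on functions\<close>

lemma eval2_eq_0I:
  assumes "\<And>x y. x \<noteq> 0 \<Longrightarrow> y \<noteq> 0 \<Longrightarrow> eval2 p (x, y) = 0"
  shows "p = 0"
proof -
  have inf: "infinite (UNIV - {0 :: complex})"
    by (simp add: infinite_UNIV_char_0)
  have "poly p [:y:] = 0" if "y \<noteq> 0" for y
  proof (rule ccontr)
    assume "poly p [:y:] \<noteq> 0"
    then have "finite {x. poly (poly p [:y:]) x = 0}" by (rule poly_roots_finite)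
    moreover have "UNIV - {0} \<subseteq> {x. poly (poly p [:y:]) x = 0}"
      using assms that by (auto simp: eval2_def)
    ultimately show False using inf finite_subset by blast
  qed
  then have "(\<lambda>y. [:y:]) ` (UNIV - {0}) \<subseteq> {z. poly p z = 0}" by auto
  moreover have "infinite ((\<lambda>y. [:y:]) ` (UNIV - {0 :: complex}))"
    using inf finite_imageD by (metis (no_types, lifting) inj_onI pCons_eq_iff)
  ultimately show ?thesis using poly_roots_finite finite_subset by blast
qed

lemma dapp_power:
  "dapp i j (\<lambda>q. (fst q - x) ^ a * (snd q - y) ^ b) (x, y) = (if i = a \<and> j = b then fact a * fact b else 0)"
proof -
  let ?f = "\<lambda>i a c w. (deriv ^^ i) (\<lambda>w. (w - c) ^ a) w :: complex"
  have hd: "?f i a c w = pochhammer (of_nat (Suc a - i)) i * (w - c) ^ (a - i)" for i a c w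
    by (rule higher_deriv_power)
  have diff: "?f i a c field_differentiable at w" for i a c w
    unfolding hd[abs_def] by (intro derivative_intros)
  have D2: "(D2 ^^ j) (\<lambda>q. (fst q - x) ^ a * (snd q - y) ^ b) = (\<lambda>q. (fst q - x) ^ a * ?f j b y (snd q))"
    by (induction j) (auto simp: D2_def fun_eq_iff deriv_cmult[OF diff])
  have "dapp i j (\<lambda>q. (fst q - x) ^ a * (snd q - y) ^ b) = (\<lambda>q. ?f i a x (fst q) * ?f j b y (snd q))"
    unfolding dapp_def D2
    by (induction i) (auto simp: D1_def fun_eq_iff deriv_cmult_right[OF diff])
  moreover have "?f i a c c = (if i = a then fact a else 0)" for i a c
    unfolding hd by (cases i a rule: linorder_cases) (auto simp: pochhammer_fact pochhammer_0_left)
  ultimately show ?thesis by simp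
qed

text \<open>Applied to a monomial centred at \<open>(x, y)\<close>, an operator returns
  \<open>a! b!\<close> times its coefficient there. Points off the axes suffice for polynomial
  coefficients, and the chart forms are specified only at such points.\<close>

lemma diffop_eq_applyI:
  assumes "\<And>v x y. holomorphic2_on v UNIV \<Longrightarrow> x \<noteq> 0 \<Longrightarrow> y \<noteq> 0 \<Longrightarrow> dop_apply P v (x, y) = dop_apply Q v (x, y)"
  shows "P = Q"
proof (rule diffop_eqI)
  fix a b
  let ?R = "P - Q"
  have "lookup ?R (a, b) = 0"
  proof (rule eval2_eq_0I)
    fix x y :: complex assume xy: "x \<noteq> 0" "y \<noteq> 0"
    let ?v = "\<lambda>q. (fst q - x) ^ a * (snd q - y) ^ b"
    have "holomorphic2_on ?v UNIV"
      by (intro holo2_arith(3) holo2_power holo2_arith(2) holo2_basic) auto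
    then have "dop_apply ?R ?v (x, y) = 0" using assms xy by (simp add: dop_apply_diff)
    moreover have "dop_apply ?R ?v (x, y) =
        (\<Sum>(i, j)\<in>insert (a, b) (Poly_Mapping.keys ?R). eval2 (lookup ?R (i, j)) (x, y) * dapp i j ?v (x, y))"
      by (rule dop_apply_superset) auto
    moreover have "\<dots> = (\<Sum>k\<in>insert (a, b) (Poly_Mapping.keys ?R).
        if k = (a, b) then eval2 (lookup ?R k) (x, y) * (fact a * fact b) else 0)"
      by (rule sum.cong) (auto simp: dapp_power split: if_splits)
    ultimately show "eval2 (lookup ?R (a, b)) (x, y) = 0"
      by (simp del: sum.insert)
  qed
  then show "lookup P (a, b) = lookup Q (a, b)" by (simp add: lookup_minus)
qed

section \<open>Change of charts\<close>

lemma chart_map_involution: "chart_map e1 e2 (chart_map e1 e2 q) = q"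
  by (cases q) (simp add: chart_map_def)

lemma chart_D:
  assumes w: "holomorphic2_on w UNIV" and xy: "x \<noteq> 0" "y \<noteq> 0"
    and f: "\<And>x y. x \<noteq> 0 \<Longrightarrow> y \<noteq> 0 \<Longrightarrow> f (chart_map e1 e2 (x, y)) = w (x, y)"
  shows "D1 f (chart_map e1 e2 (x, y)) = eval2 (cs e1 * (cm e1 t1)\<^sup>2) (x, y) * D1 w (x, y)"
    and "D2 f (chart_map e1 e2 (x, y)) = eval2 (cs e2 * (cm e2 t2)\<^sup>2) (x, y) * D2 w (x, y)"
proof -
  let ?c = "\<lambda>e z :: complex. if e then inverse z else z"
  have c: "(?c e has_field_derivative (if e then - (z\<^sup>2) else 1)) (at (?c e z))" if "z \<noteq> 0" for e z
    using that by (cases e) (auto intro!: derivative_eq_intros simp: power2_eq_square)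
  have ev: "\<forall>\<^sub>F z' in nhds (?c e z). z' \<noteq> 0" if "z \<noteq> 0" for e z
    using t1_space_nhds[of "?c e z" 0] that by auto
  note d = holo2_derivs[OF w, of x y, OF UNIV_I]
  have "((\<lambda>z. w (?c e1 z, y)) has_field_derivative D1 w (x, y) * (if e1 then - (x\<^sup>2) else 1)) (at (?c e1 x))"
    by (rule DERIV_chain2[where g = "?c e1", OF _ c[OF xy(1)]]) (use d(1) in \<open>auto split: if_splits\<close>)
  moreover have "\<forall>\<^sub>F z in nhds (?c e1 x). f (z, ?c e2 y) = w (?c e1 z, y)"
    using ev[OF xy(1), of e1]
  proof eventually_elim
    case (elim z)
    then show ?case using f[of "?c e1 z" y] xy by (auto simp: chart_map_def)
  qed
  ultimately show "D1 f (chart_map e1 e2 (x, y)) = eval2 (cs e1 * (cm e1 t1)\<^sup>2) (x, y) * D1 w (x, y)"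
    unfolding chart_map_def case_prod_conv by (subst D_eqI(1)) (auto simp: DERIV_cong_ev chart_data mult.commute)
  have "((\<lambda>z. w (x, ?c e2 z)) has_field_derivative D2 w (x, y) * (if e2 then - (y\<^sup>2) else 1)) (at (?c e2 y))"
    by (rule DERIV_chain2[where g = "?c e2", OF _ c[OF xy(2)]]) (use d(2) in \<open>auto split: if_splits\<close>)
  moreover have "\<forall>\<^sub>F z in nhds (?c e2 y). f (?c e1 x, z) = w (x, ?c e2 z)"
    using ev[OF xy(2), of e2]
  proof eventually_elim
    case (elim z)
    then show ?case using f[of x "?c e2 z"] xy by (auto simp: chart_map_def)
  qed
  ultimately show "D2 f (chart_map e1 e2 (x, y)) = eval2 (cs e2 * (cm e2 t2)\<^sup>2) (x, y) * D2 w (x, y)"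
    unfolding chart_map_def case_prod_conv by (subst D_eqI(2)) (auto simp: DERIV_cong_ev chart_data mult.commute)
qed

text \<open>Expresses a derivative in the original coordinates as an operator in the chart. The
  conclusion has the shape of the hypothesis, so iteration reduces the change of coordinates to
  arithmetic in the Weyl algebra.\<close>

lemma chart_dmult:
  assumes v: "holomorphic2_on v UNIV"
    and f: "\<forall>x y. x \<noteq> 0 \<and> y \<noteq> 0 \<longrightarrow> f (chart_map e1 e2 (x, y)) = dop_apply R v (x, y)"
  shows "\<forall>x y. x \<noteq> 0 \<and> y \<noteq> 0 \<longrightarrow>
      D1 f (chart_map e1 e2 (x, y)) = dop_apply (fmult (cs e1 * (cm e1 t1)\<^sup>2) (dmult1 R)) v (x, y)"
    and "\<forall>x y. x \<noteq> 0 \<and> y \<noteq> 0 \<longrightarrow>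
      D2 f (chart_map e1 e2 (x, y)) = dop_apply (fmult (cs e2 * (cm e2 t2)\<^sup>2) (dmult2 R)) v (x, y)"
  using chart_D[OF holo2_dop_apply[OF v], of _ _ f e1 e2 R] f dop_apply_dmult[OF v] by (simp_all add: dop_apply_fmult)

lemma dop_apply_chart:
  fixes a0 a1 a2 a3 :: complex and e1 e2 :: bool
  assumes v: "holomorphic2_on v UNIV" and xy: "x \<noteq> 0" "y \<noteq> 0"
  defines "u \<equiv> v \<circ> chart_map e1 e2"
  shows "dop_apply (C1 False False (cst a0) (cst a3)) u (chart_map e1 e2 (x, y))
      = dop_apply (C1 e1 e2 (cst a0) (cst a3)) v (x, y)" (is ?P1)
    and "eval2 (cm e1 t1 * cm e2 t2) (x, y) * dop_apply (C2 False False (cst a0) (cst a1) (cst a2)) u (chart_map e1 e2 (x, y))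
      = dop_apply (C2 e1 e2 (cst a0) (cst a1) (cst a2)) v (x, y)" (is ?P2)
proof -
  have u: "\<forall>x y. x \<noteq> 0 \<and> y \<noteq> 0 \<longrightarrow> u (chart_map e1 e2 (x, y)) = dop_apply (dop 1 0 0) v (x, y)"
    by (simp add: u_def chart_map_involution dop_apply_dop)
  note d = chart_dmult[OF v, where ?e1.0 = e1 and ?e2.0 = e2]
  note d1 = d[where f = u, OF u]
  note d11 = d[where f = "D1 u", OF d1(1)] and d12 = d[where f = "D2 u", OF d1(2)]
  note d112 = d[where f = "D1 (D2 u)", OF d12(1)] and d122 = d[where f = "D2 (D2 u)", OF d12(2)]
  note D = u[rule_format, OF conjI[OF xy]] d1[rule_format, OF conjI[OF xy]] d11[rule_format, OF conjI[OF xy]]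
    d12[rule_format, OF conjI[OF xy]] d112[rule_format, OF conjI[OF xy]] d122[rule_format, OF conjI[OF xy]]
  show ?P1
    unfolding dop_apply_C1 D using xy
    by (cases e1; cases e2) (simp_all add: chart_data chart_map_def dop_apply_add dop_apply_fmult dop_apply_dop dmult_dop
      dmult1_fmult dmult2_fmult dmult1_add dmult2_add fmult_add pd_simps pd_t_powers, simp_all add: field_simps eval_nat_numeral)
  show ?P2
    unfolding dop_apply_C2 D using xy
    by (cases e1; cases e2) (simp_all add: chart_data chart_map_def dop_apply_add dop_apply_fmult dop_apply_dop dmult_dop
      dmult1_fmult dmult2_fmult dmult1_add dmult2_add fmult_add pd_simps pd_t_powers, simp_all add: field_simps eval_nat_numeral)
qed

text \<open>The defining property of \<open>chart_form\<close> tests functions of the original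
  coordinates. As \<open>chart_map\<close> is an involution, it can be tested on
  \<open>v \<circ> chart_map\<close>, holomorphic off the axes, and so becomes a statement about
  arbitrary entire \<open>v\<close> in the chart.\<close>

lemma chart_form_apply:
  assumes "chart_form e1 e2 k l P Q" "holomorphic2_on v UNIV" "x \<noteq> 0" "y \<noteq> 0"
  shows "dop_apply Q v (x, y) = x ^ k * y ^ l * dop_apply P (v \<circ> chart_map e1 e2) (chart_map e1 e2 (x, y))"
proof -
  let ?U = "(- {0 :: complex}) \<times> (- {0 :: complex})"
  have U: "open ?U" by (intro open_Times open_Compl closed_singleton)
  have "holomorphic2_on (v \<circ> chart_map e1 e2) ?U"
    unfolding holo2_iff_sep sep_holo_def
  proof (intro conjI allI impI U)
    have "continuous_on ?U (chart_map e1 e2)"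
      unfolding chart_map_def split_def by (cases e1; cases e2) (auto intro!: continuous_intros)
    moreover have "continuous_on UNIV v" using holo2_continuous assms(2) .
    ultimately show "continuous_on ?U (v \<circ> chart_map e1 e2)"
      using continuous_on_compose continuous_on_subset by blast
    fix x y assume "(x, y) \<in> ?U"
    then have q: "x \<noteq> 0" "y \<noteq> 0" by auto
    let ?c = "\<lambda>e z :: complex. if e then inverse z else z"
    have c: "\<exists>d. (?c e has_field_derivative d) (at z)" if "z \<noteq> 0" for e z
      using that by (cases e) (auto intro!: exI derivative_eq_intros)
    note d = holo2_derivs[OF assms(2) UNIV_I]
    have "(\<lambda>z. v (?c e1 z, ?c e2 y)) field_differentiable at x" "(\<lambda>z. v (?c e1 x, ?c e2 z)) field_differentiable at y"
      unfolding field_differentiable_def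
      using c[OF q(1), of e1] c[OF q(2), of e2] DERIV_chain2[OF d(1), of "?c e1"] DERIV_chain2[OF d(2), of "?c e2"] by blast+
    then show "(\<lambda>z. (v \<circ> chart_map e1 e2) (z, y)) field_differentiable at x"
      "(\<lambda>z. (v \<circ> chart_map e1 e2) (x, z)) field_differentiable at y"
      by (simp_all add: chart_map_def)
  qed
  moreover have "(v \<circ> chart_map e1 e2) \<circ> chart_map e1 e2 = v"
    by (simp add: fun_eq_iff chart_map_involution)
  moreover have "chart_map e1 e2 (x, y) \<in> ?U" using assms(3,4) by (simp add: chart_map_def)
  ultimately show ?thesis using assms unfolding chart_form_def by metis
qed

lemma chart_form_C1:
  assumes "chart_form e1 e2 k l (C1 False False (cst a0) (cst a3)) Q"
  shows "Q = fmult (t1 ^ k * t2 ^ l) (C1 e1 e2 (cst a0) (cst a3))"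
  by (rule diffop_eq_applyI)
    (simp add: chart_form_apply[OF assms] dop_apply_chart(1) dop_apply_fmult)

text \<open>Because \<open>C2\<close> carries the clearing factor, \<open>Q\<close> is in general
  determined only up to division by it; this is the form that \<open>remove_monomial\<close> takes
  apart.\<close>

lemma chart_form_C2:
  assumes "chart_form e1 e2 k l (C2 False False (cst a0) (cst a1) (cst a2)) Q"
  shows "fmult (cm e1 t1 * cm e2 t2) Q = fmult (t1 ^ k * t2 ^ l) (C2 e1 e2 (cst a0) (cst a1) (cst a2))"
proof (rule diffop_eq_applyI)
  fix v and x y :: complex assume v: "holomorphic2_on v UNIV" "x \<noteq> 0" "y \<noteq> 0"
  show "dop_apply (fmult (cm e1 t1 * cm e2 t2) Q) v (x, y) =
    dop_apply (fmult (t1 ^ k * t2 ^ l) (C2 e1 e2 (cst a0) (cst a1) (cst a2))) v (x, y)"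
    unfolding dop_apply_fmult chart_form_apply[OF assms v] dop_apply_chart(2)[OF v, symmetric]
    by simp
qed

lemma chart_form_id: "chart_form False False 0 0 P P"
proof -
  have "chart_map False False = id" by (auto simp: chart_map_def)
  then show ?thesis by (simp add: chart_form_def)
qed

section \<open>The singular locus\<close>

lemma esymb_expand:
  "esymb q \<xi>1 \<xi>2 2 P = eval2 (lookup P (Suc (Suc 0), 0)) q * \<xi>1\<^sup>2
    + eval2 (lookup P (Suc 0, Suc 0)) q * \<xi>1 * \<xi>2 + eval2 (lookup P (0, Suc (Suc 0))) q * \<xi>2\<^sup>2"
  "esymb q \<xi>1 \<xi>2 3 P = eval2 (lookup P (Suc (Suc (Suc 0)), 0)) q * \<xi>1 ^ 3
    + eval2 (lookup P (Suc (Suc 0), Suc 0)) q * \<xi>1\<^sup>2 * \<xi>2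
    + eval2 (lookup P (Suc 0, Suc (Suc 0))) q * \<xi>1 * \<xi>2\<^sup>2
    + eval2 (lookup P (0, Suc (Suc (Suc 0)))) q * \<xi>2 ^ 3"
  by (simp_all add: esymb.symb_def eval_nat_numeral)

text \<open>The least generator \<open>S\<close> depends on the parameters, so its symbol is
  required to vanish for every factorization \<open>R = fmult f S\<close> with nonzero
  \<open>f\<close>. In the affine chart nothing is divided out, and \<open>f = 1\<close> may be
  assumed.\<close>

lemma char_variety_chart:
  fixes a0 a1 a2 a3 :: complex and e1 e2 :: bool
  defines "P \<equiv> C1 e1 e2 (cst a0) (cst a3)" and "R \<equiv> C2 e1 e2 (cst a0) (cst a1) (cst a2)"
  assumes P: "esymb q \<xi>1 \<xi>2 2 P = 0"
    and S: "\<And>f S. R = fmult f S \<Longrightarrow> f \<noteq> 0 \<Longrightarrow> (\<not> e1 \<Longrightarrow> \<not> e2 \<Longrightarrow> f = 1) \<Longrightarrow> esymb q \<xi>1 \<xi>2 3 S = 0"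
  shows "(q, (\<xi>1, \<xi>2)) \<in> char_variety (chart_system e1 e2
    {C1 False False (cst a0) (cst a3), C2 False False (cst a0) (cst a1) (cst a2)})"
proof -
  obtain \<alpha> \<beta> S where \<alpha>\<beta>: "\<alpha> \<longrightarrow> e1" "\<beta> \<longrightarrow> e2" and R: "R = fmult ((if \<alpha> then t1 else 1) * (if \<beta> then t2 else 1)) S"
    and gS: "\<And>Q k l. fmult (cm e1 t1 * cm e2 t2) Q = fmult (t1 ^ k * t2 ^ l) R \<Longrightarrow> \<exists>g. Q = fmult g S"
    using remove_monomial[of e1 e2 R] by metis
  define f where "f = (if \<alpha> then t1 else 1) * (if \<beta> then t2 else 1 :: poly2)"
  have R: "R = fmult f S" unfolding f_def by (rule R)
  have f: "f \<noteq> 0" using prime_elems(1,2) by (auto simp: f_def prime_elem_def)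
  have "ordb 4 R" unfolding R_def by (rule ordb_chart)
  then have "ordb 4 S" unfolding R using f by (simp add: ordb_def)
  then have ord: "ordb 3 P" "ordb 4 S" "ordb 2 (CM e1 e2 (cst a0) k l)" for k l
    unfolding P_def by (simp_all add: ordb_chart)
  have "act P R - act R P = act (CM e1 e2 (cst a0) e1 e2) R"
    unfolding P_def R_def by (rule commutator_chart) auto
  then have comm: "act P S - act S P = act (CM e1 e2 (cst a0) (e1 \<and> \<not> \<alpha>) (e2 \<and> \<not> \<beta>)) S"
    using monomial_commutator[OF \<alpha>\<beta>, of "cst a0" "cst a3"] f
    unfolding f_def P_def by (intro reduce_commutator[OF R[unfolded f_def]])
  \<comment> \<open>A syzygy for \<open>S\<close> becomes one for \<open>R\<close> after multiplying
    \<open>a\<close> and the relation by \<open>f\<close>; the factor is cancelled again from the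
    Koszul form.\<close>
  have reg: "\<exists>t. a = t * psymb 3 S \<and> b = - (t * psymb 2 P)" if eq: "a * psymb 2 P + b * psymb 3 S = 0" for a b
  proof -
    have R3: "psymb 3 R = [:f:] * psymb 3 S" by (simp only: R psymb.symb_fmult)
    have "([:f:] * a) * psymb 2 P + b * psymb 3 R = [:f:] * (a * psymb 2 P + b * psymb 3 S)"
      unfolding R3 by (simp only: distrib_left mult_ac)
    then have "([:f:] * a) * psymb 2 P + b * psymb 3 R = 0" by (simp only: eq mult_zero_right)
    then obtain t where t: "[:f:] * a = t * psymb 3 R" "b = - (t * psymb 2 P)"
      using regular_symbols unfolding P_def R_def by blast
    have "[:f:] * a = [:f:] * (t * psymb 3 S)" using t(1) unfolding R3 by (simp only: mult_ac)
    moreover have "[:f:] \<noteq> 0" using f by simp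
    ultimately have "a = t * psymb 3 S" by (simp only: mult_cancel_left) blast
    then show ?thesis using t(2) by blast
  qed
  show ?thesis
    unfolding chart_system_def
  proof (rule char_variety_koszul[OF ord comm reg])
    show "degree (psymb 2 P) = 2" unfolding P_def by (rule degree_psymb_C1)
    show "esymb q \<xi>1 \<xi>2 2 P = 0" by (rule P)
    show "esymb q \<xi>1 \<xi>2 3 S = 0"
    proof (rule S[OF R f])
      assume "\<not> e1" "\<not> e2"
      then show "f = 1" using \<alpha>\<beta> by (simp add: f_def)
    qed
    fix Q assume "Q \<in> {Q. \<exists>P\<in>{C1 False False (cst a0) (cst a3), C2 False False (cst a0) (cst a1) (cst a2)}.
        \<exists>k l. chart_form e1 e2 k l P Q}"
    then consider k l where "chart_form e1 e2 k l (C1 False False (cst a0) (cst a3)) Q"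
      | k l where "chart_form e1 e2 k l (C2 False False (cst a0) (cst a1) (cst a2)) Q" by blast
    then show "\<exists>A B. Q = act A P + act B S"
    proof cases
      case 1
      then have "Q = fmult (t1 ^ k * t2 ^ l) P" unfolding P_def by (rule chart_form_C1)
      then have "Q = act (dop (t1 ^ k * t2 ^ l) 0 0) P + act 0 S" by (simp add: act_dop)
      then show ?thesis by blast
    next
      case 2
      then obtain g where "Q = fmult g S" using gS chart_form_C2 unfolding R_def by blast
      then have "Q = act 0 P + act (dop g 0 0) S" by (simp add: act_dop)
      then show ?thesis by blast
    qed
  qed
qed

lemma regular_point:
  assumes xy: "x\<^sup>2 \<noteq> 1" "y\<^sup>2 \<noteq> 1" "x \<noteq> y"
    and \<xi>: "((x, y), (\<xi>1, \<xi>2)) \<in> char_variety (chart_system False False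
      {C1 False False (cst a0) (cst a3), C2 False False (cst a0) (cst a1) (cst a2)})"
  shows "\<xi>1 = 0 \<and> \<xi>2 = 0"
proof -
  let ?P = "C1 False False (cst a0) (cst a3)" and ?R = "C2 False False (cst a0) (cst a1) (cst a2)"
  have nz: "p \<noteq> 0" if "eval2 p (x, y) \<noteq> 0" for p using that by auto
  have "eval2 (lookup ?P (Suc (Suc 0), 0)) (x, y) \<noteq> 0"
    "eval2 (lookup ?R (Suc (Suc 0), Suc 0)) (x, y) \<noteq> 0"
    using xy unfolding lookup_C1 lookup_C2 by (simp_all add: chart_data)
  then have ord: "dop_order ?P = 2" "dop_order ?R = 3"
    using ordb_chart by (intro dop_order_eqI[where i = 2 and j = 0] dop_order_eqI[where i = 2 and j = 1];
      auto simp: eval_nat_numeral intro!: nz)+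
  have mem: "P \<in> chart_system False False {?P, ?R}" if "P \<in> {?P, ?R}" for P
    unfolding chart_system_def using that chart_form_id by (intro left_ideal.gen) blast
  have "principal_symbol P (x, y) (\<xi>1, \<xi>2) = 0" if "P \<in> {?P, ?R}" for P
    using \<xi> mem[OF that] by (auto simp: char_variety_def)
  then have "esymb (x, y) \<xi>1 \<xi>2 2 ?P = 0" "esymb (x, y) \<xi>1 \<xi>2 3 ?R = 0"
    using ord by (metis insertI1 insertI2 principal_symbol_esymb singletonI)+
  then have q: "(1 - x\<^sup>2) * \<xi>1\<^sup>2 + 2 * (1 - x * y) * \<xi>1 * \<xi>2 + (1 - y\<^sup>2) * \<xi>2\<^sup>2 = 0"
    and c: "2 * (x - y) * \<xi>1 * \<xi>2 * ((1 - x\<^sup>2) * \<xi>1 + (1 - y\<^sup>2) * \<xi>2) = 0"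
    unfolding esymb_expand lookup_C1 lookup_C2 by (simp_all add: chart_data algebra_simps power2_eq_square)
  consider "\<xi>1 = 0" | "\<xi>2 = 0" | "(1 - x\<^sup>2) * \<xi>1 + (1 - y\<^sup>2) * \<xi>2 = 0"
    using c xy(3) by auto
  then show ?thesis
  proof cases
    case 3
    \<comment> \<open>Inserting the linear relation into \<open>1 - x\<^sup>2\<close> times the
      quadratic form leaves \<open>1 - y\<^sup>2\<close> times \<open>(1 - x\<^sup>2) + (1 -
      y\<^sup>2) - 2 (1 - x y) = - (x - y)\<^sup>2\<close>, the coefficient already met in the
      elimination.\<close>
    have "(1 - y\<^sup>2) * (x - y)\<^sup>2 * \<xi>2\<^sup>2 = 0" using q 3 by algebra
    then have "\<xi>2 = 0" using xy by auto
    then show ?thesis using 3 xy by auto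
  qed (use q xy in auto)
qed

lemma singular_locus_Z2:
  "singular_locus (Z2_gens A0 A1 A2 A3) =
    {(p1, p2). p1 \<in> {Fin 1, Fin (-1), Infty} \<or> p2 \<in> {Fin 1, Fin (-1), Infty} \<or> p1 = p2}"
proof (intro equalityI subsetI)
  fix p assume "p \<in> singular_locus (Z2_gens A0 A1 A2 A3)"
  then obtain p1 p2 \<xi>1 \<xi>2 where p: "p = (p1, p2)" and \<xi>: "\<xi>1 \<noteq> 0 \<or> \<xi>2 \<noteq> 0"
    "((chart_coord p1, chart_coord p2), (\<xi>1, \<xi>2)) \<in> char_variety (chart_system (p1 = Infty) (p2 = Infty) (Z2_gens A0 A1 A2 A3))"
    by (auto simp: singular_locus_def)
  show "p \<in> {(p1, p2). p1 \<in> {Fin 1, Fin (-1), Infty} \<or> p2 \<in> {Fin 1, Fin (-1), Infty} \<or> p1 = p2}"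
  proof (rule ccontr)
    assume n: "\<not> ?thesis"
    then obtain x y where xy: "p1 = Fin x" "p2 = Fin y" by (cases p1; cases p2) (auto simp: p)
    then have "x\<^sup>2 \<noteq> 1" "y\<^sup>2 \<noteq> 1" "x \<noteq> y" using n by (auto simp: p power2_eq_1_iff)
    then show False using \<xi> regular_point by (auto simp: xy Z2_gens_def Z2_gens_chart)
  qed
next
  fix p assume "p \<in> {(p1, p2). p1 \<in> {Fin 1, Fin (-1), Infty} \<or> p2 \<in> {Fin 1, Fin (-1), Infty} \<or> p1 = p2}"
  then obtain p1 p2 where p: "p = (p1, p2)"
    and s: "p1 \<in> {Fin 1, Fin (-1), Infty} \<or> p2 \<in> {Fin 1, Fin (-1), Infty} \<or> p1 = p2" by auto
  let ?e1 = "p1 = Infty" and ?e2 = "p2 = Infty" and ?q = "(chart_coord p1, chart_coord p2)"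
  \<comment> \<open>The symbol of \<open>C2\<close> contains no pure cube, and this passes to every
    quotient \<open>S\<close>. Thus \<open>(1, 0)\<close> and \<open>(0, 1)\<close> always annul the
    cubic symbol, and only the quadratic one remains to be tested.\<close>
  have zero: "eval2 (lookup S (Suc (Suc (Suc 0)), 0)) ?q = 0"
    "eval2 (lookup S (0, Suc (Suc (Suc 0)))) ?q = 0"
    if "C2 ?e1 ?e2 b0 b1 b2 = fmult f S" "f \<noteq> 0" for b0 b1 b2 f S
  proof -
    have "f * lookup S k = lookup (C2 ?e1 ?e2 b0 b1 b2) k" for k
      using that(1) by simp
    then show "eval2 (lookup S (Suc (Suc (Suc 0)), 0)) ?q = 0"
      "eval2 (lookup S (0, Suc (Suc (Suc 0)))) ?q = 0"
      using that(2) lookup_C2 by (metis mult_eq_0_iff eval2_simps(6))+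
  qed
  note C = char_variety_chart[where ?e1.0 = ?e1 and ?e2.0 = ?e2 and q = ?q, unfolded esymb_expand lookup_C1]
  have "\<exists>\<xi>1 \<xi>2. (\<xi>1 \<noteq> 0 \<or> \<xi>2 \<noteq> 0) \<and> (?q, (\<xi>1, \<xi>2)) \<in> char_variety (chart_system ?e1 ?e2 (Z2_gens A0 A1 A2 A3))"
  proof -
    \<comment> \<open>At infinity the chart coordinate is 0, where \<open>lead\<close> vanishes
      through its factor \<open>m\<^sup>2\<close>; hence the point with both coordinates infinite
      belongs to the first two cases and the diagonal case is purely affine.\<close>
    consider "eval2 (lead ?e1 t1) ?q = 0" | "eval2 (lead ?e2 t2) ?q = 0"
      | "\<not> ?e1" "\<not> ?e2" "p1 = p2"
      using s by (cases p1; cases p2) (auto simp: chart_data)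
    then show ?thesis
    proof cases
      case 1
      show ?thesis
        unfolding Z2_gens_def Z2_gens_chart
        by (rule exI[of _ 1], rule exI[of _ 0], rule conjI, simp, rule C) (use 1 in \<open>auto dest: zero\<close>)
    next
      case 2
      show ?thesis
        unfolding Z2_gens_def Z2_gens_chart
        by (rule exI[of _ 0], rule exI[of _ 1], rule conjI, simp, rule C) (use 2 in \<open>auto dest: zero\<close>)
    next
      case 3
      show ?thesis
        unfolding Z2_gens_def Z2_gens_chart
        by (rule exI[of _ 1], rule exI[of _ "- 1"], rule conjI, simp, rule C)
          (use 3 in \<open>auto simp: lookup_C2 chart_data power2_eq_square algebra_simps\<close>)
    qed
  qed
  then show "p \<in> singular_locus (Z2_gens A0 A1 A2 A3)"
    by (auto simp: p singular_locus_def)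
qed

theorem theorem3p1:
  fixes A0 A1 A2 A3 :: complex
  shows "has_rank (Z2 A0 A1 A2 A3) 6 \<and>
    singular_locus (Z2_gens A0 A1 A2 A3) =
      {(p1, p2). p1 \<in> {Fin 1, Fin (-1), Infty} \<or> p2 \<in> {Fin 1, Fin (-1), Infty} \<or> p1 = p2}"
  using has_rank_Z2 singular_locus_Z2 by blast

end
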